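(* Let $T\in\mathcal{K}(V)$ be bisectorial of angle $\omega\in(0,\frac{\pi}{2})$, let $\theta\in(\omega,\frac{\pi}{2})$, let $p$ be an intrinsic polynomial of degree $m\in\mathbb{N}_0$, and $f\in\mathcal{SH}_L^{\mathrm{bnd}}(D_\theta)$. If $pf\in\mathcal{SH}_L^{\mathrm{bnd}}(D_\theta)$, then $\operatorname{ran}(f(T))\subseteq\operatorname{dom}(T^m)$ and $$(pf)(T)=p[T]f(T),$$ where $f(T)$ and $(pf)(T)$ are given by the extended $\omega$-functional calculus.
   Context: Clifford setting. Fix an integer $n\geq 1$. $\mathbb{R}_n$ is the real Clifford algebra generated by $e_1,\dots,e_n$ with $e_i^2=-1$, $e_ie_j=-e_je_i$ ($i\neq j$), with basis $e_A=e_{i_1}\cdots e_{i_r}$ for $A=(i_1<\dots<i_r)$, $e_\emptyset=1$, and $|s|^2=\sum_As_A^2$ for $s=\sum_As_Ae_A$. Paravectors: $\mathbb{R}^{n+1}=\{s_0+s_1e_1+\dots+s_ne_n\}\subseteq\mathbb{R}_n$ with $\overline{s}=s_0-s_1e_1-\dots-s_ne_n$. $\mathbb{S}=\{s\in\mathbb{R}^{n+1}: s_0=0,|s|=1\}$ and $\mathbb{C}_J=\{x+Jy: x,y\in\mathbb{R}\}$ for $J\in\mathbb{S}$. $U\subseteq\mathbb{R}^{n+1}$ is axially symmetric if $x+Jy\in U$ ($x,y\in\mathbb{R}$, $J\in\mathbb{S}$) implies $x+Iy\in U$ for all $I\in\mathbb{S}$. Slice hyperholomorphic functions. For $U$ open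 and axially symmetric, $f:U\to\mathbb{R}_n$ is left slice hyperholomorphic ($f\in\mathcal{SH}_L(U)$) if there are continuously differentiable $f_0,f_1:\{(x,y)\in\mathbb{R}^2: x+\mathbb{S}y\subseteq U\}\to\mathbb{R}_n$ with $f(x+Jy)=f_0(x,y)+Jf_1(x,y)$ for all $J\in\mathbb{S}$, $f_0(x,-y)=f_0(x,y)$, $f_1(x,-y)=-f_1(x,y)$, $\partial_xf_0=\partial_yf_1$, $\partial_yf_0=-\partial_xf_1$. Operators. $V_\mathbb{R}$ is a real Banach space, $V=\{\sum_Av_A\otimes e_A: v_A\in V_\mathbb{R}\}$ the corresponding Clifford module with norm $\|v\|^2=\sum_A\|v_A\|^2$ and the natural left and right multiplications by $\mathbb{R}_n$. $\mathcal{B}(V)$: bounded everywhere defined right-linear operators; $\mathcal{K}(V)$: closed right-linear operators $T:\operatorname{dom}(T)\to V$ with right-linear domain $\operatorname{dom}(T)\subseteq V$. A Clifford number $a$ is identified with the operator $v\mapsto av$, so $(aT)v=a(Tv)$, $(Ta)v=T(av)$. For $s\in\mathbb{R}^{n+1}$, $Q_s[T]=T^2-2s_0T+|s|^2$ on $\operatorname{dom}(T^2)$; $\rho_S(T)=\{s\in\mathbb{R}^{n+1}: Q_s[T]^{-1}\in\mathcal{B}(V)\}$, $\sigma_S(T)=\mathbb{R}^{n+1}\setminus\rho_S(T)$, and $S_L^{-1}(s,T)=Q_s[T]^{-1}\overline{s}-TQ_s[T]^{-1}$ for $s\in\rho_S(T)$. Bisectorial operators. For $\omega\in(0,\frac{\pi}{2})$,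 $I_\omega=(-\omega,\omega)\cup(\pi-\omega,\pi+\omega)$ and $D_\omega=\{re^{J\phi}: r>0,\,J\in\mathbb{S},\,\phi\in I_\omega\}\subseteq\mathbb{R}^{n+1}$. $T\in\mathcal{K}(V)$ is bisectorial of angle $\omega$ if $\sigma_S(T)\subseteq\overline{D_\omega}$ and for every $\varphi\in(\omega,\frac{\pi}{2})$ there is $C_\varphi\geq 0$ with $\|S_L^{-1}(s,T)\|\leq\frac{C_\varphi}{|s|}$ for all $s\in\mathbb{R}^{n+1}\setminus(D_\varphi\cup\{0\})$. $\omega$-functional calculus. $\mathcal{SH}_L^0(D_\theta)$ is the set of bounded $f\in\mathcal{SH}_L(D_\theta)$ with $\int_0^\infty|f(te^{J\phi})|\frac{dt}{t}<\infty$ for all $J\in\mathbb{S}$, $\phi\in I_\theta$. For $T$ bisectorial of angle $\omega$, $\theta\in(\omega,\frac{\pi}{2})$ and $f\in\mathcal{SH}_L^0(D_\theta)$, $$f(T)=\frac{1}{2\pi}\int_{\partial D_\varphi\cap\mathbb{C}_J}S_L^{-1}(s,T)ds_Jf(s):=\frac{1}{2\pi}\sum_\pm\int_\mathbb{R}S_L^{-1}(\gamma_\pm(t),T)\frac{\gamma_\pm'(t)}{J}f(\gamma_\pm(t))dt\in\mathcal{B}(V),$$ with $\gamma_\pm(t)=\pm|t|e^{-\operatorname{sgn}(t)J\varphi}$; it does not depend on the choice of $\varphi\in(\omega,\theta)$ and $J\in\mathbb{S}$. Extended $\omega$-functional calculus. $\mathcal{SH}_L^{\mathrm{bnd}}(D_\theta)$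 is the set of functions $f(s)=f_\infty+\frac{1}{1+s^2}(f_0-f_\infty)+\widetilde{f}(s)$ on $D_\theta$ with $f_0,f_\infty\in\mathbb{R}_n$, $\widetilde{f}\in\mathcal{SH}_L^0(D_\theta)$ (unique components). For such $f$, $f(T):=f_\infty+(1+T^2)^{-1}(f_0-f_\infty)+\widetilde{f}(T)\in\mathcal{B}(V)$, with $\widetilde{f}(T)$ from the $\omega$-functional calculus; here $1+T^2$ is boundedly invertible since $\mathbb{S}\subseteq\rho_S(T)$. Polynomials. An intrinsic polynomial of degree $m$ is $p(s)=p_0+p_1s+\dots+p_ms^m$ with real coefficients, $p_m\neq 0$; $p[T]=p_0+p_1T+\dots+p_mT^m$ with $\operatorname{dom}(p[T])=\operatorname{dom}(T^m)$. *)

theory Defs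
  imports "HOL-Analysis.Analysis" "HOL-Computational_Algebra.Polynomial"
begin

section \<open>The real Clifford algebra\<close>

text \<open>The generators are indexed by a finite linearly ordered type \<open>'n\<close>, so that the number of
  generators is \<open>n = CARD('n) \<ge> 1\<close>; an element is the family of its coefficients
  \<open>s\<^sub>A\<close>, \<open>A :: 'n set\<close>.\<close>

typedef 'n clifford = "UNIV :: ('n set \<Rightarrow> real) set"
  morphisms cl_coeff Cl by simp

lemma cl_coeff_Cl [simp]: "cl_coeff (Cl f) A = f A"
  by (simp add: Cl_inverse)

lemma cl_eq_iff: "a = b \<longleftrightarrow> (\<forall>A. cl_coeff a A = cl_coeff b A)"
  by (metis cl_coeff_inject ext)

text \<open>\<open>e\<^sub>A e\<^sub>B = cl_sign A B \<cdot> e\<^sub>C\<close> with \<open>C = sym_diff A B\<close>: reordering gives a factor \<open>-1\<close> for every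
  pair \<open>i \<in> A\<close>, \<open>j \<in> B\<close> with \<open>j < i\<close>, and \<open>e\<^sub>i\<^sup>2 = -1\<close> gives one for every pair with \<open>j = i\<close>.\<close>

definition cl_sign :: "'n::{finite,linorder} set \<Rightarrow> 'n set \<Rightarrow> real" where
  "cl_sign A B = (\<Prod>i\<in>A. \<Prod>j\<in>B. if j \<le> i then - 1 else 1)"

lemma prod_sym_diff:
  fixes f :: "'a::finite \<Rightarrow> real"
  assumes "\<And>i. f i * f i = 1"
  shows "prod f (sym_diff A B) = prod f A * prod f B"
proof -
  have A: "prod f A = prod f (A - B) * prod f (A \<inter> B)"
    by (metis Diff_disjoint Int_Diff_Un Int_Diff_disjoint finite mult.commute prod.union_disjoint)
  have B: "prod f B = prod f (B - A) * prod f (A \<inter> B)"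
    by (metis Int_Diff_Un Int_Diff_disjoint Int_commute finite mult.commute prod.union_disjoint)
  have S: "prod f (sym_diff A B) = prod f (A - B) * prod f (B - A)"
    by (rule prod.union_disjoint) auto
  have "prod f (A \<inter> B) * prod f (A \<inter> B) = 1"
    by (simp add: assms flip: prod.distrib)
  then show ?thesis unfolding A B S by (simp add: algebra_simps)
qed

lemma cl_sign_sq: "cl_sign A B * cl_sign A B = 1"
  unfolding cl_sign_def
  by (simp flip: prod.distrib) (auto intro!: prod.neutral)

lemma cl_sign_left: "cl_sign (sym_diff A B) C = cl_sign A C * cl_sign B C"
  unfolding cl_sign_def
  by (rule prod_sym_diff) (simp flip: prod.distrib, auto intro!: prod.neutral)

lemma cl_sign_right: "cl_sign A (sym_diff B C) = cl_sign A B * cl_sign A C"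
proof -
  have "(\<Prod>j\<in>sym_diff B C. if j \<le> i then - 1 else 1 :: real) =
      (\<Prod>j\<in>B. if j \<le> i then - 1 else 1) * (\<Prod>j\<in>C. if j \<le> i then - 1 else 1)" for i
    by (rule prod_sym_diff) simp
  then show ?thesis by (simp add: cl_sign_def prod.distrib)
qed

lemma cl_sign_empty [simp]: "cl_sign {} A = 1" "cl_sign A {} = 1"
  by (simp_all add: cl_sign_def)

instantiation clifford :: ("{finite,linorder}") real_algebra_1
begin

definition "0 = Cl (\<lambda>_. 0)"
definition "1 = Cl (\<lambda>A. if A = {} then 1 else 0)"
definition "a + b = Cl (\<lambda>A. cl_coeff a A + cl_coeff b A)"
definition "a - b = Cl (\<lambda>A. cl_coeff a A - cl_coeff b A)"
definition "- a = Cl (\<lambda>A. - cl_coeff a A)"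
definition "r *\<^sub>R a = Cl (\<lambda>A. r * cl_coeff a A)"

text \<open>The pairs \<open>(A, B)\<close> with \<open>sym_diff A B = C\<close> are those with \<open>B = sym_diff A C\<close>.\<close>
definition "a * b = Cl (\<lambda>C. \<Sum>A\<in>UNIV.
  cl_sign A (sym_diff A C) * cl_coeff a A * cl_coeff b (sym_diff A C))"

instance
proof
  have sd: "sym_diff A (sym_diff A B) = B" for A B :: "'a set" by auto
  have sa: "sym_diff (sym_diff A B) C = sym_diff A (sym_diff B C)" for A B C :: "'a set" by auto
  fix a b c :: "'a clifford" and r q :: real
  show "a * b * c = a * (b * c)"
  proof -
    have "(\<Sum>B\<in>UNIV. cl_sign B (sym_diff B D) *
        (\<Sum>A\<in>UNIV. cl_sign A (sym_diff A B) * cl_coeff a A * cl_coeff b (sym_diff A B)) *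
        cl_coeff c (sym_diff B D)) =
      (\<Sum>A\<in>UNIV. cl_sign A (sym_diff A D) * cl_coeff a A *
        (\<Sum>B\<in>UNIV. cl_sign B (sym_diff B (sym_diff A D)) * cl_coeff b B *
          cl_coeff c (sym_diff B (sym_diff A D))))" for D
    proof -
      have "(\<Sum>B\<in>UNIV. cl_sign B (sym_diff B D) *
        (\<Sum>A\<in>UNIV. cl_sign A (sym_diff A B) * cl_coeff a A * cl_coeff b (sym_diff A B)) *
        cl_coeff c (sym_diff B D)) =
       (\<Sum>A\<in>UNIV. \<Sum>B\<in>UNIV. cl_sign B (sym_diff B D) * cl_sign A (sym_diff A B) *
          cl_coeff a A * cl_coeff b (sym_diff A B) * cl_coeff c (sym_diff B D))"
        by (subst sum.swap) (simp add: sum_distrib_left sum_distrib_right mult.assoc)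
      also have "\<dots> = (\<Sum>A\<in>UNIV. \<Sum>B\<in>UNIV. cl_sign A (sym_diff A D) * cl_coeff a A *
        (cl_sign B (sym_diff B (sym_diff A D)) * cl_coeff b B *
          cl_coeff c (sym_diff B (sym_diff A D))))"
      proof (rule sum.cong[OF refl])
        fix A :: "'a set"
        show "(\<Sum>B\<in>UNIV. cl_sign B (sym_diff B D) * cl_sign A (sym_diff A B) *
          cl_coeff a A * cl_coeff b (sym_diff A B) * cl_coeff c (sym_diff B D)) =
          (\<Sum>B\<in>UNIV. cl_sign A (sym_diff A D) * cl_coeff a A *
        (cl_sign B (sym_diff B (sym_diff A D)) * cl_coeff b B *
          cl_coeff c (sym_diff B (sym_diff A D))))"
        proof (rule sum.reindex_bij_witness[of _ "sym_diff A" "sym_diff A"])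
          fix B :: "'a set"
          have 1: "sym_diff (sym_diff A B) (sym_diff A D) = sym_diff B D" by auto
          show "cl_sign A (sym_diff A D) * cl_coeff a A *
              (cl_sign (sym_diff A B) (sym_diff (sym_diff A B) (sym_diff A D)) *
               cl_coeff b (sym_diff A B) * cl_coeff c (sym_diff (sym_diff A B) (sym_diff A D))) =
              cl_sign B (sym_diff B D) * cl_sign A (sym_diff A B) * cl_coeff a A *
              cl_coeff b (sym_diff A B) * cl_coeff c (sym_diff B D)"
            unfolding 1 unfolding cl_sign_left cl_sign_right
            using cl_sign_sq[of A D] by (simp add: algebra_simps)
        qed (auto simp: sd)
      qed
      finally show ?thesis by (simp add: sum_distrib_left)
    qed
    then show ?thesis by (simp add: cl_eq_iff times_clifford_def)
  qed
  have "(\<Sum>A\<in>UNIV. cl_sign A (sym_diff A C) * (if A = {} then 1 else 0) *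
      cl_coeff a (sym_diff A C)) = cl_coeff a C" for C
    by (subst sum.mono_neutral_right[of _ "{{}}"]) auto
  then show "1 * a = a" by (simp add: cl_eq_iff times_clifford_def one_clifford_def)
  have *: "sym_diff A C = {} \<longleftrightarrow> A = C" for A C :: "'a set" by auto
  have "(\<Sum>A\<in>UNIV. cl_sign A (sym_diff A C) * cl_coeff a A *
      (if sym_diff A C = {} then 1 else 0)) = cl_coeff a C" for C
    unfolding * by (subst sum.mono_neutral_right[of _ "{C}"]) auto
  then show "a * 1 = a" by (simp only: cl_eq_iff times_clifford_def one_clifford_def cl_coeff_Cl) simp
  show "(0::'a clifford) \<noteq> 1"
    by (auto simp: cl_eq_iff zero_clifford_def one_clifford_def)
qed (auto simp: cl_eq_iff zero_clifford_def plus_clifford_def minus_clifford_def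
    uminus_clifford_def scaleR_clifford_def times_clifford_def algebra_simps sum.distrib
    sum_distrib_left)

end

lemma cl_coeff_simps [simp]:
  "cl_coeff 0 A = 0" "cl_coeff 1 A = (if A = {} then 1 else 0)"
  "cl_coeff (a + b) A = cl_coeff a A + cl_coeff b A"
  "cl_coeff (a - b) A = cl_coeff a A - cl_coeff b A"
  "cl_coeff (- a) A = - cl_coeff a A" "cl_coeff (r *\<^sub>R a) A = r * cl_coeff a A"
  by (simp_all add: zero_clifford_def one_clifford_def plus_clifford_def minus_clifford_def
    uminus_clifford_def scaleR_clifford_def)

definition cl_basis :: "'n::{finite,linorder} set \<Rightarrow> 'n clifford" where
  "cl_basis A = Cl (\<lambda>B. if B = A then 1 else 0)"

abbreviation cl_gen :: "'n::{finite,linorder} \<Rightarrow> 'n clifford" where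
  "cl_gen i \<equiv> cl_basis {i}"

lemma cl_basis_mult: "cl_basis A * cl_basis B = cl_sign A B *\<^sub>R cl_basis (sym_diff A B)"
proof -
  have "(\<Sum>D\<in>UNIV. cl_sign D (sym_diff D C) * (if D = A then 1 else 0) *
      (if sym_diff D C = B then 1 else 0)) = cl_sign A B * (if C = sym_diff A B then 1 else 0)" for C
    by (subst sum.mono_neutral_right[of _ "{A}"]) auto
  then show ?thesis
    by (simp only: cl_eq_iff times_clifford_def cl_basis_def cl_coeff_simps cl_coeff_Cl) simp
qed

lemma cl_basis_empty: "cl_basis {} = 1"
  by (auto simp: cl_eq_iff cl_basis_def)

lemma cl_gen_square: "cl_gen i * cl_gen i = - 1"
  by (simp add: cl_basis_mult cl_sign_def cl_basis_empty)

lemma cl_gen_anticommute: "i \<noteq> j \<Longrightarrow> cl_gen i * cl_gen j = - (cl_gen j * cl_gen i)"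
  by (auto simp: cl_basis_mult cl_sign_def insert_commute Un_commute)

lemma cl_basis_eq_prod: "cl_basis A = prod_list (map cl_gen (sorted_list_of_set A))"
proof (induction "card A" arbitrary: A)
  case 0
  then show ?case by (simp add: cl_basis_empty)
next
  case (Suc k)
  then have ne: "A \<noteq> {}" by auto
  let ?m = "Min A" and ?B = "A - {Min A}"
  have "card ?B = k" using Suc ne by simp
  then have IH: "cl_basis ?B = prod_list (map cl_gen (sorted_list_of_set ?B))"
    using Suc by blast
  have sgn: "cl_sign {?m} ?B = 1"
    unfolding cl_sign_def by (auto intro!: prod.neutral) (metis Min_le antisym finite)
  have sd: "sym_diff {?m} ?B = A" using Min_in[OF finite ne] by blast
  have "cl_gen ?m * cl_basis ?B = cl_basis A"
    unfolding cl_basis_mult sgn sd by simp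
  then show ?case using ne IH by (simp add: sorted_list_of_set_nonempty)
qed

instantiation clifford :: ("{finite,linorder}") real_inner
begin

definition "inner a b = (\<Sum>A\<in>UNIV. cl_coeff a A * cl_coeff b A)"
definition "norm (a::'a clifford) = sqrt (\<Sum>A\<in>UNIV. (cl_coeff a A)\<^sup>2)"
definition "dist (a::'a clifford) b = norm (a - b)"
definition "sgn (a::'a clifford) = a /\<^sub>R norm a"
definition "uniformity = (INF e\<in>{0<..}. principal {(x::'a clifford, y). dist x y < e})"
definition "open (U::'a clifford set) \<longleftrightarrow>
  (\<forall>x\<in>U. eventually (\<lambda>(x', y). x' = x \<longrightarrow> y \<in> U) uniformity)"

instance
proof
  fix a b c :: "'a clifford" and r :: real
  have "(\<Sum>A\<in>UNIV. cl_coeff a A * cl_coeff a A) = 0 \<longleftrightarrow> (\<forall>A. cl_coeff a A = 0)"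
    by (subst sum_nonneg_eq_0_iff) auto
  then show "inner a a = 0 \<longleftrightarrow> a = 0"
    by (simp add: inner_clifford_def cl_eq_iff)
qed (auto simp: inner_clifford_def norm_clifford_def dist_clifford_def sgn_clifford_def
    uniformity_clifford_def open_clifford_def algebra_simps sum.distrib sum_distrib_left
    power2_eq_square intro: sum_nonneg)

end

instantiation clifford :: ("{finite,linorder}") euclidean_space
begin

definition "(Basis :: 'a clifford set) = range cl_basis"

instance
proof
  have 1: "inner x (cl_basis A) = cl_coeff x A" for A and x :: "'a clifford"
    by (simp add: inner_clifford_def cl_basis_def if_distrib sum.delta cong: if_cong)
  show "(Basis :: 'a clifford set) \<noteq> {}" "finite (Basis :: 'a clifford set)"
    by (auto simp: Basis_clifford_def)
  show "inner u v = (if u = v then 1 else 0)" if "u \<in> Basis" "v \<in> Basis" for u v :: "'a clifford"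
    using that by (auto simp: Basis_clifford_def 1) (auto simp: cl_basis_def)
  show "(\<forall>u\<in>Basis. inner x u = 0) \<longleftrightarrow> x = 0" for x :: "'a clifford"
    by (auto simp: Basis_clifford_def 1 cl_eq_iff)
qed

end

text \<open>Only invertible arguments matter, in particular nonzero paravectors such as \<open>1 + s\<^sup>2\<close>.\<close>
definition cl_inverse :: "'n::{finite,linorder} clifford \<Rightarrow> 'n clifford" where
  "cl_inverse a = (THE b. a * b = 1 \<and> b * a = 1)"

definition paravectors :: "'n::{finite,linorder} clifford set" where
  "paravectors = {of_real x0 + (\<Sum>i\<in>UNIV. x i *\<^sub>R cl_gen i) | x0 x. True}"

definition cl_real :: "'n::{finite,linorder} clifford \<Rightarrow> real" where
  "cl_real s = cl_coeff s {}"

text \<open>Conjugation, on paravectors: \<open>s\<^sub>0 - s\<^sub>1 e\<^sub>1 - \<dots> - s\<^sub>n e\<^sub>n\<close>.\<close>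
definition pv_cnj :: "'n::{finite,linorder} clifford \<Rightarrow> 'n clifford" where
  "pv_cnj s = of_real (cl_real s) - (\<Sum>i\<in>UNIV. cl_coeff s {i} *\<^sub>R cl_gen i)"

definition imag_units :: "'n::{finite,linorder} clifford set" where
  "imag_units = {s \<in> paravectors. cl_real s = 0 \<and> norm s = 1}"

definition slice_point :: "'n::{finite,linorder} clifford \<Rightarrow> real \<Rightarrow> real \<Rightarrow> 'n clifford" where
  "slice_point J x y = of_real x + y *\<^sub>R J"

text \<open>\<open>r e\<^bsup>J\<phi>\<^esup>\<close>\<close>
definition cl_polar :: "real \<Rightarrow> 'n::{finite,linorder} clifford \<Rightarrow> real \<Rightarrow> 'n clifford" where
  "cl_polar r J \<phi> = r *\<^sub>R slice_point J (cos \<phi>) (sin \<phi>)"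


section \<open>Slice hyperholomorphic functions\<close>

text \<open>Functions on \<open>U\<close> are represented by total functions of which only the values on \<open>U\<close> are used.
  The notion is applied only to sets \<open>U\<close> that are axially symmetric and open relative to
  the paravectors, for which \<open>slice_dom U\<close> is open.\<close>

definition slice_dom :: "'n::{finite,linorder} clifford set \<Rightarrow> (real \<times> real) set" where
  "slice_dom U = {(x, y). \<forall>J\<in>imag_units. slice_point J x y \<in> U}"

definition C1_partials :: "(real \<times> real) set \<Rightarrow> (real \<times> real \<Rightarrow> 'a::real_normed_vector) \<Rightarrow>
    (real \<times> real \<Rightarrow> 'a) \<Rightarrow> (real \<times> real \<Rightarrow> 'a) \<Rightarrow> bool" where
  "C1_partials S f fx fy \<longleftrightarrow> continuous_on S fx \<and> continuous_on S fy \<and>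
     (\<forall>z\<in>S. (f has_derivative (\<lambda>(h, k). h *\<^sub>R fx z + k *\<^sub>R fy z)) (at z))"

definition SH_L ::
    "'n::{finite,linorder} clifford set \<Rightarrow> ('n clifford \<Rightarrow> 'n clifford) set" where
  "SH_L U = {f. \<exists>f0 f1 f0x f0y f1x f1y.
     C1_partials (slice_dom U) f0 f0x f0y \<and> C1_partials (slice_dom U) f1 f1x f1y \<and>
     (\<forall>(x, y)\<in>slice_dom U.
        (\<forall>J\<in>imag_units. f (slice_point J x y) = f0 (x, y) + J * f1 (x, y)) \<and>
        f0 (x, - y) = f0 (x, y) \<and> f1 (x, - y) = - f1 (x, y) \<and>
        f0x (x, y) = f1y (x, y) \<and> f0y (x, y) = - f1x (x, y))}"

definition I_sect :: "real \<Rightarrow> real set" where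
  "I_sect \<omega> = {- \<omega><..<\<omega>} \<union> {pi - \<omega><..<pi + \<omega>}"

definition D_sect :: "real \<Rightarrow> 'n::{finite,linorder} clifford set" where
  "D_sect \<omega> = {cl_polar r J \<phi> | r J \<phi>. r > 0 \<and> J \<in> imag_units \<and> \<phi> \<in> I_sect \<omega>}"

definition SH_L0 :: "real \<Rightarrow> ('n::{finite,linorder} clifford \<Rightarrow> 'n clifford) set" where
  "SH_L0 \<theta> = {f \<in> SH_L (D_sect \<theta>). bounded (f ` D_sect \<theta>) \<and>
     (\<forall>J\<in>imag_units. \<forall>\<phi>\<in>I_sect \<theta>.
        set_integrable lborel {0<..} (\<lambda>t. norm (f (cl_polar t J \<phi>)) / t))}"

text \<open>The remainder \<open>f~\<close> of \<open>f\<close> for given \<open>f\<^sub>0\<close> and \<open>f\<^sub>\<infinity>\<close>.\<close>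
definition bnd_rest :: "('n::{finite,linorder} clifford \<Rightarrow> 'n clifford) \<Rightarrow>
    'n clifford \<Rightarrow> 'n clifford \<Rightarrow> 'n clifford \<Rightarrow> 'n clifford" where
  "bnd_rest f f0 finf = (\<lambda>s. f s - (finf + cl_inverse (1 + s\<^sup>2) * (f0 - finf)))"

definition SH_Lbnd :: "real \<Rightarrow> ('n::{finite,linorder} clifford \<Rightarrow> 'n clifford) set" where
  "SH_Lbnd \<theta> = {f. \<exists>f0 finf. bnd_rest f f0 finf \<in> SH_L0 \<theta>}"

text \<open>The pair \<open>(f\<^sub>0, f\<^sub>\<infinity>)\<close>, which is unique for \<open>f \<in> SH_Lbnd \<theta>\<close>.\<close>
definition bnd_components :: "real \<Rightarrow> ('n::{finite,linorder} clifford \<Rightarrow> 'n clifford) \<Rightarrow>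
    'n clifford \<times> 'n clifford" where
  "bnd_components \<theta> f = (SOME (f0, finf). bnd_rest f f0 finf \<in> SH_L0 \<theta>)"


section \<open>Operators on Clifford modules\<close>

text \<open>For a real Banach space \<open>'v\<close>, the Clifford module \<open>V\<close> consists of the families \<open>(v\<^sub>A)\<close>,
  representing the sum of all \<open>v\<^sub>A \<otimes> e\<^sub>A\<close>; the norm of \<^type>\<open>vec\<close> is the Euclidean combination of the
  norms of the \<open>v\<^sub>A\<close>.\<close>

type_synonym ('v, 'n) cl_module = "('v, 'n set) vec"

definition lmul :: "'n::{finite,linorder} clifford \<Rightarrow> ('v::real_normed_vector, 'n) cl_module \<Rightarrow>
    ('v, 'n) cl_module" where
  "lmul a v = (\<chi> C. \<Sum>A\<in>UNIV.
     (cl_coeff a A * cl_sign A (sym_diff A C)) *\<^sub>R (v $ sym_diff A C))"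

definition rmul :: "('v::real_normed_vector, 'n::{finite,linorder}) cl_module \<Rightarrow> 'n clifford \<Rightarrow>
    ('v, 'n) cl_module" where
  "rmul v a = (\<chi> C. \<Sum>A\<in>UNIV.
     (cl_coeff a A * cl_sign (sym_diff A C) A) *\<^sub>R (v $ sym_diff A C))"

text \<open>Unbounded operators are partial maps on \<open>V\<close>; everywhere defined ones are total functions.\<close>

definition bounded_ops :: "(('v::real_normed_vector, 'n::{finite,linorder}) cl_module \<Rightarrow>
    ('v, 'n) cl_module) set" where
  "bounded_ops = {B. bounded_linear B \<and> (\<forall>v a. B (rmul v a) = rmul (B v) a)}"

definition closed_ops :: "(('v::real_normed_vector, 'n::{finite,linorder}) cl_module \<rightharpoonup>
    ('v, 'n) cl_module) set" where
  "closed_ops = {T. T 0 = Some 0 \<and>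
     (\<forall>v w x y. T v = Some x \<and> T w = Some y \<longrightarrow> T (v + w) = Some (x + y)) \<and>
     (\<forall>v x a. T v = Some x \<longrightarrow> T (rmul v a) = Some (rmul x a)) \<and>
     closed {(v, x). T v = Some x}}"

fun op_pow :: "('a \<rightharpoonup> 'a) \<Rightarrow> nat \<Rightarrow> ('a \<rightharpoonup> 'a)" where
  "op_pow T 0 = Some"
| "op_pow T (Suc k) = T \<circ>\<^sub>m op_pow T k"

text \<open>\<open>p[T]\<close> for \<open>p \<noteq> 0\<close>, with domain that of \<open>T\<^sup>m\<close>, \<open>m = degree p\<close>.\<close>
definition op_poly :: "real poly \<Rightarrow> ('a::real_vector \<rightharpoonup> 'a) \<Rightarrow> ('a \<rightharpoonup> 'a)" where
  "op_poly p T v = (if v \<in> dom (op_pow T (degree p))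
     then Some (\<Sum>i\<le>degree p. coeff p i *\<^sub>R the (op_pow T i v)) else None)"

definition cl_poly :: "real poly \<Rightarrow> 'n::{finite,linorder} clifford \<Rightarrow> 'n clifford" where
  "cl_poly p s = (\<Sum>i\<le>degree p. coeff p i *\<^sub>R s ^ i)"

definition op_inv :: "('a \<rightharpoonup> 'a) \<Rightarrow> 'a \<Rightarrow> 'a" where
  "op_inv A w = (THE v. A v = Some w)"

definition boundedly_invertible ::
    "(('v::real_normed_vector, 'n::{finite,linorder}) cl_module \<rightharpoonup> ('v, 'n) cl_module) \<Rightarrow> bool"
  where
  "boundedly_invertible A \<longleftrightarrow> (\<forall>w. \<exists>!v. A v = Some w) \<and> op_inv A \<in> bounded_ops"

definition Q_op :: "'n::{finite,linorder} clifford \<Rightarrow>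
    (('v::real_normed_vector, 'n) cl_module \<rightharpoonup> ('v, 'n) cl_module) \<Rightarrow>
    (('v, 'n) cl_module \<rightharpoonup> ('v, 'n) cl_module)" where
  "Q_op s T = op_poly [:(norm s)\<^sup>2, - 2 * cl_real s, 1:] T"

definition S_resolvent_set ::
    "(('v::real_normed_vector, 'n::{finite,linorder}) cl_module \<rightharpoonup> ('v, 'n) cl_module) \<Rightarrow>
     'n clifford set" where
  "S_resolvent_set T = {s \<in> paravectors. boundedly_invertible (Q_op s T)}"

definition S_spectrum ::
    "(('v::real_normed_vector, 'n::{finite,linorder}) cl_module \<rightharpoonup> ('v, 'n) cl_module) \<Rightarrow>
     'n clifford set" where
  "S_spectrum T = paravectors - S_resolvent_set T"

definition S_L_inv :: "'n::{finite,linorder} clifford \<Rightarrow>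
    (('v::real_normed_vector, 'n) cl_module \<rightharpoonup> ('v, 'n) cl_module) \<Rightarrow>
    ('v, 'n) cl_module \<Rightarrow> ('v, 'n) cl_module" where
  "S_L_inv s T v = op_inv (Q_op s T) (lmul (pv_cnj s) v) - the (T (op_inv (Q_op s T) v))"

text \<open>\<^const>\<open>onorm\<close> is meaningful for bounded operators only, hence the explicit boundedness
  (automatic for closed \<open>T\<close> and \<open>s\<close> in the S-resolvent set, by the closed graph theorem).\<close>
definition bisectorial :: "real \<Rightarrow>
    (('v::banach, 'n::{finite,linorder}) cl_module \<rightharpoonup> ('v, 'n) cl_module) \<Rightarrow> bool" where
  "bisectorial \<omega> T \<longleftrightarrow> T \<in> closed_ops \<and> 0 < \<omega> \<and> \<omega> < pi / 2 \<and>
     S_spectrum T \<subseteq> closure (D_sect \<omega>) \<and>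
     (\<forall>\<phi>\<in>{\<omega><..<pi / 2}. \<exists>C\<ge>0. \<forall>s\<in>paravectors - (D_sect \<phi> \<union> {0}).
        bounded_linear (S_L_inv s T) \<and> onorm (S_L_inv s T) \<le> C / norm s)"


section \<open>The functional calculi\<close>

text \<open>The paths \<open>\<gamma>\<^sub>\<plusminus>\<close>, with \<open>\<sigma> = 1\<close> and \<open>\<sigma> = -1\<close>, respectively.\<close>
definition sect_path :: "real \<Rightarrow> real \<Rightarrow> 'n::{finite,linorder} clifford \<Rightarrow> real \<Rightarrow> 'n clifford" where
  "sect_path \<sigma> \<phi> J t = cl_polar (\<sigma> * \<bar>t\<bar>) J (- sgn t * \<phi>)"

text \<open>The integral is taken in the Banach space of bounded operators. It is a gauge integral because
  the Bochner integral of the library requires a second countable space; for the norm-continuous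
  (away from \<open>t = 0\<close>), absolutely integrable integrands at hand both integrals agree.
  The result depends neither on \<open>\<phi>\<close> nor on \<open>J\<close>.\<close>
definition omega_calc :: "real \<Rightarrow> 'n::{finite,linorder} clifford \<Rightarrow>
    (('v::banach, 'n) cl_module \<rightharpoonup> ('v, 'n) cl_module) \<Rightarrow> ('n clifford \<Rightarrow> 'n clifford) \<Rightarrow>
    ('v, 'n) cl_module \<Rightarrow>\<^sub>L ('v, 'n) cl_module" where
  "omega_calc \<phi> J T f = (1 / (2 * pi)) *\<^sub>R (\<Sum>\<sigma>\<in>{1, - 1}. integral UNIV (\<lambda>t.
     Blinfun (\<lambda>v. S_L_inv (sect_path \<sigma> \<phi> J t) T
       (lmul (vector_derivative (sect_path \<sigma> \<phi> J) (at t) * cl_inverse J * f (sect_path \<sigma> \<phi> J t)) v))))"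

definition ext_calc :: "real \<Rightarrow> real \<Rightarrow> 'n::{finite,linorder} clifford \<Rightarrow>
    (('v::banach, 'n) cl_module \<rightharpoonup> ('v, 'n) cl_module) \<Rightarrow> ('n clifford \<Rightarrow> 'n clifford) \<Rightarrow>
    ('v, 'n) cl_module \<Rightarrow> ('v, 'n) cl_module" where
  "ext_calc \<theta> \<phi> J T f = (case bnd_components \<theta> f of (f0, finf) \<Rightarrow>
     (\<lambda>v. lmul finf v + op_inv (op_poly [:1, 0, 1:] T) (lmul (f0 - finf) v) +
          blinfun_apply (omega_calc \<phi> J T (bnd_rest f f0 finf)) v))"

end

theory Submission
  imports Defs
begin

text \<open>Multiplied by \<open>(1 + T\<^sup>2)\<^bsup>-m-1\<^esup>\<close>, the claim only involves the bounded rational functions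
  \<open>(1 + s\<^sup>2)\<^sup>-\<^sup>1\<close> and \<open>s (1 + s\<^sup>2)\<^sup>-\<^sup>1\<close> of \<open>T\<close>. For these, the resolvent identity
  \<open>(1 + T\<^sup>2)\<^sup>-\<^sup>1 S\<^sub>L\<^sup>-\<^sup>1(s, T) (1 + s\<^sup>2) = S\<^sub>L\<^sup>-\<^sup>1(s, T) + T (1 + T\<^sup>2)\<^sup>-\<^sup>1 + (1 + T\<^sup>2)\<^sup>-\<^sup>1 s\<close>
  reduces the product rule to Cauchy's theorem for the slice hyperholomorphic integrand. The components
  at \<open>0\<close> and \<open>\<infinity>\<close> contribute rational functions vanishing at \<open>0\<close>, and by the same product rule these
  need only be evaluated for \<open>s (1 + s\<^sup>2)\<^sup>-\<^sup>1\<close>, once more with Cauchy's theorem. Finally, the factor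
  \<open>(1 + T\<^sup>2)\<^bsup>-m-1\<^esup>\<close> is cancelled, which yields the inclusion of the range as well.

  Cauchy's theorem for functions with values in Banach spaces is obtained from the fundamental theorem
  of calculus and Fubini's theorem on polar rectangles.\<close>

section \<open>Slices of the Clifford algebra\<close>

text \<open>The obstacle is noncommutativity: values of f need not lie in the slice C_J, and T need
  not commute with left multiplications. In the integrand, however, the scalars from C_J stand
  between the resolvent and f(s). Each of these two factors is therefore holomorphic for its own
  action of the complex numbers, and scalars of the slice, which commute with each other, may be
  passed from one to the other. Multiplying f(T) by a rational function of T leaves, besides the
  wanted integral, terms without a resolvent. They must vanish although the remainder of f is merely
  bounded and integrable against dt/t, with no pointwise decay. The elementary function is s/(1+s^2)
  because it vanishes at 0 and at infinity and so has no components there; 1/(1+s^2) takes the value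
  1 at 0. All surviving rational terms must therefore contain a factor s/(1+s^2), which amounts to
  g_0 = p_0 f_0 for the components at 0 of g = pf and of f. The exponent m+1 leaves a spare factor
  1/(1+s^2) beside every monomial of p. It is split as (1+s^2)^(-2) + (s/(1+s^2))^2, which separates
  the components at 0 and at infinity.\<close>

lemma inner_cl_basis_right: "inner x (cl_basis A) = cl_coeff x A"
  by (simp add: inner_clifford_def cl_basis_def if_distrib sum.delta cong: if_cong)

lemma inner_cl_basis: "inner (cl_basis A) (cl_basis B) = (if A = B then 1 else 0)"
  by (simp add: inner_cl_basis_right) (simp add: cl_basis_def)

lemma cl_coeff_sum: "cl_coeff (sum f S) A = (\<Sum>i\<in>S. cl_coeff (f i) A)"
  by (induction S rule: infinite_finite_induct) auto

lemma cl_coeff_of_real: "cl_coeff (of_real x) A = (if A = {} then x else 0)"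
  by (simp add: of_real_def)

lemma imag_unit_eq_sum:
  assumes "J \<in> imag_units"
  shows "J = (\<Sum>i\<in>UNIV. cl_coeff J {i} *\<^sub>R cl_gen i)"
proof -
  obtain x0 x where J: "J = of_real x0 + (\<Sum>i\<in>UNIV. x i *\<^sub>R cl_gen i)"
    using assms by (auto simp: imag_units_def paravectors_def)
  have coeff: "cl_coeff J A = (if A = {} then x0 else 0) + (\<Sum>i\<in>UNIV. if A = {i} then x i else 0)" for A
    unfolding J by (auto simp: cl_coeff_sum cl_coeff_of_real cl_basis_def intro!: sum.cong)
  have "x0 = 0" using assms coeff[of "{}"] by (simp add: imag_units_def cl_real_def)
  moreover have "cl_coeff J {i} = x i" for i using coeff[of "{i}"] by simp
  ultimately show ?thesis using J by simp
qed

text \<open>Adding the double sum for J * J to its transpose produces the anticommutators of the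
  generators, which are -2 on the diagonal and 0 off it; what remains is -2 times the squared
  norm.\<close>

lemma imag_unit_square:
  assumes "J \<in> imag_units"
  shows "J * J = - 1"
proof -
  let ?x = "\<lambda>i. cl_coeff J {i}"
  have eq: "J = (\<Sum>i\<in>UNIV. ?x i *\<^sub>R cl_gen i)" by (rule imag_unit_eq_sum[OF assms])
  have "inner J J = (\<Sum>i\<in>UNIV. \<Sum>j\<in>UNIV. ?x i * ?x j * (if i = j then 1 else 0))"
    by (subst (1 2) eq)
       (simp add: inner_sum_left inner_sum_right inner_cl_basis sum_distrib_left mult.assoc
         cong: if_cong, intro sum.cong refl, auto)
  also have "\<dots> = (\<Sum>i\<in>UNIV. ?x i * ?x i)" by (simp add: if_distrib cong: if_cong)
  finally have nrm: "(\<Sum>i\<in>UNIV. ?x i * ?x i) = 1"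
    using assms by (simp add: imag_units_def norm_eq_sqrt_inner)
  have JJ: "J * J = (\<Sum>i\<in>UNIV. \<Sum>j\<in>UNIV. (?x i * ?x j) *\<^sub>R (cl_gen i * cl_gen j))"
    by (subst (1 2) eq) (simp add: sum_product mult.commute[of "cl_coeff J _" "cl_coeff J _"])
  have JJ': "J * J = (\<Sum>i\<in>UNIV. \<Sum>j\<in>UNIV. (?x i * ?x j) *\<^sub>R (cl_gen j * cl_gen i))"
    unfolding JJ by (subst sum.swap) (intro sum.cong refl arg_cong2[where f = scaleR], rule mult.commute)
  have anti: "cl_gen i * cl_gen j + cl_gen j * cl_gen i = (if i = j then - 2 else 0) *\<^sub>R 1" for i j :: 'a
    using cl_gen_square[of i] cl_gen_anticommute[of i j] by (auto simp: scaleR_2)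
  have "J * J + J * J =
      (\<Sum>i\<in>UNIV. \<Sum>j\<in>UNIV. (?x i * ?x j) *\<^sub>R (cl_gen i * cl_gen j + cl_gen j * cl_gen i))"
    by (subst JJ, subst JJ') (simp add: sum.distrib scaleR_add_right)
  also have "\<dots> = (\<Sum>i\<in>UNIV. \<Sum>j\<in>UNIV. if i = j then (- 2 * (?x i * ?x j)) *\<^sub>R 1 else 0)"
    unfolding anti by (intro sum.cong refl) auto
  also have "\<dots> = (- 2 * (\<Sum>i\<in>UNIV. ?x i * ?x i)) *\<^sub>R 1"
    by (simp add: scaleR_left.sum sum_negf sum_distrib_left)
  finally have "J * J + J * J = (- 2) *\<^sub>R 1" by (simp add: nrm)
  then have "2 *\<^sub>R (J * J) = 2 *\<^sub>R (- 1)" by (simp add: scaleR_2)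
  then show ?thesis by (subst (asm) real_vector.scale_left_imp_eq) auto
qed

lemma cl_real_slice_point:
  "J \<in> imag_units \<Longrightarrow> cl_real (slice_point J x y) = x"
  by (simp add: cl_real_def slice_point_def imag_units_def cl_coeff_of_real)

lemma norm_slice_point:
  assumes "J \<in> imag_units"
  shows "norm (slice_point J x y) = sqrt (x\<^sup>2 + y\<^sup>2)"
proof -
  have 1: "inner (1::'a clifford) a = cl_coeff a {}" for a
    by (metis cl_basis_empty inner_cl_basis_right inner_commute)
  have "cl_coeff J {} = 0" "inner J J = 1"
    using assms by (auto simp: imag_units_def cl_real_def norm_eq_sqrt_inner)
  then have "inner (slice_point J x y) (slice_point J x y) = x\<^sup>2 + y\<^sup>2"
    by (simp add: slice_point_def of_real_def inner_add_left inner_add_right 1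
        inner_commute[of J 1] power2_eq_square)
  then show ?thesis by (simp add: norm_eq_sqrt_inner)
qed

lemma pv_cnj_slice_point:
  assumes "J \<in> imag_units"
  shows "pv_cnj (slice_point J x y) = slice_point J x (- y)"
proof -
  have "cl_coeff (slice_point J x y) {i} = y * cl_coeff J {i}" for i
    by (simp add: slice_point_def cl_coeff_of_real)
  then have "(\<Sum>i\<in>UNIV. cl_coeff (slice_point J x y) {i} *\<^sub>R cl_gen i) =
      y *\<^sub>R (\<Sum>i\<in>UNIV. cl_coeff J {i} *\<^sub>R cl_gen i)"
    by (simp add: scaleR_sum_right)
  also have "\<dots> = y *\<^sub>R J" by (simp flip: imag_unit_eq_sum[OF assms])
  finally show ?thesis
    using cl_real_slice_point[OF assms] by (simp add: pv_cnj_def slice_point_def)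
qed

lemma slice_point_paravector:
  assumes "J \<in> imag_units"
  shows "slice_point J x y \<in> paravectors"
proof -
  have "slice_point J x y = of_real x + (\<Sum>i\<in>UNIV. (y * cl_coeff J {i}) *\<^sub>R cl_gen i)"
    unfolding slice_point_def
    by (subst imag_unit_eq_sum[OF assms]) (simp add: scaleR_sum_right)
  then show ?thesis unfolding paravectors_def mem_Collect_eq
    by (intro exI[of _ x] exI[of _ "\<lambda>i. y * cl_coeff J {i}"] conjI TrueI)
qed

text \<open>For an imaginary unit J this is the isometric algebra embedding of
  \<open>complex\<close> onto the slice C_J. It makes complex polar coordinates and complex
  differentiation available on the slice.\<close>

definition slice_emb :: "'n::{finite,linorder} clifford \<Rightarrow> complex \<Rightarrow> 'n clifford" where
  "slice_emb J z = slice_point J (Re z) (Im z)"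

lemma slice_emb_simps [simp]:
  "slice_emb J 0 = 0" "slice_emb J 1 = 1" "slice_emb J \<i> = J"
  "slice_emb J (z + w) = slice_emb J z + slice_emb J w"
  "slice_emb J (z - w) = slice_emb J z - slice_emb J w"
  "slice_emb J (- z) = - slice_emb J z"
  "slice_emb J (of_real r) = of_real r"
  "slice_emb J (r *\<^sub>R z) = r *\<^sub>R slice_emb J z"
  by (simp_all add: slice_emb_def slice_point_def algebra_simps scaleR_conv_of_real)

lemma slice_emb_mult:
  assumes "J \<in> imag_units"
  shows "slice_emb J (z * w) = slice_emb J z * slice_emb J w"
  using imag_unit_square[OF assms]
  by (simp add: slice_emb_def slice_point_def of_real_def algebra_simps)

lemma slice_emb_power:
  "J \<in> imag_units \<Longrightarrow> slice_emb J (z ^ k) = slice_emb J z ^ k"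
  by (induction k) (simp_all add: slice_emb_mult)

lemma norm_slice_emb: "J \<in> imag_units \<Longrightarrow> norm (slice_emb J z) = norm z"
  by (simp add: slice_emb_def norm_slice_point cmod_def)

lemma cl_polar_eq_slice_emb: "cl_polar t J \<psi> = slice_emb J (of_real t * cis \<psi>)"
  by (simp add: cl_polar_def slice_emb_def slice_point_def algebra_simps scaleR_conv_of_real)

lemma cl_inverse_eqI: "a * b = 1 \<Longrightarrow> b * a = 1 \<Longrightarrow> cl_inverse a = b"
  unfolding cl_inverse_def
  by (rule the_equality) (auto, metis mult.assoc mult_1_left mult_1_right)

lemma cl_inverse_slice_emb:
  assumes "J \<in> imag_units" "z \<noteq> 0"
  shows "cl_inverse (slice_emb J z) = slice_emb J (1 / z)"
  by (rule cl_inverse_eqI)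
     (use assms in \<open>simp_all flip: slice_emb_mult\<close>)

lemma cl_poly_slice_emb:
  assumes "J \<in> imag_units"
  shows "cl_poly p (slice_emb J z) = slice_emb J (poly (map_poly of_real p) z)"
proof -
  have sum: "slice_emb J (sum h S) = (\<Sum>i\<in>S. slice_emb J (h i))" for h :: "nat \<Rightarrow> complex" and S
    by (induction S rule: infinite_finite_induct) auto
  show ?thesis
    by (simp add: cl_poly_def poly_altdef sum degree_map_poly coeff_map_poly
        slice_emb_mult[OF assms] slice_emb_power[OF assms] scaleR_conv_of_real)
qed

lemma bounded_linear_slice_emb: "bounded_linear (slice_emb J)"
  by (rule linear_conv_bounded_linear[THEN iffD1])
     (auto intro!: linearI simp: slice_emb_simps)

lemma bounded_bilinear_clifford_mult:
  "bounded_bilinear ((*) :: 'n::{finite,linorder} clifford \<Rightarrow> _)"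
  by (subst bilinear_conv_bounded_bilinear[symmetric])
     (auto simp: bilinear_def algebra_simps intro!: linearI)


section \<open>Left multiplication on the Clifford module\<close>

lemma bounded_bilinear_lmul:
  "bounded_bilinear (lmul :: 'n::{finite,linorder} clifford \<Rightarrow> ('v::real_normed_vector, 'n) cl_module \<Rightarrow> _)"
proof
  fix a b :: "'n clifford" and v w :: "('v, 'n) cl_module" and r :: real
  show "lmul (a + b) v = lmul a v + lmul b v"
    by (simp add: lmul_def vec_eq_iff algebra_simps sum.distrib)
  show "lmul a (v + w) = lmul a v + lmul a w"
    by (simp add: lmul_def vec_eq_iff algebra_simps sum.distrib)
  show "lmul (r *\<^sub>R a) v = r *\<^sub>R lmul a v"
    by (simp add: lmul_def vec_eq_iff algebra_simps scaleR_sum_right)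
  show "lmul a (r *\<^sub>R v) = r *\<^sub>R lmul a v"
    by (simp add: lmul_def vec_eq_iff algebra_simps scaleR_sum_right)
  show "\<exists>K. \<forall>a v. norm (lmul a v :: ('v, 'n) cl_module) \<le> norm (a :: 'n clifford) * norm (v :: ('v, 'n) cl_module) * K"
  proof (intro exI allI)
    fix a :: "'n clifford" and v :: "('v, 'n) cl_module"
    have sgn: "\<bar>cl_sign A B\<bar> = 1" for A B :: "'n set"
      using cl_sign_sq[of A B] square_eq_1_iff[of "cl_sign A B"] by auto
    have ca: "\<bar>cl_coeff a A\<bar> \<le> norm a" for A
    proof -
      have "(cl_coeff a A)\<^sup>2 \<le> (\<Sum>A\<in>UNIV. (cl_coeff a A)\<^sup>2)"
        by (rule member_le_sum) auto
      then show ?thesis unfolding norm_clifford_def by (simp add: real_le_rsqrt)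
    qed
    have vc: "norm (v $ A) \<le> norm v" for A
      unfolding norm_vec_def by (rule member_le_L2_set) auto
    \<comment> \<open>Each component is a sum over all index sets, and summing the components costs
      the same factor again; hence the squared cardinality below.\<close>
    have comp: "norm (lmul a v $ C) \<le> real CARD('n set) * (norm a * norm v)" for C
    proof -
      have "norm (lmul a v $ C) \<le> (\<Sum>A\<in>UNIV. norm ((cl_coeff a A * cl_sign A (sym_diff A C)) *\<^sub>R (v $ sym_diff A C)))"
        unfolding lmul_def by (simp only: vec_lambda_beta) (rule norm_sum)
      also have "\<dots> \<le> (\<Sum>A\<in>(UNIV::'n set set). norm a * norm v)"
        by (intro sum_mono) (auto simp: abs_mult sgn intro!: mult_mono ca vc)
      finally show ?thesis by simp
    qed
    have "norm (lmul a v) \<le> (\<Sum>C\<in>UNIV. norm (lmul a v $ C))"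
      unfolding norm_vec_def by (rule L2_set_le_sum) auto
    also have "\<dots> \<le> (\<Sum>C\<in>(UNIV::'n set set). real CARD('n set) * (norm a * norm v))"
      by (intro sum_mono comp)
    finally show "norm (lmul a v) \<le> norm a * norm v * (real CARD('n set) * real CARD('n set))"
      by (simp add: algebra_simps)
  qed
qed

interpretation lmul: bounded_bilinear "lmul :: 'n::{finite,linorder} clifford \<Rightarrow> ('v::real_normed_vector, 'n) cl_module \<Rightarrow> _"
  by (rule bounded_bilinear_lmul)

lemma lmul_one [simp]: "lmul 1 v = v"
proof -
  have "(\<Sum>A\<in>UNIV. ((if A = {} then 1 else 0) * cl_sign A (sym_diff A C)) *\<^sub>R (v $ sym_diff A C)) = v $ C" for C
    by (subst sum.mono_neutral_right[of _ "{{}}"]) auto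
  then show ?thesis by (simp add: lmul_def vec_eq_iff)
qed

lemma lmul_of_real: "lmul (of_real r) v = r *\<^sub>R v"
  by (simp add: of_real_def lmul.scaleR_left)

text \<open>Module version of associativity: the substitution by \<open>sym_diff A\<close> aligns
  the two double sums, and the signs agree because \<open>cl_sign\<close> is multiplicative in each
  argument.\<close>

lemma lmul_mult:
  fixes a b :: "'a::{finite,linorder} clifford"
  shows "lmul (a * b) v = lmul a (lmul b v)"
proof -
  have sd: "sym_diff A (sym_diff A B) = B" for A B :: "'a set" by auto
  have "(\<Sum>D\<in>UNIV. (cl_coeff (a * b) D * cl_sign D (sym_diff D C)) *\<^sub>R (v $ sym_diff D C)) =
    (\<Sum>A\<in>UNIV. (cl_coeff a A * cl_sign A (sym_diff A C)) *\<^sub>R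
      (\<Sum>B\<in>UNIV. (cl_coeff b B * cl_sign B (sym_diff B (sym_diff A C))) *\<^sub>R
         (v $ sym_diff B (sym_diff A C))))" for C
  proof -
    have "(\<Sum>D\<in>UNIV. (cl_coeff (a * b) D * cl_sign D (sym_diff D C)) *\<^sub>R (v $ sym_diff D C)) =
      (\<Sum>A\<in>UNIV. \<Sum>D\<in>UNIV. (cl_sign A (sym_diff A D) * cl_coeff a A * cl_coeff b (sym_diff A D) *
         cl_sign D (sym_diff D C)) *\<^sub>R (v $ sym_diff D C))"
      by (subst sum.swap) (simp add: times_clifford_def sum_distrib_right scaleR_sum_left)
    also have "\<dots> = (\<Sum>A\<in>UNIV. \<Sum>B\<in>UNIV. (cl_coeff a A * cl_sign A (sym_diff A C)) *\<^sub>R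
        ((cl_coeff b B * cl_sign B (sym_diff B (sym_diff A C))) *\<^sub>R (v $ sym_diff B (sym_diff A C))))"
    proof (rule sum.cong[OF refl])
      fix A :: "'a set"
      show "(\<Sum>D\<in>UNIV. (cl_sign A (sym_diff A D) * cl_coeff a A * cl_coeff b (sym_diff A D) *
         cl_sign D (sym_diff D C)) *\<^sub>R (v $ sym_diff D C)) =
        (\<Sum>B\<in>UNIV. (cl_coeff a A * cl_sign A (sym_diff A C)) *\<^sub>R
        ((cl_coeff b B * cl_sign B (sym_diff B (sym_diff A C))) *\<^sub>R (v $ sym_diff B (sym_diff A C))))"
      proof (rule sum.reindex_bij_witness[of _ "sym_diff A" "sym_diff A"])
        fix D :: "'a set"
        have 1: "sym_diff (sym_diff A D) (sym_diff A C) = sym_diff D C" by auto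
        show "(cl_coeff a A * cl_sign A (sym_diff A C)) *\<^sub>R
            ((cl_coeff b (sym_diff A D) * cl_sign (sym_diff A D) (sym_diff (sym_diff A D) (sym_diff A C))) *\<^sub>R
             (v $ sym_diff (sym_diff A D) (sym_diff A C))) =
            (cl_sign A (sym_diff A D) * cl_coeff a A * cl_coeff b (sym_diff A D) *
             cl_sign D (sym_diff D C)) *\<^sub>R (v $ sym_diff D C)"
          unfolding 1 unfolding cl_sign_left cl_sign_right
          using cl_sign_sq[of A C] by (simp add: algebra_simps)
      qed (auto simp: sd)
    qed
    finally show ?thesis by (simp add: scaleR_sum_right)
  qed
  then show ?thesis by (simp add: lmul_def vec_eq_iff)
qed

lemma rmul_of_real: "rmul v (of_real r) = r *\<^sub>R v"
proof -
  have "(\<Sum>A\<in>UNIV. (cl_coeff (of_real r) A * cl_sign (sym_diff A C) A) *\<^sub>R (v $ sym_diff A C)) = r *\<^sub>R v $ C" for C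
    by (subst sum.mono_neutral_right[of _ "{{}}"]) (auto simp: cl_coeff_of_real)
  then show ?thesis by (simp add: rmul_def vec_eq_iff)
qed

type_synonym ('v, 'n) cl_op = "('v, 'n) cl_module \<Rightarrow>\<^sub>L ('v, 'n) cl_module"

definition lmul_op :: "'n::{finite,linorder} clifford \<Rightarrow>
    ('v::real_normed_vector, 'n) cl_module \<Rightarrow>\<^sub>L ('v, 'n) cl_module" where
  "lmul_op a = Blinfun (lmul a)"

lemma lmul_op_apply [simp]: "lmul_op a v = lmul a v"
  by (simp add: lmul_op_def bounded_linear_Blinfun_apply lmul.bounded_linear_right)

lemma lmul_op_mult: "lmul_op (a * b) = lmul_op a o\<^sub>L lmul_op b"
  by (rule blinfun_eqI) (simp add: lmul_mult)

lemma lmul_op_one: "lmul_op 1 = id_blinfun"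
  by (rule blinfun_eqI) simp

lemma bounded_linear_lmul_op: "bounded_linear lmul_op"
proof -
  obtain K where K: "0 < K" "\<And>a v. norm (lmul a v :: ('b,'a) cl_module) \<le> norm a * norm v * K"
    using lmul.pos_bounded by blast
  show ?thesis
  proof (rule bounded_linear_intro[where K = K])
    show "lmul_op (a + b) = (lmul_op a + lmul_op b :: ('b,'a) cl_module \<Rightarrow>\<^sub>L _)" for a b
      by (rule blinfun_eqI) (simp add: blinfun.bilinear_simps lmul.add_left)
    show "lmul_op (r *\<^sub>R a) = (r *\<^sub>R lmul_op a :: ('b,'a) cl_module \<Rightarrow>\<^sub>L _)" for r a
      by (rule blinfun_eqI) (simp add: blinfun.bilinear_simps lmul.scaleR_left)
    show "norm (lmul_op a :: ('b,'a) cl_module \<Rightarrow>\<^sub>L _) \<le> norm a * K" for a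
      by (rule norm_blinfun_bound) (use K in \<open>auto simp: algebra_simps\<close>)
  qed
qed

section \<open>Dominated gauge integrals in Banach spaces\<close>

text \<open>The dominated convergence theorem of the library requires a Euclidean codomain; here the
  domination is by functions with small integral.\<close>

lemma integrable_on_cbox_approx:
  fixes f :: "'a::euclidean_space \<Rightarrow> 'b::banach"
  assumes fn: "\<And>n. fn n integrable_on cbox a b"
    and hn: "\<And>n. h n integrable_on cbox a b"
    and le: "\<And>n x. norm (f x - fn n x) \<le> h n x"
    and lim: "(\<lambda>n. integral (cbox a b) (h n)) \<longlonglongrightarrow> 0"
  shows "f integrable_on cbox a b"
  unfolding integrable_Cauchy
proof (intro allI impI)
  fix e :: real assume "e > 0"
  \<comment> \<open>The Riemann sum of \<open>h n\<close> stays below e/6 + e/6, and that of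
    \<open>fn n\<close> is within e/6 of its integral. This makes e/2 for one tagged division, and
    two divisions are compared.\<close>
  then have e6: "e / 6 > 0" by simp
  obtain n where n: "integral (cbox a b) (h n) < e / 6"
    using order_tendstoD(2)[OF lim e6] by (auto simp: eventually_sequentially)
  obtain \<gamma>1 where \<gamma>1: "gauge \<gamma>1" "\<And>\<D>. \<D> tagged_division_of cbox a b \<Longrightarrow> \<gamma>1 fine \<D> \<Longrightarrow>
      norm ((\<Sum>(x,K)\<in>\<D>. measure lborel K *\<^sub>R fn n x) - integral (cbox a b) (fn n)) < e / 6"
    using integrable_integral[OF fn[of n]] e6 unfolding has_integral by metis
  obtain \<gamma>2 where \<gamma>2: "gauge \<gamma>2" "\<And>\<D>. \<D> tagged_division_of cbox a b \<Longrightarrow> \<gamma>2 fine \<D> \<Longrightarrow>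
      norm ((\<Sum>(x,K)\<in>\<D>. measure lborel K *\<^sub>R h n x) - integral (cbox a b) (h n)) < e / 6"
    using integrable_integral[OF hn[of n]] e6 unfolding has_integral by metis
  have close: "norm ((\<Sum>(x,K)\<in>\<D>. measure lborel K *\<^sub>R f x) - integral (cbox a b) (fn n)) < e / 2"
    if D: "\<D> tagged_division_of cbox a b" "(\<lambda>x. \<gamma>1 x \<inter> \<gamma>2 x) fine \<D>" for \<D>
  proof -
    have fine: "\<gamma>1 fine \<D>" "\<gamma>2 fine \<D>" using D(2) by (auto simp: fine_def)
    have "norm ((\<Sum>(x,K)\<in>\<D>. measure lborel K *\<^sub>R f x) - (\<Sum>(x,K)\<in>\<D>. measure lborel K *\<^sub>R fn n x)) \<le>
        (\<Sum>(x,K)\<in>\<D>. measure lborel K *\<^sub>R h n x)"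
      unfolding sum_subtractf[symmetric]
      by (rule sum_norm_le)
         (auto simp: scaleR_diff_right[symmetric] intro!: mult_left_mono le)
    also have "\<dots> < e / 3"
      using \<gamma>2(2)[OF D(1) fine(2)] n
      by (simp only: real_norm_def abs_diff_less_iff) linarith
    finally have "norm ((\<Sum>(x,K)\<in>\<D>. measure lborel K *\<^sub>R f x) - (\<Sum>(x,K)\<in>\<D>. measure lborel K *\<^sub>R fn n x)) < e / 3" .
    from norm_triangle_lt[OF add_strict_mono[OF this \<gamma>1(2)[OF D(1) fine(1)], THEN less_le_trans[where z = "e / 2"]]]
    show ?thesis by simp
  qed
  show "\<exists>\<gamma>. gauge \<gamma> \<and> (\<forall>\<D>1 \<D>2. \<D>1 tagged_division_of cbox a b \<and> \<gamma> fine \<D>1 \<and>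
      \<D>2 tagged_division_of cbox a b \<and> \<gamma> fine \<D>2 \<longrightarrow>
      norm ((\<Sum>(x,K)\<in>\<D>1. measure lborel K *\<^sub>R f x) - (\<Sum>(x,K)\<in>\<D>2. measure lborel K *\<^sub>R f x)) < e)"
  proof (intro exI[of _ "\<lambda>x. \<gamma>1 x \<inter> \<gamma>2 x"] conjI allI impI gauge_Int \<gamma>1(1) \<gamma>2(1))
    fix \<D>1 \<D>2
    assume "\<D>1 tagged_division_of cbox a b \<and> (\<lambda>x. \<gamma>1 x \<inter> \<gamma>2 x) fine \<D>1 \<and>
      \<D>2 tagged_division_of cbox a b \<and> (\<lambda>x. \<gamma>1 x \<inter> \<gamma>2 x) fine \<D>2"
    then show "norm ((\<Sum>(x,K)\<in>\<D>1. measure lborel K *\<^sub>R f x) - (\<Sum>(x,K)\<in>\<D>2. measure lborel K *\<^sub>R f x)) < e"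
      using norm_triangle_half_l[OF close close] by blast
  qed
qed

text \<open>On boxes the previous lemma applies, since the integrals of \<open>h n\<close> over a
  box are squeezed between 0 and those over the whole space. The passage to the whole space compares
  f - \<open>fn 0\<close> with the integrable function \<open>h 0\<close>.\<close>

lemma integrable_UNIV_approx:
  fixes f :: "'a::euclidean_space \<Rightarrow> 'b::banach"
  assumes fn: "\<And>n. fn n integrable_on UNIV"
    and hn: "\<And>n. h n integrable_on UNIV"
    and le: "\<And>n x. norm (f x - fn n x) \<le> h n x"
    and lim: "(\<lambda>n. integral UNIV (h n)) \<longlonglongrightarrow> 0"
  shows "f integrable_on UNIV" "(\<lambda>n. integral UNIV (fn n)) \<longlonglongrightarrow> integral UNIV f"
proof -
  have h0: "0 \<le> h n x" for n x using le[of x n] norm_ge_zero order_trans by blast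
  have cb: "fn n integrable_on cbox a b" "h n integrable_on cbox a b" for n a b
    using fn hn integrable_on_subcbox by blast+
  have fcb: "f integrable_on cbox a b" for a b
  proof (rule integrable_on_cbox_approx[OF cb le])
    have "0 \<le> integral (cbox a b) (h n)" "integral (cbox a b) (h n) \<le> integral UNIV (h n)" for n
      by (auto intro!: integral_nonneg integral_subset_le cb hn h0)
    then show "(\<lambda>n. integral (cbox a b) (h n)) \<longlonglongrightarrow> 0"
      by (intro tendsto_sandwich[OF _ _ tendsto_const lim]) auto
  qed
  have "(\<lambda>x. f x - fn 0 x) integrable_on UNIV"
    by (rule integrable_on_all_intervals_UNIV[OF integrable_diff[OF fcb cb(1)] le hn])
  from integrable_add[OF this fn[of 0]] show f: "f integrable_on UNIV" by simp
  have "norm (integral UNIV (fn n) - integral UNIV f) \<le> integral UNIV (h n)" for n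
    unfolding integral_diff[OF fn f, symmetric]
    by (rule integral_norm_bound_integral[OF integrable_diff[OF fn f] hn])
       (use le in \<open>simp add: norm_minus_commute\<close>)
  then have "(\<lambda>n. integral UNIV (fn n) - integral UNIV f) \<longlonglongrightarrow> 0"
    by (intro Lim_null_comparison[OF _ lim]) auto
  then show "(\<lambda>n. integral UNIV (fn n)) \<longlonglongrightarrow> integral UNIV f"
    by (rule LIM_zero_cancel)
qed

text \<open>Connects the integral over the line in \<open>omega_calc\<close> with integrals over
  compact intervals away from 0, where the integrand is continuous. The truncation error is
  dominated by the tail of a scalar function, and that tail tends to 0 by dominated
  convergence.\<close>

lemma truncated_integral_tendsto:
  fixes g :: "real \<Rightarrow> 'b::banach" and h :: "real \<Rightarrow> real"
  assumes h: "set_integrable lborel {0<..} h"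
    and cpos: "continuous_on {0<..} g" and cneg: "continuous_on {..<0} g"
    and le: "\<And>t. t \<noteq> 0 \<Longrightarrow> norm (g t) \<le> h \<bar>t\<bar>"
  shows "(\<lambda>n. integral {1 / real (Suc n)..real (Suc n)} (\<lambda>t. g t + g (- t))) \<longlonglongrightarrow> integral UNIV g"
proof -
  \<comment> \<open>The value of g at 0 is uncontrolled; it is set to 0 so that the domination holds
    at every point.\<close>
  define g' where "g' t = (if t = 0 then 0 else g t)" for t
  define hh where "hh t = (if t = 0 then 0 else h \<bar>t\<bar>)" for t
  define a b :: "nat \<Rightarrow> real" where "a n = 1 / real (Suc n)" and "b n = real (Suc n)" for n
  define S where "S n = {a n..b n} \<union> {- b n..- a n}" for n
  have ab: "0 < a n" "a n \<le> b n" for n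
    by (auto simp: a_def b_def field_simps)
  have int: "integrable lborel (\<lambda>t. indicator {0<..} t * h t)"
    using h by (simp add: set_integrable_def)
  have hh: "integrable lborel hh"
  proof -
    have "integrable lborel (\<lambda>t. indicator {0<..} t * h t + indicator {0<..} (- t) * h (- t))"
      using lborel_integrable_real_affine[OF int, of "- 1" 0] by (intro Bochner_Integration.integrable_add int) auto
    also have "(\<lambda>t. indicator {0<..} t * h t + indicator {0<..} (- t) * h (- t)) = hh"
      by (auto simp: hh_def fun_eq_iff indicator_def)
    finally show ?thesis .
  qed
  have hh0: "0 \<le> hh t" for t
    using order_trans[OF norm_ge_zero le[of t]] by (simp add: hh_def)
  define hn where "hn n t = indicator (- S n) t * hh t" for n t
  have Sm: "S n \<in> sets lborel" for n by (simp add: S_def)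
  have hn_int: "integrable lborel (hn n)" for n
    unfolding hn_def using integrable_mult_indicator[OF _ hh, of "- S n"] Sm by simp
  have "(\<lambda>n. \<integral>t. hn n t \<partial>lborel) \<longlonglongrightarrow> (\<integral>t. 0 \<partial>(lborel :: real measure))"
  proof (rule integral_dominated_convergence[where w = hh])
    show "AE t in lborel. (\<lambda>n. hn n t) \<longlonglongrightarrow> 0"
    proof (rule AE_I2)
      fix t :: real
      show "(\<lambda>n. hn n t) \<longlonglongrightarrow> 0"
      proof (cases "t = 0")
        case False
        obtain N :: nat where N: "max \<bar>t\<bar> (1 / \<bar>t\<bar>) < real N" using reals_Archimedean2 by blast
        have "t \<in> S n" if "n \<ge> N" for n
        proof -
          have "\<bar>t\<bar> < b n" "1 / \<bar>t\<bar> < b n" using N that by (auto simp: b_def)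
          then have "a n \<le> \<bar>t\<bar>" "\<bar>t\<bar> \<le> b n" using False by (auto simp: a_def b_def field_simps)
          then show ?thesis by (auto simp: S_def abs_if split: if_splits)
        qed
        then have "\<forall>\<^sub>F n in sequentially. hn n t = 0"
          unfolding eventually_sequentially by (intro exI[of _ N]) (simp add: hn_def)
        then show ?thesis by (rule tendsto_eventually)
      qed (simp add: hn_def hh_def)
    qed
    show "AE t in lborel. norm (hn n t) \<le> hh t" for n
      using hh0 by (auto simp: hn_def indicator_def)
  qed (use hn_int hh in auto)
  then have lim: "(\<lambda>n. integral UNIV (hn n)) \<longlonglongrightarrow> 0"
    using has_integral_integral_lborel[OF hn_int, THEN integral_unique] by simp
  have hn_hk: "hn n integrable_on UNIV" for n
    using has_integral_integral_lborel[OF hn_int] by blast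
  define fn where "fn n t = (if t \<in> {a n..b n} then g t else 0) + (if t \<in> {- b n..- a n} then g t else 0)" for n t
  have p1: "g integrable_on {a n..b n}" and p2: "g integrable_on {- b n..- a n}" for n
    using ab[of n]
    by (intro integrable_continuous_interval continuous_on_subset[OF cpos], force,
        intro integrable_continuous_interval continuous_on_subset[OF cneg], force)
  have fn_has: "(fn n has_integral (integral {a n..b n} g + integral {- b n..- a n} g)) UNIV" for n
    unfolding fn_def
    by (intro has_integral_add)
       (use p1 p2 in \<open>simp_all only: has_integral_restrict_UNIV integrable_integral\<close>)
  have "(\<lambda>n. integral UNIV (fn n)) \<longlonglongrightarrow> integral UNIV g'"
  proof (rule integrable_UNIV_approx(2)[OF _ hn_hk _ lim])
    show "fn n integrable_on UNIV" for n using fn_has by blast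
    show "norm (g' t - fn n t) \<le> hn n t" for n t
      using ab[of n] le[of t] hh0[of t] by (auto simp: g'_def fn_def hn_def hh_def S_def)
  qed
  moreover have "integral UNIV (fn n) = integral {a n..b n} (\<lambda>t. g t + g (- t))" for n
  proof -
    have "integral {a n..b n} (\<lambda>t. g (- t)) = integral {- b n..- a n} g"
      using Henstock_Kurzweil_Integration.integral_reflect_real[of "- a n" "- b n" g] by simp
    moreover have "(\<lambda>t. g (- t)) integrable_on {a n..b n}"
      using p2[of n] Henstock_Kurzweil_Integration.integrable_reflect_real[of g "- a n" "- b n"] by simp
    ultimately show ?thesis
      using integral_unique[OF fn_has[of n]] integral_add[OF p1[of n]] by simp
  qed
  moreover have "integral UNIV g' = integral UNIV g"
    by (rule integral_spike[of "{0}"]) (auto simp: g'_def)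
  ultimately show ?thesis by (simp add: a_def b_def)
qed


section \<open>Cauchy's theorem on sectors\<close>

abbreviation polar :: "real \<Rightarrow> real \<Rightarrow> complex" where
  "polar r \<psi> \<equiv> of_real r * cis \<psi>"

text \<open>The instances are the Clifford algebra under left multiplication by elements of a slice, and the
  operators under composition with these left multiplications. Holomorphy is relative to the action.\<close>

locale complex_action = bounded_bilinear act
  for act :: "complex \<Rightarrow> 'b::banach \<Rightarrow> 'b" +
  assumes act_one: "act 1 x = x" and act_mult: "act (z * w) x = act z (act w x)"
begin

text \<open>Derivatives are taken within X because the sets in question contain boundary rays.
  Continuity of D is included for the sake of Fubini's theorem.\<close>

definition holo_on :: "(complex \<Rightarrow> 'b) \<Rightarrow> (complex \<Rightarrow> 'b) \<Rightarrow> complex set \<Rightarrow> bool" where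
  "holo_on G D X \<longleftrightarrow> continuous_on X D \<and>
     (\<forall>z\<in>X. (G has_derivative (\<lambda>h. act h (D z))) (at z within X))"

lemma holo_on_continuous: "holo_on G D X \<Longrightarrow> continuous_on X G"
  unfolding holo_on_def continuous_on_eq_continuous_within
  by (blast intro: has_derivative_continuous)

lemma holo_on_subset: "holo_on G D X \<Longrightarrow> Y \<subseteq> X \<Longrightarrow> holo_on G D Y"
  unfolding holo_on_def using continuous_on_subset has_derivative_subset subsetD by metis

lemma holo_on_act:
  assumes "holo_on G D X" and "continuous_on X E'"
    and E: "\<And>z. z \<in> X \<Longrightarrow> (E has_field_derivative E' z) (at z within X)"
  shows "holo_on (\<lambda>z. act (E z) (G z)) (\<lambda>z. act (E' z) (G z) + act (E z) (D z)) X"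
  unfolding holo_on_def
proof (intro conjI ballI)
  have "continuous_on X E"
    unfolding continuous_on_eq_continuous_within using E DERIV_continuous by blast
  then show "continuous_on X (\<lambda>z. act (E' z) (G z) + act (E z) (D z))"
    using assms holo_on_continuous[OF assms(1)]
    by (intro continuous_intros continuous_on) (auto simp: holo_on_def)
  fix z assume z: "z \<in> X"
  have "((\<lambda>z. act (E z) (G z)) has_derivative (\<lambda>h. act (E z) (act h (D z)) + act (E' z * h) (G z)))
      (at z within X)"
    using E[OF z] assms(1) z by (intro FDERIV) (auto simp: holo_on_def has_field_derivative_def)
  also have "(\<lambda>h. act (E z) (act h (D z)) + act (E' z * h) (G z)) =
      (\<lambda>h. act h (act (E' z) (G z) + act (E z) (D z)))"
    by (simp add: fun_eq_iff add_right add.commute mult.commute flip: act_mult)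
  finally show "((\<lambda>z. act (E z) (G z)) has_derivative
      (\<lambda>h. act h (act (E' z) (G z) + act (E z) (D z)))) (at z within X)" .
qed

lemma holo_on_const: "holo_on (\<lambda>_. c) (\<lambda>_. 0) X"
  by (auto simp: holo_on_def zero_right)

lemma holo_on_diff:
  assumes "holo_on G D X" "holo_on G' D' X"
  shows "holo_on (\<lambda>z. G z - G' z) (\<lambda>z. D z - D' z) X"
  using assms by (auto simp: holo_on_def diff_right intro!: continuous_intros has_derivative_diff)

lemma holo_on_add:
  assumes "holo_on G D X" "holo_on G' D' X"
  shows "holo_on (\<lambda>z. G z + G' z) (\<lambda>z. D z + D' z) X"
  using assms by (auto simp: holo_on_def add_right intro!: continuous_intros has_derivative_add)

lemma holo_on_chain:
  assumes "holo_on G D X" "p x \<in> X" "(p has_vector_derivative p') (at x within S)" "p ` S \<subseteq> X"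
  shows "((\<lambda>x. G (p x)) has_vector_derivative act p' (D (p x))) (at x within S)"
proof -
  have "(G has_derivative (\<lambda>h. act h (D (p x)))) (at (p x) within p ` S)"
    using assms by (auto simp: holo_on_def intro: has_derivative_subset)
  from vector_derivative_diff_chain_within[OF assms(3) this] show ?thesis by (simp add: o_def)
qed

lemma continuous_on_ray:
  assumes "holo_on G D X" "(\<lambda>r. polar r \<psi>) ` S \<subseteq> X"
  shows "continuous_on S (\<lambda>r. G (polar r \<psi>))"
  by (rule continuous_on_compose2[OF holo_on_continuous[OF assms(1)]])
     (use assms(2) in \<open>auto intro!: continuous_intros\<close>)

text \<open>In polar coordinates the Cauchy--Riemann equations say that \<open>e\<^sup>i\<^sup>\<psi> G\<close> and \<open>i r e\<^sup>i\<^sup>\<psi> G\<close> have equal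
  derivatives with respect to \<open>\<psi>\<close> and \<open>r\<close>, respectively.\<close>

lemma Cauchy_polar_rectangle:
  assumes holo: "holo_on G D X" and "r1 \<le> r2" "\<alpha> \<le> \<beta>"
    and X: "\<And>r \<psi>. r \<in> {r1..r2} \<Longrightarrow> \<psi> \<in> {\<alpha>..\<beta>} \<Longrightarrow> polar r \<psi> \<in> X"
  shows "integral {r1..r2} (\<lambda>r. act (cis \<beta>) (G (polar r \<beta>))) -
      integral {r1..r2} (\<lambda>r. act (cis \<alpha>) (G (polar r \<alpha>))) =
    integral {\<alpha>..\<beta>} (\<lambda>\<psi>. act (\<i> * of_real r2 * cis \<psi>) (G (polar r2 \<psi>)) -
      act (\<i> * of_real r1 * cis \<psi>) (G (polar r1 \<psi>)))"
proof -
  define k where "k r \<psi> = act (cis \<psi>) (G (polar r \<psi>))" for r \<psi>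
  define l where "l r \<psi> = act (\<i> * of_real r * cis \<psi>) (G (polar r \<psi>))" for r \<psi>
  \<comment> \<open>The common value of both partial derivatives; its continuity on the rectangle
    allows the order of integration to be exchanged.\<close>
  define d where "d r \<psi> = act (\<i> * cis \<psi>) (G (polar r \<psi>)) +
    act (\<i> * of_real r * cis \<psi> * cis \<psi>) (D (polar r \<psi>))" for r \<psi>
  have cis': "(cis has_vector_derivative \<i> * cis \<psi>) (at \<psi> within S)" for \<psi> S
    unfolding has_vector_derivative_def
    by (rule has_derivative_eq_rhs[OF has_derivative_cis[OF has_derivative_ident]])
       (simp add: scaleR_conv_of_real)
  have k': "(k r has_vector_derivative d r \<psi>) (at \<psi> within {\<alpha>..\<beta>})"
    if "r \<in> {r1..r2}" "\<psi> \<in> {\<alpha>..\<beta>}" for r \<psi>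
  proof -
    have arc: "((\<lambda>\<psi>. polar r \<psi>) has_vector_derivative of_real r * (\<i> * cis \<psi>)) (at \<psi> within {\<alpha>..\<beta>})"
      by (intro has_vector_derivative_mult_right cis')
    have "((\<lambda>\<psi>. G (polar r \<psi>)) has_vector_derivative
        act (of_real r * (\<i> * cis \<psi>)) (D (polar r \<psi>))) (at \<psi> within {\<alpha>..\<beta>})"
      by (rule holo_on_chain[OF holo _ arc]) (use X that in auto)
    from has_vector_derivative[OF cis' this] show ?thesis
      unfolding k_def d_def by (simp add: mult_ac add.commute flip: act_mult)
  qed
  have l': "((\<lambda>r. l r \<psi>) has_vector_derivative d r \<psi>) (at r within {r1..r2})"
    if "r \<in> {r1..r2}" "\<psi> \<in> {\<alpha>..\<beta>}" for r \<psi>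
  proof -
    have ray: "((\<lambda>r. of_real r * c) has_vector_derivative c) (at r within {r1..r2})" for c :: complex
      by (auto intro!: derivative_eq_intros simp: has_vector_derivative_def scaleR_conv_of_real)
    have "((\<lambda>r. G (polar r \<psi>)) has_vector_derivative
        act (cis \<psi>) (D (polar r \<psi>))) (at r within {r1..r2})"
      by (rule holo_on_chain[OF holo _ ray]) (use X that in auto)
    from has_vector_derivative[OF ray[of "\<i> * cis \<psi>"] this] show ?thesis
      unfolding l_def d_def by (simp add: mult_ac add.commute flip: act_mult)
  qed
  have cont: "continuous_on ({r1..r2} \<times> {\<alpha>..\<beta>}) (\<lambda>(r, \<psi>). d r \<psi>)"
  proof -
    let ?B = "{r1..r2} \<times> {\<alpha>..\<beta>}" and ?z = "\<lambda>p::real \<times> real. of_real (fst p) * cis (snd p)"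
    have z: "continuous_on ?B ?z" by (intro continuous_intros)
    have zX: "?z ` ?B \<subseteq> X" using X by auto
    have G: "continuous_on ?B (\<lambda>p. G (?z p))"
      by (rule continuous_on_compose2[OF holo_on_continuous[OF holo] z zX])
    have D: "continuous_on ?B (\<lambda>p. D (?z p))"
      by (rule continuous_on_compose2[OF _ z zX]) (use holo in \<open>simp add: holo_on_def\<close>)
    show ?thesis
      unfolding d_def case_prod_unfold
      by (intro continuous_on_add continuous_on[OF _ G] continuous_on[OF _ D]) (intro continuous_intros)+
  qed
  have kI: "(d r has_integral (k r \<beta> - k r \<alpha>)) {\<alpha>..\<beta>}" if "r \<in> {r1..r2}" for r
    by (rule fundamental_theorem_of_calculus[OF \<open>\<alpha> \<le> \<beta>\<close>]) (use k' that in auto)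
  have lI: "((\<lambda>r. d r \<psi>) has_integral (l r2 \<psi> - l r1 \<psi>)) {r1..r2}" if "\<psi> \<in> {\<alpha>..\<beta>}" for \<psi>
    by (rule fundamental_theorem_of_calculus[OF \<open>r1 \<le> r2\<close>]) (use l' that in auto)
  have kc: "(\<lambda>r. k r \<psi>) integrable_on {r1..r2}" if "\<psi> \<in> {\<alpha>..\<beta>}" for \<psi>
    unfolding k_def
    by (rule integrable_continuous_interval, intro continuous_on continuous_intros continuous_on_ray[OF holo])
       (use X that in auto)
  have "integral {r1..r2} (\<lambda>r. k r \<beta>) - integral {r1..r2} (\<lambda>r. k r \<alpha>) =
      integral {r1..r2} (\<lambda>r. k r \<beta> - k r \<alpha>)"
    using kc \<open>\<alpha> \<le> \<beta>\<close> by (intro integral_diff[symmetric]) auto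
  also have "\<dots> = integral {r1..r2} (\<lambda>r. integral {\<alpha>..\<beta>} (d r))"
    by (intro integral_cong) (rule integral_unique[OF kI, symmetric])
  also have "\<dots> = integral {\<alpha>..\<beta>} (\<lambda>\<psi>. integral {r1..r2} (\<lambda>r. d r \<psi>))"
    using integral_swap_continuous[of r1 \<alpha> r2 \<beta> d] cont by (simp add: cbox_Pair_eq)
  also have "\<dots> = integral {\<alpha>..\<beta>} (\<lambda>\<psi>. l r2 \<psi> - l r1 \<psi>)"
    by (intro integral_cong) (rule integral_unique[OF lI])
  finally show ?thesis by (simp add: k_def l_def)
qed

end

definition sector :: "real \<Rightarrow> real \<Rightarrow> complex set" where
  "sector \<alpha> \<beta> = {polar r \<psi> | r \<psi>. 0 < r \<and> \<psi> \<in> {\<alpha>..\<beta>}}"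

lemma sectorI: "0 < r \<Longrightarrow> \<alpha> \<le> \<psi> \<Longrightarrow> \<psi> \<le> \<beta> \<Longrightarrow> polar r \<psi> \<in> sector \<alpha> \<beta>"
  by (auto simp: sector_def)

text \<open>The factor min 1 (\<delta> r) bounds the error 1 - 1/(1 + \<delta> w) on the circle of
  radius r when w has nonnegative real part. It tends to 0 pointwise and never exceeds 1, so
  dominated convergence applies.\<close>

lemma damped_integral_tendsto_0:
  fixes h :: "real \<Rightarrow> real"
  assumes h: "set_integrable lborel {0<..} h" and \<delta>: "\<delta> \<longlonglongrightarrow> 0" "\<And>n. 0 \<le> \<delta> n"
  shows "set_integrable lborel {0<..} (\<lambda>r. min 1 (\<delta> n * r) * h r)"
    and "(\<lambda>n. integral {0<..} (\<lambda>r. min 1 (\<delta> n * r) * h r)) \<longlonglongrightarrow> 0"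
proof -
  have int: "integrable lborel (\<lambda>t. indicator {0<..} t * h t)"
    using h by (simp add: set_integrable_def)
  define F where "F n r = min 1 (\<delta> n * \<bar>r\<bar>) * (indicator {0<..} r * h r)" for n r
  have le: "norm (F n r) \<le> norm (indicator {0<..} r * h r)" for n r
    using \<delta>(2)[of n] by (auto simp: F_def abs_mult intro!: mult_left_le_one_le)
  have Fm: "F n \<in> borel_measurable lborel" for n
    unfolding F_def using borel_measurable_integrable[OF int] by measurable
  have F: "integrable lborel (F n)" for n
    by (rule Bochner_Integration.integrable_bound[OF int Fm]) (use le in auto)
  have eq: "indicator {0<..} r *\<^sub>R (min 1 (\<delta> n * r) * h r) = F n r" for n r
    by (auto simp: F_def indicator_def)
  show *: "set_integrable lborel {0<..} (\<lambda>r. min 1 (\<delta> n * r) * h r)" for n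
    unfolding set_integrable_def eq by (rule F)
  have "(\<lambda>n. \<integral>r. F n r \<partial>lborel) \<longlonglongrightarrow> (\<integral>r. 0 \<partial>(lborel :: real measure))"
  proof (rule integral_dominated_convergence[where w = "\<lambda>r. norm (indicator {0<..} r * h r)"])
    show "AE r in lborel. (\<lambda>n. F n r) \<longlonglongrightarrow> 0"
    proof (rule AE_I2)
      fix r :: real
      have "(\<lambda>n. min 1 (\<delta> n * \<bar>r\<bar>) * (indicator {0<..} r * h r)) \<longlonglongrightarrow>
          min 1 (0 * \<bar>r\<bar>) * (indicator {0<..} r * h r)"
        by (intro tendsto_intros \<delta>)
      then show "(\<lambda>n. F n r) \<longlonglongrightarrow> 0" by (simp add: F_def)
    qed
  qed (use Fm le int in auto)
  moreover have "(\<integral>r. F n r \<partial>lborel) = integral {0<..} (\<lambda>r. min 1 (\<delta> n * r) * h r)" for n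
    using set_borel_integral_eq_integral(2)[OF *[of n]]
    unfolding set_lebesgue_integral_def eq .
  ultimately show "(\<lambda>n. integral {0<..} (\<lambda>r. min 1 (\<delta> n * r) * h r)) \<longlonglongrightarrow> 0" by simp
qed

section \<open>Limits of differences of ray integrals\<close>

context complex_action
begin

lemma norm_act_le: obtains K where "0 < K" "\<And>z x. norm (act z x) \<le> K * (norm z * norm x)"
  using pos_bounded by (metis mult.commute)

lemma continuous_on_act_arc:
  assumes "holo_on G D X" "\<And>\<psi>. \<psi> \<in> S \<Longrightarrow> polar r \<psi> \<in> X"
  shows "continuous_on S (\<lambda>\<psi>. act (c * cis \<psi>) (G (polar r \<psi>)))"
proof -
  have "continuous_on S (\<lambda>\<psi>. G (polar r \<psi>))"
    by (rule continuous_on_compose2[OF holo_on_continuous[OF assms(1)]])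
       (use assms(2) in \<open>auto intro!: continuous_intros\<close>)
  then show ?thesis by (intro continuous_on) (auto intro!: continuous_intros)
qed

text \<open>By Cauchy's theorem the difference of the ray integrals equals the difference of two arc
  integrals. On the outer arc z G(z) is close to c and on the inner arc close to 0, so the limit is
  the opening angle times the action of i on c.\<close>

lemma truncated_sector_limit:
  assumes holo: "holo_on G D (sector \<alpha> \<beta>)" and "\<alpha> \<le> \<beta>"
    and large: "\<And>z. z \<in> sector \<alpha> \<beta> \<Longrightarrow> 1 \<le> norm z \<Longrightarrow> norm (act z (G z) - c) \<le> C / norm z"
    and small: "\<And>z. z \<in> sector \<alpha> \<beta> \<Longrightarrow> norm z \<le> 1 \<Longrightarrow> norm (act z (G z)) \<le> C * norm z"
  shows "(\<lambda>n. integral {1 / real (Suc n)..real (Suc n)} (\<lambda>r. act (cis \<beta>) (G (polar r \<beta>))) -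
      integral {1 / real (Suc n)..real (Suc n)} (\<lambda>r. act (cis \<alpha>) (G (polar r \<alpha>))))
    \<longlonglongrightarrow> (\<beta> - \<alpha>) *\<^sub>R act \<i> c"
proof -
  obtain K where K: "0 < K" "\<And>z x. norm (act z x) \<le> K * (norm z * norm x)"
    using norm_act_le by metis
  define I where "I n = integral {1 / real (Suc n)..real (Suc n)} (\<lambda>r. act (cis \<beta>) (G (polar r \<beta>))) -
      integral {1 / real (Suc n)..real (Suc n)} (\<lambda>r. act (cis \<alpha>) (G (polar r \<alpha>)))" for n
  have bound: "norm (I n - (\<beta> - \<alpha>) *\<^sub>R act \<i> c) \<le> 2 * K * C * (\<beta> - \<alpha>) / real (Suc n)" for n
  proof -
    \<comment> \<open>The radii are reciprocal, so the errors \<open>C / r2\<close> and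
      \<open>C * r1\<close> of the two arcs coincide.\<close>
    define r1 r2 where "r1 = 1 / real (Suc n)" and "r2 = real (Suc n)"
    have r: "0 < r1" "r1 \<le> r2" "r1 \<le> 1" "1 \<le> r2" "0 < r2"
      by (auto simp: r1_def r2_def field_simps)
    define q where "q \<psi> = act (\<i> * of_real r2 * cis \<psi>) (G (polar r2 \<psi>)) -
      act (\<i> * of_real r1 * cis \<psi>) (G (polar r1 \<psi>))" for \<psi>
    have I: "I n = integral {\<alpha>..\<beta>} q"
      unfolding I_def q_def r1_def[symmetric] unfolding r2_def[symmetric]
      by (rule Cauchy_polar_rectangle[OF holo r(2) \<open>\<alpha> \<le> \<beta>\<close>]) (use r in \<open>auto intro!: sectorI\<close>)
    have qc: "continuous_on {\<alpha>..\<beta>} q"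
      unfolding q_def
      by (intro continuous_on_diff continuous_on_act_arc[OF holo]) (use r in \<open>auto intro!: sectorI\<close>)
    have "integral {\<alpha>..\<beta>} q - (\<beta> - \<alpha>) *\<^sub>R act \<i> c = integral {\<alpha>..\<beta>} (\<lambda>\<psi>. q \<psi> - act \<i> c)"
      using \<open>\<alpha> \<le> \<beta>\<close> by (subst integral_diff) (auto intro!: integrable_continuous_interval qc)
    moreover have "norm (integral {\<alpha>..\<beta>} (\<lambda>\<psi>. q \<psi> - act \<i> c)) \<le> 2 * K * C / r2 * (\<beta> - \<alpha>)"
    proof (rule integral_bound[OF \<open>\<alpha> \<le> \<beta>\<close>])
      show "continuous_on {\<alpha>..\<beta>} (\<lambda>\<psi>. q \<psi> - act \<i> c)" by (intro continuous_intros qc)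
      fix \<psi> assume "\<psi> \<in> {\<alpha>..\<beta>}"
      then have z: "polar r1 \<psi> \<in> sector \<alpha> \<beta>" "polar r2 \<psi> \<in> sector \<alpha> \<beta>"
        using r by (auto intro!: sectorI)
      define u v where "u = act (polar r2 \<psi>) (G (polar r2 \<psi>)) - c"
        and "v = act (polar r1 \<psi>) (G (polar r1 \<psi>))"
      have "q \<psi> - act \<i> c = act \<i> (u - v)"
        by (simp add: q_def u_def v_def diff_right act_mult mult.assoc)
      then have "norm (q \<psi> - act \<i> c) \<le> K * norm (u - v)" using K(2)[of \<i>] by simp
      also have "norm u \<le> C / r2" using large[OF z(2)] r by (simp add: u_def norm_mult)
      moreover have "norm v \<le> C * r1" using small[OF z(1)] r by (simp add: v_def norm_mult)
      ultimately have "norm (q \<psi> - act \<i> c) \<le> K * (C / r2 + C * r1)"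
        using norm_triangle_ineq4[of u v] K(1) by (smt (verit) mult_left_mono)
      moreover have "K * (C / r2 + C * r1) = 2 * K * C / r2"
        unfolding r1_def r2_def by (simp add: algebra_simps)
      ultimately show "norm (q \<psi> - act \<i> c) \<le> 2 * K * C / r2" by simp
    qed
    ultimately show ?thesis by (simp add: I r2_def)
  qed
  have "(\<lambda>n. 2 * K * C * (\<beta> - \<alpha>) / real (Suc n)) \<longlonglongrightarrow> 0"
    by (intro LIMSEQ_Suc lim_const_over_n)
  then have "(\<lambda>n. I n - (\<beta> - \<alpha>) *\<^sub>R act \<i> c) \<longlonglongrightarrow> 0"
    by (rule Lim_null_comparison[rotated]) (use bound in auto)
  then show ?thesis unfolding I_def by (rule LIM_zero_cancel)
qed

text \<open>The decay of \<open>G\<close> at infinity is only borderline, so that the arcs need not tend to \<open>0\<close>;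
  the factor \<open>1 / (1 + \<delta> e\<^bsup>-i\<mu>\<^esup> z)\<close> with \<open>\<delta> \<rightarrow> 0\<close> supplies the missing decay.\<close>

lemma truncated_sector_vanishing:
  assumes holo: "holo_on G D (sector (\<mu> - \<phi>) (\<mu> + \<phi>))" and \<phi>: "0 < \<phi>" "\<phi> < pi / 2"
    and bounded: "\<And>z. z \<in> sector (\<mu> - \<phi>) (\<mu> + \<phi>) \<Longrightarrow> norm (G z) \<le> C"
    and decay: "\<And>z. z \<in> sector (\<mu> - \<phi>) (\<mu> + \<phi>) \<Longrightarrow> norm (G z) \<le> C / norm z"
    and int: "\<And>\<psi>. \<psi> \<in> {\<mu> - \<phi>, \<mu> + \<phi>} \<Longrightarrow> set_integrable lborel {0<..} (\<lambda>r. norm (G (polar r \<psi>)))"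
  shows "(\<lambda>n. integral {1 / real (Suc n)..real (Suc n)} (\<lambda>r. act (cis (\<mu> + \<phi>)) (G (polar r (\<mu> + \<phi>)))) -
      integral {1 / real (Suc n)..real (Suc n)} (\<lambda>r. act (cis (\<mu> - \<phi>)) (G (polar r (\<mu> - \<phi>)))))
    \<longlonglongrightarrow> 0"
proof -
  obtain K where K: "0 < K" "\<And>z x. norm (act z x) \<le> K * (norm z * norm x)"
    using norm_act_le by metis
  let ?S = "sector (\<mu> - \<phi>) (\<mu> + \<phi>)"
  \<comment> \<open>The rate lies between two demands: \<delta> tends to 0, so that the damping
    disappears on the rays, while \<delta> times the outer radius is sqrt(n+1) and tends to
    infinity, so that the outer arc vanishes.\<close>
  define \<delta> where "\<delta> n = 1 / sqrt (real (Suc n))" for n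
  have \<delta>: "\<delta> \<longlonglongrightarrow> 0" "0 < \<delta> n" for n
  proof -
    have "filterlim (\<lambda>n. sqrt (real (Suc n))) at_top sequentially"
      by (intro filterlim_compose[OF sqrt_at_top] filterlim_compose[OF filterlim_real_sequentially filterlim_Suc])
    then show "\<delta> \<longlonglongrightarrow> 0" unfolding \<delta>_def by (intro tendsto_divide_0[OF tendsto_const] filterlim_at_top_imp_at_infinity)
  qed (simp add: \<delta>_def)
  \<comment> \<open>The rotation by -\<mu> moves the sector into the right half plane, because
    \<phi> < pi/2. There adding 1 can decrease neither 1 nor the modulus of the other
    summand.\<close>
  define den where "den n z = 1 + of_real (\<delta> n) * (z * cis (- \<mu>))" for n z
  have den: "1 \<le> norm (den n z)" "\<delta> n * norm z \<le> norm (den n z)" if zS: "z \<in> ?S" for n z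
  proof -
    obtain r \<psi> where z: "z = polar r \<psi>" "0 < r" "\<psi> \<in> {\<mu> - \<phi>..\<mu> + \<phi>}"
      using zS by (auto simp: sector_def)
    have "0 < cos (\<psi> - \<mu>)" using z(3) \<phi> by (intro cos_gt_zero_pi) auto
    then have re: "0 \<le> Re (z * cis (- \<mu>))" using z by (simp add: mult.assoc cis_mult)
    have "1 \<le> Re (den n z)" using re \<delta>(2)[of n] by (simp add: den_def)
    then show "1 \<le> norm (den n z)" using complex_Re_le_cmod order_trans by blast
    have "(\<delta> n * norm z)\<^sup>2 = (\<delta> n * Re (z * cis (- \<mu>)))\<^sup>2 + (\<delta> n * Im (z * cis (- \<mu>)))\<^sup>2"
      using cmod_power2[of "of_real (\<delta> n) * (z * cis (- \<mu>))"] \<delta>(2)[of n] by (simp add: norm_mult)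
    also have "\<dots> \<le> (1 + \<delta> n * Re (z * cis (- \<mu>)))\<^sup>2 + (\<delta> n * Im (z * cis (- \<mu>)))\<^sup>2"
    proof -
      have "(\<delta> n * Re (z * cis (- \<mu>)))\<^sup>2 \<le> (1 + \<delta> n * Re (z * cis (- \<mu>)))\<^sup>2"
        by (rule power_mono) (use mult_nonneg_nonneg[OF less_imp_le[OF \<delta>(2)[of n]] re] in linarith)+
      then show ?thesis by linarith
    qed
    also have "\<dots> = (norm (den n z))\<^sup>2" by (simp add: den_def cmod_power2)
    finally show "\<delta> n * norm z \<le> norm (den n z)" by (rule power2_le_imp_le) simp
  qed
  have den0: "den n z \<noteq> 0" if "z \<in> ?S" for n z using den(1)[OF that, of n] by auto
  define Gn where "Gn n z = act (1 / den n z) (G z)" for n z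
  define Dn where "Dn n z = act (- (of_real (\<delta> n) * cis (- \<mu>)) / (den n z)\<^sup>2) (G z) + act (1 / den n z) (D z)" for n z
  have Gn_holo: "holo_on (Gn n) (Dn n) ?S" for n
    unfolding Gn_def Dn_def
  proof (rule holo_on_act[OF holo])
    show "continuous_on ?S (\<lambda>z. - (of_real (\<delta> n) * cis (- \<mu>)) / (den n z)\<^sup>2)"
      using den0 by (auto simp: den_def intro!: continuous_intros)
    show "((\<lambda>z. 1 / den n z) has_field_derivative - (of_real (\<delta> n) * cis (- \<mu>)) / (den n z)\<^sup>2)
        (at z within ?S)" if "z \<in> ?S" for z
      using den0[OF that, of n] unfolding den_def
      by (auto intro!: derivative_eq_intros simp: power2_eq_square)
  qed
  define I where "I H n \<psi> = integral {1 / real (Suc n)..real (Suc n)} (\<lambda>r. act (cis \<psi>) (H (polar r \<psi>)))"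
    for H :: "complex \<Rightarrow> 'b" and n \<psi>
  have arcs: "norm (I (Gn n) n (\<mu> + \<phi>) - I (Gn n) n (\<mu> - \<phi>)) \<le>
      (K * C / sqrt (real (Suc n)) + K * C / real (Suc n)) * (2 * \<phi>)" for n
  proof -
    define r1 r2 where "r1 = 1 / real (Suc n)" and "r2 = real (Suc n)"
    have r: "0 < r1" "r1 \<le> r2" "0 < r2" by (auto simp: r1_def r2_def field_simps)
    have le: "\<mu> - \<phi> \<le> \<mu> + \<phi>" using \<phi> by simp
    have "I (Gn n) n (\<mu> + \<phi>) - I (Gn n) n (\<mu> - \<phi>) =
      integral {\<mu> - \<phi>..\<mu> + \<phi>} (\<lambda>\<psi>. act (\<i> * of_real r2 * cis \<psi>) (Gn n (polar r2 \<psi>)) -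
        act (\<i> * of_real r1 * cis \<psi>) (Gn n (polar r1 \<psi>)))"
      unfolding I_def r1_def[symmetric] unfolding r2_def[symmetric]
      by (rule Cauchy_polar_rectangle[OF Gn_holo r(2) le]) (use r in \<open>auto intro!: sectorI\<close>)
    also have "norm \<dots> \<le> (K * C / sqrt (real (Suc n)) + K * C / real (Suc n)) * (\<mu> + \<phi> - (\<mu> - \<phi>))"
    proof (rule integral_bound[OF le])
      show "continuous_on {\<mu> - \<phi>..\<mu> + \<phi>} (\<lambda>\<psi>. act (\<i> * of_real r2 * cis \<psi>) (Gn n (polar r2 \<psi>)) -
        act (\<i> * of_real r1 * cis \<psi>) (Gn n (polar r1 \<psi>)))"
        by (intro continuous_on_diff continuous_on_act_arc[OF Gn_holo]) (use r in \<open>auto intro!: sectorI\<close>)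
      fix \<psi> assume \<psi>: "\<psi> \<in> {\<mu> - \<phi>..\<mu> + \<phi>}"
      have est: "norm (act (\<i> * z) (Gn n z)) \<le> K * (norm z / norm (den n z) * norm (G z))" for z
        using K(2)[of "\<i> * z * (1 / den n z)" "G z"]
        by (simp only: Gn_def act_mult[symmetric]) (simp add: norm_mult norm_divide)
      define z1 z2 where "z1 = polar r1 \<psi>" and "z2 = polar r2 \<psi>"
      have z: "z1 \<in> ?S" "z2 \<in> ?S" "norm z1 = r1" "norm z2 = r2"
        using r \<psi> by (auto simp: z1_def z2_def norm_mult intro!: sectorI)
      have C0: "0 \<le> C" using bounded[OF z(1)] norm_ge_zero order_trans by blast
      \<comment> \<open>The inner arc uses boundedness of G and the lower bound 1 for the
        denominator; the outer arc below uses the decay of G and the lower bound \<delta>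
        |z|.\<close>
      have "norm z1 / norm (den n z1) * norm (G z1) \<le> r1 * C"
      proof (rule mult_mono)
        have "norm z1 / norm (den n z1) \<le> norm z1 / 1"
          using den(1)[OF z(1), of n] by (intro divide_left_mono) auto
        then show "norm z1 / norm (den n z1) \<le> r1" using z by simp
      qed (use bounded[OF z(1)] r in auto)
      then have e1: "norm (act (\<i> * z1) (Gn n z1)) \<le> K * (r1 * C)"
        using est[of z1] K(1) by (meson mult_left_mono order_trans less_imp_le)
      have "norm z2 / norm (den n z2) * norm (G z2) \<le> 1 / \<delta> n * (C / r2)"
      proof (rule mult_mono)
        have "0 < norm (den n z2)" using den(1)[OF z(2), of n] by linarith
        then show "norm z2 / norm (den n z2) \<le> 1 / \<delta> n"
          using den(2)[OF z(2), of n] \<delta>(2)[of n] by (simp add: field_simps)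
      qed (use decay[OF z(2)] z \<delta>(2)[of n] in auto)
      then have e2: "norm (act (\<i> * z2) (Gn n z2)) \<le> K * (1 / \<delta> n * (C / r2))"
        using est[of z2] K(1) by (meson mult_left_mono order_trans less_imp_le)
      have "\<delta> n * r2 = sqrt (real (Suc n))"
        unfolding \<delta>_def r2_def by (simp add: real_div_sqrt del: of_nat_Suc)
      then have "K * (1 / \<delta> n * (C / r2)) = K * C / sqrt (real (Suc n))"
        by (metis mult.assoc mult_1 times_divide_eq_left times_divide_eq_right divide_divide_eq_left)
      moreover have "K * (r1 * C) = K * C / real (Suc n)" by (simp add: r1_def)
      ultimately have "norm (act (\<i> * z2) (Gn n z2) - act (\<i> * z1) (Gn n z1)) \<le>
          K * C / sqrt (real (Suc n)) + K * C / real (Suc n)"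
        using norm_triangle_le_diff[OF add_mono[OF e2 e1]] by (simp only:)
      then show "norm (act (\<i> * of_real r2 * cis \<psi>) (Gn n (polar r2 \<psi>)) -
          act (\<i> * of_real r1 * cis \<psi>) (Gn n (polar r1 \<psi>))) \<le>
          K * C / sqrt (real (Suc n)) + K * C / real (Suc n)"
        by (simp only: z1_def z2_def mult.assoc)
    qed
    finally show ?thesis by simp
  qed
  \<comment> \<open>On the two boundary rays the damping is removed again; this is where
    integrability of G along the rays enters.\<close>
  have diff: "norm (I G n \<psi> - I (Gn n) n \<psi>) \<le>
      K * integral {0<..} (\<lambda>r. min 1 (\<delta> n * r) * norm (G (polar r \<psi>)))"
    if \<psi>: "\<psi> \<in> {\<mu> - \<phi>, \<mu> + \<phi>}" for \<psi> n
  proof -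
    define r1 r2 where "r1 = 1 / real (Suc n)" and "r2 = real (Suc n)"
    have r: "0 < r1" "r1 \<le> r2" "0 < r2" by (auto simp: r1_def r2_def field_simps)
    have in_S: "polar t \<psi> \<in> ?S" if "0 < t" for t using \<psi> \<phi> that by (auto intro!: sectorI)
    have ray: "(\<lambda>r. polar r \<psi>) ` {r1..r2} \<subseteq> ?S" using r by (auto intro!: in_S)
    have c1: "continuous_on {r1..r2} (\<lambda>t. act (cis \<psi>) (H (polar t \<psi>)))"
      if "holo_on H H' ?S" for H H'
      by (intro continuous_on continuous_intros continuous_on_ray[OF that ray])
    define g where "g t = min 1 (\<delta> n * t) * norm (G (polar t \<psi>))" for t
    have g: "g integrable_on {0<..}"
      unfolding g_def using \<delta> int[OF \<psi>]
      by (intro set_borel_integral_eq_integral(1) damped_integral_tendsto_0(1)) (auto simp: less_imp_le)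
    have gc: "g integrable_on {r1..r2}"
      unfolding g_def
      by (intro integrable_continuous_interval continuous_intros continuous_on_ray[OF holo ray])
    have "I G n \<psi> - I (Gn n) n \<psi> = integral {r1..r2} (\<lambda>t. act (cis \<psi>) (G (polar t \<psi>)) -
        act (cis \<psi>) (Gn n (polar t \<psi>)))"
      unfolding I_def r1_def[symmetric] unfolding r2_def[symmetric]
      by (rule integral_diff[symmetric]) (intro integrable_continuous_interval c1[OF holo] c1[OF Gn_holo])+
    also have "norm \<dots> \<le> integral {r1..r2} (\<lambda>t. K * g t)"
    proof (rule integral_norm_bound_integral)
      show "(\<lambda>t. act (cis \<psi>) (G (polar t \<psi>)) - act (cis \<psi>) (Gn n (polar t \<psi>))) integrable_on {r1..r2}"
        by (intro integrable_continuous_interval continuous_on_diff c1[OF holo] c1[OF Gn_holo])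
      show "(\<lambda>t. K * g t) integrable_on {r1..r2}"
        using integrable_cmul[OF gc, of K] by simp
      fix t assume t: "t \<in> {r1..r2}"
      define z where "z = polar t \<psi>"
      have t0: "0 < t" using t r by auto
      have z: "z \<in> ?S" "norm z = t" using in_S[OF t0] t0 by (auto simp: z_def norm_mult)
      have one: "1 - 1 / den n z = of_real (\<delta> n) * (z * cis (- \<mu>)) / den n z"
        using den0[OF z(1), of n] by (simp add: field_simps) (simp add: den_def)
      have nd: "0 < norm (den n z)" using den(1)[OF z(1), of n] by linarith
      have "norm (1 - 1 / den n z) = \<delta> n * t / norm (den n z)"
        unfolding one using z \<delta>(2)[of n] by (simp add: norm_mult norm_divide)
      also have "\<dots> \<le> min 1 (\<delta> n * t)"
        using den[OF z(1), of n] nd z(2) \<delta>(2)[of n] t0 by (simp add: divide_le_eq field_simps)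
      finally have m: "norm (1 - 1 / den n z) \<le> min 1 (\<delta> n * t)" .
      have "act (cis \<psi>) (G z) - act (cis \<psi>) (Gn n z) = act (cis \<psi> * (1 - 1 / den n z)) (G z)"
        by (simp add: Gn_def act_mult[symmetric] right_diff_distrib diff_left)
      also have "norm \<dots> \<le> K * (norm (1 - 1 / den n z) * norm (G z))"
        using K(2)[of "cis \<psi> * (1 - 1 / den n z)" "G z"] by (simp add: norm_mult)
      also have "\<dots> \<le> K * g t"
        unfolding g_def z_def[symmetric] using m K(1) by (intro mult_left_mono mult_right_mono) auto
      finally show "norm (act (cis \<psi>) (G (polar t \<psi>)) - act (cis \<psi>) (Gn n (polar t \<psi>))) \<le> K * g t"
        unfolding z_def .
    qed
    also have "\<dots> = K * integral {r1..r2} g" by simp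
    also have "\<dots> \<le> K * integral {0<..} g"
      using K(1) r \<delta>(2)[of n] by (intro mult_left_mono integral_subset_le gc g) (auto simp: g_def)
    finally show ?thesis unfolding g_def .
  qed
  have "(\<lambda>n. I G n (\<mu> + \<phi>) - I G n (\<mu> - \<phi>)) \<longlonglongrightarrow> 0"
  proof (rule Lim_null_comparison)
    let ?d = "\<lambda>n \<psi>. K * integral {0<..} (\<lambda>r. min 1 (\<delta> n * r) * norm (G (polar r \<psi>)))"
    have "norm (I G n (\<mu> + \<phi>) - I G n (\<mu> - \<phi>)) \<le> ?d n (\<mu> + \<phi>) + ?d n (\<mu> - \<phi>) +
        (K * C / sqrt (real (Suc n)) + K * C / real (Suc n)) * (2 * \<phi>)" for n
    proof -
      have tri: "norm (a - b) \<le> x + y + w" if "norm (a - a') \<le> x" "norm (b - b') \<le> y" "norm (a' - b') \<le> w"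
        for a b a' b' :: 'b and x y w
        using that norm_triangle_ineq[of "a - a'" "a' - b'"] norm_triangle_ineq4[of "a - b'" "b - b'"] by simp
      show ?thesis by (intro tri[OF diff diff arcs]) auto
    qed
    then show "\<forall>\<^sub>F n in sequentially. norm (I G n (\<mu> + \<phi>) - I G n (\<mu> - \<phi>)) \<le>
        ?d n (\<mu> + \<phi>) + ?d n (\<mu> - \<phi>) + (K * C * \<delta> n + K * C / real (Suc n)) * (2 * \<phi>)"
      unfolding \<delta>_def by (intro always_eventually allI) simp
    have d: "(\<lambda>n. integral {0<..} (\<lambda>r. min 1 (\<delta> n * r) * norm (G (polar r \<psi>)))) \<longlonglongrightarrow> 0"
      if "\<psi> \<in> {\<mu> - \<phi>, \<mu> + \<phi>}" for \<psi>
      using \<delta> int[OF that] by (intro damped_integral_tendsto_0(2)) (auto simp: less_imp_le)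
    have "(\<lambda>n. ?d n (\<mu> + \<phi>) + ?d n (\<mu> - \<phi>) + (K * C * \<delta> n + K * C / real (Suc n)) * (2 * \<phi>))
        \<longlonglongrightarrow> K * 0 + K * 0 + (K * C * 0 + 0) * (2 * \<phi>)"
      by (intro tendsto_add tendsto_mult tendsto_const d \<delta> LIMSEQ_Suc[OF lim_const_over_n]) auto
    then show "(\<lambda>n. ?d n (\<mu> + \<phi>) + ?d n (\<mu> - \<phi>) + (K * C * \<delta> n + K * C / real (Suc n)) * (2 * \<phi>)) \<longlonglongrightarrow> 0"
      by simp
  qed
  then show ?thesis by (simp add: I_def)
qed

end

section \<open>Linear partial operators\<close>

text \<open>The real-linear structure shared by T, its powers and
  \<open>op_poly p T\<close>.\<close>

definition linear_pmap :: "('a::real_vector \<rightharpoonup> 'a) \<Rightarrow> bool" where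
  "linear_pmap T \<longleftrightarrow> T 0 = Some 0 \<and>
     (\<forall>v w x y. T v = Some x \<longrightarrow> T w = Some y \<longrightarrow> T (v + w) = Some (x + y)) \<and>
     (\<forall>v x r. T v = Some x \<longrightarrow> T (r *\<^sub>R v) = Some (r *\<^sub>R x))"

lemma linear_pmap_0: "linear_pmap T \<Longrightarrow> T 0 = Some 0"
  and linear_pmap_add: "linear_pmap T \<Longrightarrow> T v = Some x \<Longrightarrow> T w = Some y \<Longrightarrow> T (v + w) = Some (x + y)"
  and linear_pmap_scaleR: "linear_pmap T \<Longrightarrow> T v = Some x \<Longrightarrow> T (r *\<^sub>R v) = Some (r *\<^sub>R x)"
  by (auto simp: linear_pmap_def)

lemma linear_pmap_diff:
  "linear_pmap T \<Longrightarrow> T v = Some x \<Longrightarrow> T w = Some y \<Longrightarrow> T (v - w) = Some (x - y)"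
  using linear_pmap_add[of T v x "- w" "- y"] linear_pmap_scaleR[of T w y "- 1"] by simp

lemma linear_pmap_sum:
  "linear_pmap T \<Longrightarrow> (\<And>i. i \<in> I \<Longrightarrow> T (v i) = Some (x i)) \<Longrightarrow> T (sum v I) = Some (sum x I)"
  by (induction I rule: infinite_finite_induct) (auto simp: linear_pmap_0 intro: linear_pmap_add)

lemma closed_ops_linear: "T \<in> closed_ops \<Longrightarrow> linear_pmap T"
  unfolding closed_ops_def linear_pmap_def mem_Collect_eq
  by (intro conjI allI impI) (blast, blast, simp flip: rmul_of_real)

lemma op_pow_SucI: "op_pow T k v = Some x \<Longrightarrow> T x = Some y \<Longrightarrow> op_pow T (Suc k) v = Some y"
  by (simp add: map_comp_def)

lemma op_pow_SucD: "op_pow T (Suc k) v = Some y \<Longrightarrow> \<exists>x. op_pow T k v = Some x \<and> T x = Some y"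
  by (auto simp: map_comp_Some_iff)

lemma op_pow_1: "op_pow T (Suc 0) = T"
  by (auto simp: map_comp_def fun_eq_iff)

lemma op_pow_addI:
  "op_pow T j v = Some x \<Longrightarrow> op_pow T i x = Some y \<Longrightarrow> op_pow T (i + j) v = Some y"
proof (induction i arbitrary: y)
  case (Suc i)
  then obtain z where "op_pow T i x = Some z" "T z = Some y" using op_pow_SucD by metis
  then show ?case using Suc by (metis add_Suc op_pow_SucI)
qed simp

lemma op_pow_addD:
  "op_pow T (i + j) v = Some y \<Longrightarrow> \<exists>x. op_pow T j v = Some x \<and> op_pow T i x = Some y"
proof (induction i arbitrary: y)
  case (Suc i)
  then obtain z where z: "op_pow T (i + j) v = Some z" "T z = Some y"
    using op_pow_SucD[of T "i + j" v y] by (metis add_Suc)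
  then show ?case using Suc.IH op_pow_SucI by metis
qed simp

lemma op_pow_dom_mono: "v \<in> dom (op_pow T k) \<Longrightarrow> i \<le> k \<Longrightarrow> v \<in> dom (op_pow T i)"
  using op_pow_addD[of T "k - i" i v] by (auto simp: dom_def)

lemma linear_pmap_op_pow:
  assumes "linear_pmap T"
  shows "linear_pmap (op_pow T k)"
proof (induction k)
  case (Suc k)
  show ?case
    unfolding linear_pmap_def
  proof (intro conjI allI impI)
    show "op_pow T (Suc k) 0 = Some 0"
      by (rule op_pow_SucI[OF linear_pmap_0[OF Suc] linear_pmap_0[OF assms]])
    show "op_pow T (Suc k) (v + w) = Some (x + y)"
      if "op_pow T (Suc k) v = Some x" "op_pow T (Suc k) w = Some y" for v w x y
      using op_pow_SucD[OF that(1)] op_pow_SucD[OF that(2)] linear_pmap_add[OF Suc] linear_pmap_add[OF assms]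
      by (blast intro: op_pow_SucI)
    show "op_pow T (Suc k) (r *\<^sub>R v) = Some (r *\<^sub>R x)" if "op_pow T (Suc k) v = Some x" for v x r
      using op_pow_SucD[OF that] linear_pmap_scaleR[OF Suc] linear_pmap_scaleR[OF assms]
      by (blast intro: op_pow_SucI)
  qed
qed (simp add: linear_pmap_def)

lemma op_poly_eq_Some_iff:
  "op_poly p T v = Some w \<longleftrightarrow> v \<in> dom (op_pow T (degree p)) \<and>
     w = (\<Sum>i\<le>degree p. coeff p i *\<^sub>R the (op_pow T i v))"
  by (auto simp: op_poly_def)

lemma op_poly_SomeI:
  assumes "degree p = m" "\<And>i. i \<le> m \<Longrightarrow> op_pow T i v = Some (x i)"
  shows "op_poly p T v = Some (\<Sum>i\<le>m. coeff p i *\<^sub>R x i)"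
  unfolding op_poly_eq_Some_iff using assms(2)[of m] assms by auto

lemma op_poly_quadratic:
  "op_poly [:a, b, 1:] T v = Some w \<longleftrightarrow>
     (\<exists>x y. T v = Some x \<and> T x = Some y \<and> w = a *\<^sub>R v + b *\<^sub>R x + y)"
proof -
  have "op_pow T 2 v = Some y \<longleftrightarrow> (\<exists>x. T v = Some x \<and> T x = Some y)" for y
    by (auto simp: numeral_2_eq_2 map_comp_Some_iff)
  then show ?thesis
    unfolding op_poly_eq_Some_iff
    by (auto simp: numeral_2_eq_2 op_pow_1 map_comp_Some_iff dom_def simp del: op_pow.simps(2))
       (auto simp: map_comp_Some_iff)
qed

text \<open>The leading term \<open>T\<^sup>m v\<close> differs from a multiple of \<open>p[T] v\<close> by terms of lower order.\<close>

lemma op_poly_dom_lift: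
  assumes T: "linear_pmap T" and p: "p \<noteq> 0" "degree p = m"
  shows "op_poly p T v = Some w \<Longrightarrow> w \<in> dom (op_pow T j) \<Longrightarrow> v \<in> dom (op_pow T (j + m))"
proof (induction j)
  case 0
  then show ?case using p by (auto simp: op_poly_eq_Some_iff)
next
  case (Suc j)
  note lin = linear_pmap_op_pow[OF T, of "Suc j"]
  have "w \<in> dom (op_pow T j)" using op_pow_dom_mono[OF Suc.prems(2)] by simp
  then have v: "v \<in> dom (op_pow T (j + m))" using Suc by blast
  then have pow: "op_pow T i v = Some (the (op_pow T i v))" if "i \<le> m" for i
    using op_pow_dom_mono[OF v, of i] that by (auto simp: dom_def)
  define x where "x i = the (op_pow T i v)" for i
  \<comment> \<open>For i < m the index \<open>Suc j + i\<close> is still at most j + m, so the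
    induction hypothesis already covers all terms but the leading one.\<close>
  have low: "\<exists>y. op_pow T (Suc j) (x i) = Some y" if "i < m" for i
  proof -
    have "v \<in> dom (op_pow T (Suc j + i))" using op_pow_dom_mono[OF v, of "Suc j + i"] that by simp
    then show ?thesis
      using op_pow_addD[of T "Suc j" i v] pow[of i] that by (auto simp: dom_def x_def)
  qed
  then obtain y where y: "\<And>i. i < m \<Longrightarrow> op_pow T (Suc j) (x i) = Some (y i)" by metis
  have sum: "op_pow T (Suc j) (\<Sum>i<m. coeff p i *\<^sub>R x i) = Some (\<Sum>i<m. coeff p i *\<^sub>R y i)"
    by (rule linear_pmap_sum[OF lin]) (use y linear_pmap_scaleR[OF lin] in auto)
  obtain z where z: "op_pow T (Suc j) w = Some z" using Suc.prems(2) by (auto simp: dom_def)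
  have "w = (\<Sum>i\<le>m. coeff p i *\<^sub>R x i)"
    using Suc.prems(1) p by (simp add: op_poly_eq_Some_iff x_def)
  also have "\<dots> = (\<Sum>i<m. coeff p i *\<^sub>R x i) + coeff p m *\<^sub>R x m"
    by (simp add: lessThan_Suc_atMost[symmetric])
  finally have "x m = (1 / coeff p m) *\<^sub>R (w - (\<Sum>i<m. coeff p i *\<^sub>R x i))"
    using p by auto
  then have "op_pow T (Suc j) (x m) = Some ((1 / coeff p m) *\<^sub>R (z - (\<Sum>i<m. coeff p i *\<^sub>R y i)))"
    by (simp only:) (intro linear_pmap_scaleR[OF lin] linear_pmap_diff[OF lin] z sum)
  then have "op_pow T (Suc j + m) v \<noteq> None"
    using op_pow_addI[OF pow[of m, folded x_def]] by fastforce
  then show ?case by (auto simp: dom_def)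
qed

text \<open>On the domain of \<open>op_pow T (j + m)\<close> both orders of application give the sum
  of the terms p_i T^(i+j) v, since real coefficients pass through T.\<close>

lemma op_poly_commute_pow:
  assumes T: "linear_pmap T" and m: "degree p = m"
    and v: "op_pow T j v = Some x" "v \<in> dom (op_pow T (j + m))" and w: "op_poly p T v = Some w"
  shows "\<exists>u. op_pow T j w = Some u \<and> op_poly p T x = Some u"
proof -
  note lin = linear_pmap_op_pow[OF T, of j]
  define xi where "xi i = the (op_pow T i v)" for i
  have xi: "op_pow T i v = Some (xi i)" if "i \<le> m" for i
    using op_pow_dom_mono[OF v(2), of i] that by (auto simp: dom_def xi_def)
  have "\<exists>y. op_pow T (j + i) v = Some y" if "i \<le> m" for i
    using op_pow_dom_mono[OF v(2), of "j + i"] that by (auto simp: dom_def)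
  then obtain y where y: "\<And>i. i \<le> m \<Longrightarrow> op_pow T (j + i) v = Some (y i)" by metis
  have a: "op_pow T j (xi i) = Some (y i)" if "i \<le> m" for i
    using op_pow_addD[OF y[OF that]] xi[OF that] by simp
  have b: "op_pow T i x = Some (y i)" if "i \<le> m" for i
    using op_pow_addD[of T i j v "y i"] y[OF that] v(1) by (simp add: add.commute)
  have w: "w = (\<Sum>i\<le>m. coeff p i *\<^sub>R xi i)"
    using w m by (simp add: op_poly_eq_Some_iff xi_def)
  have "op_pow T j w = Some (\<Sum>i\<le>m. coeff p i *\<^sub>R y i)"
    unfolding w by (rule linear_pmap_sum[OF lin]) (use a linear_pmap_scaleR[OF lin] in auto)
  moreover have "op_poly p T x = Some (\<Sum>i\<le>m. coeff p i *\<^sub>R y i)"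
    by (rule op_poly_SomeI[OF m b])
  ultimately show ?thesis by blast
qed

lemma linear_pmap_op_poly:
  assumes "linear_pmap T"
  shows "linear_pmap (op_poly p T)"
  unfolding linear_pmap_def
proof (intro conjI allI impI)
  note lin = linear_pmap_op_pow[OF assms]
  have eq: "op_poly p T v = Some x \<longleftrightarrow>
      (\<exists>y. (\<forall>i\<le>degree p. op_pow T i v = Some (y i)) \<and> x = (\<Sum>i\<le>degree p. coeff p i *\<^sub>R y i))" for v x
  proof (rule iffI)
    assume L: "op_poly p T v = Some x"
    then have "v \<in> dom (op_pow T i)" if "i \<le> degree p" for i
      using that op_pow_dom_mono op_poly_eq_Some_iff by metis
    then have "op_pow T i v = Some (the (op_pow T i v))" if "i \<le> degree p" for i
      using that by fastforce
    with L show "\<exists>y. (\<forall>i\<le>degree p. op_pow T i v = Some (y i)) \<and> x = (\<Sum>i\<le>degree p. coeff p i *\<^sub>R y i)"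
      unfolding op_poly_eq_Some_iff by (intro exI[of _ "\<lambda>i. the (op_pow T i v)"]) blast
  next
    assume "\<exists>y. (\<forall>i\<le>degree p. op_pow T i v = Some (y i)) \<and> x = (\<Sum>i\<le>degree p. coeff p i *\<^sub>R y i)"
    then show "op_poly p T v = Some x" using op_poly_SomeI[OF refl] by blast
  qed
  show "op_poly p T 0 = Some 0"
    using op_poly_SomeI[OF refl linear_pmap_0[OF lin], of p] by simp
  show "op_poly p T (v + w) = Some (x + y)"
    if xy: "op_poly p T v = Some x" "op_poly p T w = Some y" for v w x y
  proof -
    obtain x' where x': "\<forall>i\<le>degree p. op_pow T i v = Some (x' i)" "x = (\<Sum>i\<le>degree p. coeff p i *\<^sub>R x' i)"
      using iffD1[OF eq xy(1)] by blast
    obtain y' where y': "\<forall>i\<le>degree p. op_pow T i w = Some (y' i)" "y = (\<Sum>i\<le>degree p. coeff p i *\<^sub>R y' i)"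
      using iffD1[OF eq xy(2)] by blast
    have "op_poly p T (v + w) = Some (\<Sum>i\<le>degree p. coeff p i *\<^sub>R (x' i + y' i))"
      by (rule op_poly_SomeI[OF refl]) (use x' y' linear_pmap_add[OF lin] in blast)
    then show ?thesis by (simp add: x' y' sum.distrib scaleR_add_right)
  qed
  show "op_poly p T (r *\<^sub>R v) = Some (r *\<^sub>R x)" if x: "op_poly p T v = Some x" for v x r
  proof -
    obtain x' where x': "\<forall>i\<le>degree p. op_pow T i v = Some (x' i)" "x = (\<Sum>i\<le>degree p. coeff p i *\<^sub>R x' i)"
      using iffD1[OF eq x] by blast
    have "op_poly p T (r *\<^sub>R v) = Some (\<Sum>i\<le>degree p. coeff p i *\<^sub>R (r *\<^sub>R x' i))"
      by (rule op_poly_SomeI[OF refl]) (use x' linear_pmap_scaleR[OF lin] in blast)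
    then show ?thesis by (simp add: x' scaleR_sum_right mult.commute)
  qed
qed


section \<open>Resolvents\<close>

text \<open>Covers all operators Q_s[T] and, with a = 1 and b = 0, also 1 + T^2, which is Q_s[T] for
  s an imaginary unit.\<close>

locale invertible_quadratic =
  fixes T :: "('v::real_normed_vector, 'n::{finite,linorder}) cl_module \<rightharpoonup> ('v, 'n) cl_module"
    and a b :: real
  assumes lin: "linear_pmap T" and inv: "boundedly_invertible (op_poly [:a, b, 1:] T)"
begin

definition A where "A = op_inv (op_poly [:a, b, 1:] T)"

text \<open>Total because the inverse A maps into the domain of T^2; T A is kept as one everywhere
  defined map.\<close>

definition TA where "TA v = the (T (A v))"

lemma bounded_linear_A: "bounded_linear A"
  using inv by (simp add: boundedly_invertible_def A_def bounded_ops_def)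

lemma op_poly_A: "op_poly [:a, b, 1:] T (A w) = Some w"
  using inv theI'[of "\<lambda>v. op_poly [:a, b, 1:] T v = Some w"]
  unfolding boundedly_invertible_def A_def op_inv_def by blast

lemma A_eqI: "T v = Some x \<Longrightarrow> T x = Some y \<Longrightarrow> A (a *\<^sub>R v + b *\<^sub>R x + y) = v"
  using inv op_poly_A[of "a *\<^sub>R v + b *\<^sub>R x + y"] op_poly_quadratic[of a b T v]
  unfolding boundedly_invertible_def by metis

lemma T_A: "T (A w) = Some (TA w)"
  and T_TA: "T (TA w) = Some (w - a *\<^sub>R A w - b *\<^sub>R TA w)"
proof -
  obtain x y where "T (A w) = Some x" "T x = Some y" "w = a *\<^sub>R A w + b *\<^sub>R x + y"
    using op_poly_A[of w] unfolding op_poly_quadratic by blast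
  then show "T (A w) = Some (TA w)" "T (TA w) = Some (w - a *\<^sub>R A w - b *\<^sub>R TA w)"
    by (simp_all add: TA_def algebra_simps)
qed

text \<open>Applying T to the equation Q[T] A v = v shows that T A v is a preimage of x = T v under
  Q[T], and preimages are unique.\<close>

lemma A_commute:
  assumes "T v = Some x"
  shows "A x = TA v"
proof -
  have "T (v - a *\<^sub>R A v - b *\<^sub>R TA v) =
      Some (x - a *\<^sub>R TA v - b *\<^sub>R (v - a *\<^sub>R A v - b *\<^sub>R TA v))"
    by (intro linear_pmap_diff[OF lin] linear_pmap_scaleR[OF lin] assms T_A T_TA)
  from A_eqI[OF T_TA this] show ?thesis by simp
qed

lemma linear_TA: "linear TA"
proof (rule linearI)
  interpret A: bounded_linear A by (rule bounded_linear_A)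
  fix v w and r :: real
  show "TA (v + w) = TA v + TA w"
    using linear_pmap_add[OF lin T_A[of v] T_A[of w]] by (simp add: TA_def A.add)
  show "TA (r *\<^sub>R v) = r *\<^sub>R TA v"
    using linear_pmap_scaleR[OF lin T_A[of v], of r] by (simp add: TA_def A.scaleR)
qed

end

text \<open>Elements \<open>s\<close> of the slice \<open>\<complex>\<^sub>J\<close> are given by complex numbers; \<open>A\<close> and \<open>S\<close> are \<open>Q\<^sub>s[T]\<^sup>-\<^sup>1\<close> and
  \<open>S\<^sub>L\<^sup>-\<^sup>1(s, T)\<close>.\<close>

locale slice_resolvent =
  fixes T :: "('v::real_normed_vector, 'n::{finite,linorder}) cl_module \<rightharpoonup> ('v, 'n) cl_module"
    and J :: "'n clifford"
  assumes closed: "T \<in> closed_ops" and unit: "J \<in> imag_units"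
begin

abbreviation e :: "complex \<Rightarrow> 'n clifford" where "e \<equiv> slice_emb J"

definition \<rho> :: "complex set" where "\<rho> = {z. e z \<in> S_resolvent_set T}"

definition A :: "complex \<Rightarrow> ('v, 'n) cl_module \<Rightarrow> ('v, 'n) cl_module" where
  "A z = op_inv (Q_op (e z) T)"

definition S :: "complex \<Rightarrow> ('v, 'n) cl_module \<Rightarrow> ('v, 'n) cl_module" where
  "S z = S_L_inv (e z) T"

lemma lin: "linear_pmap T"
  by (rule closed_ops_linear[OF closed])

lemma Q_op_e: "Q_op (e z) T = op_poly [:(norm z)\<^sup>2, - (2 * Re z), 1:] T"
  by (simp add: Q_op_def norm_slice_emb[OF unit])
     (simp add: slice_emb_def cl_real_slice_point[OF unit])

lemma quadratic: "z \<in> \<rho> \<Longrightarrow> invertible_quadratic T ((norm z)\<^sup>2) (- (2 * Re z))"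
  by unfold_locales (auto simp: lin \<rho>_def S_resolvent_set_def Q_op_e[symmetric])

lemma A_quadratic: "z \<in> \<rho> \<Longrightarrow> A z = invertible_quadratic.A T ((norm z)\<^sup>2) (- (2 * Re z))"
  by (simp add: A_def Q_op_e invertible_quadratic.A_def[OF quadratic])

lemma A_cnj: "A (cnj z) = A z"
  by (simp add: A_def Q_op_e)

definition TA :: "complex \<Rightarrow> ('v, 'n) cl_module \<Rightarrow> ('v, 'n) cl_module" where
  "TA z v = the (T (A z v))"

context
  fixes z assumes z: "z \<in> \<rho>"
begin

interpretation q: invertible_quadratic T "(norm z)\<^sup>2" "- (2 * Re z)"
  rewrites "q.A = A z"
  using quadratic[OF z] A_quadratic[OF z] by auto

lemma qTA: "q.TA = TA z"
  by (auto simp: q.TA_def TA_def)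

lemmas bounded_linear_A = q.bounded_linear_A
lemmas T_A = q.T_A[unfolded qTA]
lemmas T_TA = q.T_TA[unfolded qTA]
lemmas A_commute = q.A_commute[unfolded qTA]
lemmas A_eqI = q.A_eqI
lemmas linear_TA = q.linear_TA[unfolded qTA]

end

section \<open>Resolvent equations and cancellation of resolvents\<close>

lemma e_cnj: "pv_cnj (e z) = e (cnj z)"
  by (simp add: slice_emb_def pv_cnj_slice_point[OF unit])

lemma S_eq: "S z v = A z (lmul (e (cnj z)) v) - TA z v"
  by (simp add: S_def S_L_inv_def A_def TA_def e_cnj)

lemma lmul_e: "lmul (e z) (lmul (e w) v) = lmul (e (z * w)) v"
  by (simp add: slice_emb_mult[OF unit] lmul_mult)

text \<open>The left S-resolvent equation: S(z) z - T S(z) is the identity. Although A and T A need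
  not commute with the slice scalars z and cnj z, they commute with the real numbers z + cnj z and z
  cnj z, and only these occur.\<close>

lemma T_S:
  assumes z: "z \<in> \<rho>"
  shows "T (S z v) = Some (S z (lmul (e z) v) - v)"
proof -
  interpret A: bounded_linear "A z" by (rule bounded_linear_A[OF z])
  interpret TA: linear "TA z" by (rule linear_TA[OF z])
  have "lmul (e z) v + lmul (e (cnj z)) v = lmul (e (of_real (2 * Re z))) v"
    unfolding complex_add_cnj[symmetric] by (simp add: lmul.add_left)
  then have "TA z (lmul (e z) v) + TA z (lmul (e (cnj z)) v) = (2 * Re z) *\<^sub>R TA z v"
    by (simp only: TA.add[symmetric] slice_emb_simps lmul_of_real TA.scale)
  moreover have "A z (lmul (e (cnj z)) (lmul (e z) v)) = (norm z)\<^sup>2 *\<^sub>R A z v"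
    by (simp only: lmul_e mult.commute[of "cnj z"] complex_norm_square[symmetric] slice_emb_simps lmul_of_real A.scaleR)
  moreover have "T (S z v) = Some (TA z (lmul (e (cnj z)) v) -
      (v - (norm z)\<^sup>2 *\<^sub>R A z v - (- (2 * Re z)) *\<^sub>R TA z v))"
    unfolding S_eq by (intro linear_pmap_diff[OF lin] T_A[OF z] T_TA[OF z])
  ultimately show ?thesis by (simp add: S_eq algebra_simps)
qed

text \<open>Q_s[T] depends on s through its real part and modulus only, so the parts T A cancel. Off
  the real axis this recovers A from the resolvent.\<close>

lemma S_cnj_diff:
  assumes z: "z \<in> \<rho>"
  shows "S z v - S (cnj z) v = A z (lmul (e (cnj z - z)) v)"
proof -
  interpret A: bounded_linear "A z" by (rule bounded_linear_A[OF z])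
  have "TA (cnj z) v = TA z v" by (simp add: TA_def A_cnj)
  then show ?thesis by (simp add: S_eq A_cnj A.diff lmul.diff_left)
qed

text \<open>The scalar factor is the quadratic polynomial Q_t evaluated at s. The vector
  \<open>S s v\<close> lies in the domain of T but in general not in that of T^2, so Q_t[T] cannot
  be applied to it directly. Instead \<open>A t\<close> is applied to the equations for T y and T
  y1, and \<open>A_commute\<close> exchanges it with T.\<close>

lemma resolvent_identity:
  assumes s: "s \<in> \<rho>" and t: "t \<in> \<rho>" and S: "bounded_linear (S s)"
  shows "A t (S s (lmul (e ((s - t) * (s - cnj t))) v)) =
    S s v + TA t v + A t (lmul (e s) v) - (2 * Re t) *\<^sub>R A t v"
proof -
  interpret A: bounded_linear "A t" by (rule bounded_linear_A[OF t])
  interpret S: bounded_linear "S s" by (rule S)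
  interpret TA: linear "TA t" by (rule linear_TA[OF t])
  define y where "y = S s v"
  define y1 where "y1 = S s (lmul (e s) v)"
  define y2 where "y2 = S s (lmul (e (s * s)) v)"
  have Ty: "T y = Some (y1 - v)" and Ty1: "T y1 = Some (y2 - lmul (e s) v)"
    using T_S[OF s, of v] T_S[OF s, of "lmul (e s) v"] by (simp_all add: y_def y1_def y2_def lmul_e)
  have Ay1: "A t y1 = TA t y + A t v" using A_commute[OF t Ty] by (simp add: A.diff algebra_simps)
  have "A t y2 = TA t y1 + A t (lmul (e s) v)"
    using A_commute[OF t Ty1] by (simp add: A.diff algebra_simps)
  moreover have "TA t y1 = (y - (norm t)\<^sup>2 *\<^sub>R A t y + (2 * Re t) *\<^sub>R TA t y) + TA t v"
  proof -
    have "T (A t y1) = Some ((y - (norm t)\<^sup>2 *\<^sub>R A t y - (- (2 * Re t)) *\<^sub>R TA t y) + TA t v)"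
      unfolding Ay1 by (intro linear_pmap_add[OF lin] T_A[OF t] T_TA[OF t])
    then show ?thesis using T_A[OF t, of y1] by simp
  qed
  moreover have "(s - t) * (s - cnj t) = s * s - of_real (2 * Re t) * s + of_real ((norm t)\<^sup>2)"
    unfolding complex_norm_square complex_add_cnj[symmetric] by (simp add: algebra_simps)
  then have w: "S s (lmul (e ((s - t) * (s - cnj t))) v) = y2 - (2 * Re t) *\<^sub>R y1 + (norm t)\<^sup>2 *\<^sub>R y"
    unfolding y_def y1_def y2_def
    by (simp only: slice_emb_simps slice_emb_mult[OF unit] lmul_mult lmul.add_left lmul.diff_left
        lmul_of_real S.add S.diff S.scaleR)
  ultimately show ?thesis
    unfolding w by (simp add: A.add A.diff A.scaleR Ay1 y_def algebra_simps)
qed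

text \<open>Subtracting \<open>S t\<close> from the resolvent identity with cnj t = 2 Re t - t
  leaves s - t as a factor acting directly on v. This is the form from which the complex derivative
  is read off.\<close>

lemma S_diff:
  assumes "s \<in> \<rho>" and t: "t \<in> \<rho>" and "bounded_linear (S s)"
  shows "S s v - S t v = A t (S s (lmul (e ((s - t) * (s - cnj t))) v) - lmul (e (s - t)) v)"
proof -
  interpret A: bounded_linear "A t" by (rule bounded_linear_A[OF t])
  have "cnj t = of_real (2 * Re t) - t" by (simp add: complex_eq_iff)
  then have "A t (lmul (e (cnj t)) v) = (2 * Re t) *\<^sub>R A t v - A t (lmul (e t) v)"
    by (simp only: slice_emb_simps lmul.diff_left A.diff lmul_of_real A.scaleR)
  moreover define w where "w = S s (lmul (e ((s - t) * (s - cnj t))) v)"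
  moreover have "A t w = S s v + TA t v + A t (lmul (e s) v) - (2 * Re t) *\<^sub>R A t v"
    unfolding w_def by (rule resolvent_identity[OF assms])
  ultimately show ?thesis
    unfolding w_def[symmetric] by (simp add: A.diff A.add S_eq[of t] lmul.diff_left algebra_simps)
qed

text \<open>By \<open>op_poly_dom_lift\<close> the hypothesis puts \<open>A \<i> x\<close> into the
  domain of T^(2+m), where m is the degree of p; there T^2 commutes with p[T]. As T^2
  \<open>A \<i>\<close> = 1 - \<open>A \<i>\<close>, this gives p[T] (x - \<open>A \<i> x\<close>) =
  u - \<open>A \<i> u\<close>, and adding the hypothesis proves the claim.\<close>

lemma op_poly_cancel:
  assumes i: "\<i> \<in> \<rho>" and p: "p \<noteq> 0" and eq: "op_poly p T (A \<i> x) = Some (A \<i> u)"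
  shows "op_poly p T x = Some u"
proof -
  have pow2: "op_pow T 2 (A \<i> w) = Some (w - A \<i> w)" for w
    using T_A[OF i, of w] T_TA[OF i, of w] by (simp add: numeral_2_eq_2)
  have "A \<i> x \<in> dom (op_pow T (2 + degree p))"
    by (rule op_poly_dom_lift[OF lin p refl eq]) (use pow2 in auto)
  from op_poly_commute_pow[OF lin refl pow2 this eq]
  have "op_poly p T (x - A \<i> x) = Some (u - A \<i> u)" using pow2[of u] by auto
  from linear_pmap_add[OF linear_pmap_op_poly[OF lin] this eq] show ?thesis by simp
qed

lemma op_poly_cancel_funpow:
  assumes "\<i> \<in> \<rho>" "p \<noteq> 0"
  shows "op_poly p T ((A \<i> ^^ k) x) = Some ((A \<i> ^^ k) u) \<Longrightarrow> op_poly p T x = Some u"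
  by (induction k) (auto dest: op_poly_cancel[OF assms])

lemma A_TA_commute:
  assumes i: "z \<in> \<rho>"
  shows "A z (TA z v) = TA z (A z v)"
  using A_commute[OF i T_A[OF i]] .

text \<open>Each application of T is paired with one of the k factors A, which limits j to
  k.\<close>

lemma op_pow_A_funpow:
  assumes i: "z \<in> \<rho>"
  shows "j \<le> k \<Longrightarrow> op_pow T j ((A z ^^ k) v) = Some ((TA z ^^ j) ((A z ^^ (k - j)) v))"
proof (induction j)
  case (Suc j)
  have comm: "(TA z ^^ j) (A z w) = A z ((TA z ^^ j) w)" for w
    by (induction j) (simp_all add: A_TA_commute[OF i])
  have "k - j = Suc (k - Suc j)" using Suc.prems by simp
  then have "(TA z ^^ j) ((A z ^^ (k - j)) v) = A z ((TA z ^^ j) ((A z ^^ (k - Suc j)) v))"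
    by (simp add: comm)
  then show ?case
    using Suc T_A[OF i] by (intro op_pow_SucI[of T j]) auto
qed simp

end

section \<open>Norm estimates and holomorphy of the resolvent\<close>

text \<open>Caratheodory's form of differentiability: the increment factors exactly through w - z,
  with a quotient that is continuous at z.\<close>

lemma (in complex_action) holo_derivativeI:
  assumes eq: "\<And>w. w \<in> X \<Longrightarrow> G w - G z = act (w - z) (q w)"
    and q: "(q \<longlongrightarrow> q z) (at z within X)"
  shows "(G has_derivative (\<lambda>h. act h (q z))) (at z within X)"
proof -
  obtain K where K: "0 < K" "\<And>z x. norm (act z x) \<le> K * (norm z * norm x)"
    using norm_act_le by metis
  have "((\<lambda>w. norm (G w - G z - act (w - z) (q z)) / norm (w - z)) \<longlongrightarrow> 0) (at z within X)"
  proof (rule Lim_null_comparison)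
    have "((\<lambda>w. K * norm (q w - q z)) \<longlongrightarrow> K * norm (q z - q z)) (at z within X)"
      by (intro tendsto_intros q)
    then show "((\<lambda>w. K * norm (q w - q z)) \<longlongrightarrow> 0) (at z within X)" by simp
    show "\<forall>\<^sub>F w in at z within X. norm (norm (G w - G z - act (w - z) (q z)) / norm (w - z)) \<le>
        K * norm (q w - q z)"
      unfolding eventually_at_filter
    proof (intro always_eventually allI impI)
      fix w assume w: "w \<noteq> z" "w \<in> X"
      have "norm (G w - G z - act (w - z) (q z)) \<le> K * (norm (w - z) * norm (q w - q z))"
        using K(2)[of "w - z" "q w - q z"] eq[OF w(2)] by (simp add: diff_right)
      then show "norm (norm (G w - G z - act (w - z) (q z)) / norm (w - z)) \<le> K * norm (q w - q z)"
        using w(1) by (simp add: field_simps)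
    qed
  qed
  then show ?thesis
    unfolding has_derivative_iff_norm using bounded_linear_left by auto
qed

lemma complex_action_clifford:
  assumes "J \<in> imag_units"
  shows "complex_action (\<lambda>z a. slice_emb J z * a)"
  by (intro complex_action.intro complex_action_axioms.intro
      bounded_bilinear.comp1[OF bounded_bilinear_clifford_mult bounded_linear_slice_emb])
     (simp_all add: slice_emb_mult[OF assms] mult.assoc)

text \<open>Composition on the right reverses the order of factors, so the action law rests on
  commutativity of the complex numbers.\<close>

lemma complex_action_operators:
  assumes "J \<in> imag_units"
  shows "complex_action (\<lambda>z B :: ('v::banach, 'n::{finite,linorder}) cl_module \<Rightarrow>\<^sub>L ('v, 'n) cl_module.
    B o\<^sub>L lmul_op (slice_emb J z))"
proof (intro complex_action.intro complex_action_axioms.intro)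
  show "bounded_bilinear (\<lambda>z B :: ('v, 'n) cl_op. B o\<^sub>L lmul_op (slice_emb J z))"
    by (rule bounded_bilinear.comp1[OF bounded_bilinear.flip[OF bounded_bilinear_blinfun_compose]
        bounded_linear_compose[OF bounded_linear_lmul_op bounded_linear_slice_emb]])
  show "B o\<^sub>L lmul_op (slice_emb J 1) = B" for B :: "('v, 'n) cl_op"
    by (rule blinfun_eqI) simp
  show "B o\<^sub>L lmul_op (slice_emb J (z * w)) = (B o\<^sub>L lmul_op (slice_emb J w)) o\<^sub>L lmul_op (slice_emb J z)"
    for B :: "('v, 'n) cl_op" and z w
    using slice_emb_mult[OF assms, of w z]
    by (intro blinfun_eqI) (simp add: mult.commute lmul_mult)
qed

text \<open>X is the region outside the two sectors where the resolvent estimate holds. Symmetry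
  under conjugation and distance from the real axis let A be recovered from S; the point i provides
  (1 + T^2)^(-1).\<close>

locale slice_resolvent_bound = slice_resolvent T J
  for T :: "('v::banach, 'n::{finite,linorder}) cl_module \<rightharpoonup> ('v, 'n) cl_module" and J +
  fixes X :: "complex set" and C :: real
  assumes X_resolvent: "z \<in> X \<Longrightarrow> z \<in> \<rho>"
    and X_cnj: "z \<in> X \<Longrightarrow> cnj z \<in> X"
    and X_i: "\<i> \<in> X"
    and X_Im: "z \<in> X \<Longrightarrow> Im z \<noteq> 0"
    and bounded_linear_S: "z \<in> X \<Longrightarrow> bounded_linear (S z)"
    and onorm_S: "z \<in> X \<Longrightarrow> onorm (S z) \<le> C / norm z"
begin

sublocale op: complex_action "\<lambda>z B :: ('v, 'n) cl_op. B o\<^sub>L lmul_op (e z)"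
  by (rule complex_action_operators[OF unit])

sublocale cl: complex_action "\<lambda>z a. e z * a"
  by (rule complex_action_clifford[OF unit])

definition Sb :: "complex \<Rightarrow> ('v, 'n) cl_op" where "Sb z = Blinfun (S z)"
definition Ab :: "complex \<Rightarrow> ('v, 'n) cl_op" where "Ab z = Blinfun (A z)"
text \<open>R is (1 + T^2)^(-1) and P is T (1 + T^2)^(-1), the values at T of \<open>E0\<close> and
  \<open>E1\<close>.\<close>

definition R :: "('v, 'n) cl_op" where "R = Ab \<i>"
definition P :: "('v, 'n) cl_op" where "P = Blinfun (TA \<i>)"

lemma X_0: "0 \<notin> X"
  using X_Im by force

lemma Sb_apply [simp]: "z \<in> X \<Longrightarrow> Sb z v = S z v"
  by (simp add: Sb_def bounded_linear_Blinfun_apply bounded_linear_S)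

lemma Ab_apply [simp]: "z \<in> X \<Longrightarrow> Ab z v = A z v"
  by (simp add: Ab_def bounded_linear_Blinfun_apply bounded_linear_A X_resolvent)

lemma R_apply [simp]: "R v = A \<i> v"
  by (simp add: R_def X_i)

text \<open>Boundedness of T (1 + T^2)^(-1) is read off from the definition of the S-resolvent at i,
  whose other two terms are bounded.\<close>

lemma P_apply [simp]: "P v = TA \<i> v"
proof -
  have "TA \<i> = (\<lambda>v. A \<i> (lmul (e (cnj \<i>)) v) - S \<i> v)" by (simp add: S_eq fun_eq_iff)
  moreover have "bounded_linear (\<lambda>v. A \<i> (lmul (e (cnj \<i>)) v) - S \<i> v)"
    by (intro bounded_linear_sub bounded_linear_S X_i lmul.bounded_linear_right
        bounded_linear_compose[OF bounded_linear_A[OF X_resolvent[OF X_i]]])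
  ultimately show ?thesis by (simp add: P_def bounded_linear_Blinfun_apply)
qed

lemma norm_Sb: "z \<in> X \<Longrightarrow> norm (Sb z) \<le> C / norm z"
  using onorm_S[of z] by (simp add: Sb_def norm_blinfun.rep_eq bounded_linear_Blinfun_apply bounded_linear_S)

lemma C_nonneg: "0 \<le> C"
  using order_trans[OF norm_ge_zero norm_Sb[OF X_i]] by simp

text \<open>The difference quotient of \<open>Sb\<close> between s and t; on the diagonal it is the
  derivative.\<close>

definition Sq :: "complex \<Rightarrow> complex \<Rightarrow> ('v, 'n) cl_op" where
  "Sq t s = Ab t o\<^sub>L ((Sb s o\<^sub>L lmul_op (e (s - cnj t))) - id_blinfun)"

lemma Sb_diff:
  assumes "s \<in> X" "t \<in> X"
  shows "Sb s - Sb t = Sq t s o\<^sub>L lmul_op (e (s - t))"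
proof (rule blinfun_eqI)
  fix v :: "('v, 'n) cl_module"
  have "lmul (e ((s - t) * (s - cnj t))) v = lmul (e (s - cnj t)) (lmul (e (s - t)) v)"
    by (simp only: lmul_e mult.commute)
  then show "(Sb s - Sb t) v = (Sq t s o\<^sub>L lmul_op (e (s - t))) v"
    using S_diff[of s t v] assms bounded_linear_S[of s] X_resolvent
    by (simp add: Sq_def blinfun.add_left blinfun.diff_left del: slice_emb_simps)
qed

text \<open>The quotient \<open>Sq t s\<close> contains \<open>Sb s\<close> itself, so its
  continuity is not yet available. The bound C / |s| keeps it bounded near t, and the factor s - t
  tends to 0.\<close>

lemma continuous_on_Sb: "continuous_on X Sb"
  unfolding continuous_on_def
proof
  fix t assume t: "t \<in> X"
  obtain K where K: "0 < K" "\<And>z B. norm (B o\<^sub>L lmul_op (e z) :: ('v, 'n) cl_op) \<le> K * (norm z * norm B)"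
    using op.norm_act_le by metis
  define g where "g s = K * (norm (s - t) * (norm (Ab t) * (K * (norm (s - cnj t) * (C / norm s)) + norm (id_blinfun :: ('v, 'n) cl_op))))" for s
  have "((\<lambda>s. Sb s - Sb t) \<longlongrightarrow> 0) (at t within X)"
  proof (rule Lim_null_comparison[where g = g])
    have "norm t \<noteq> 0" using t X_0 by auto
    then have "(g \<longlongrightarrow> g t) (at t within X)" unfolding g_def by (intro tendsto_intros) auto
    then show "(g \<longlongrightarrow> 0) (at t within X)" by (simp add: g_def)
    have "norm (Sb s - Sb t) \<le> g s" if s: "s \<in> X" for s
    proof -
      have "norm ((Sb s o\<^sub>L lmul_op (e (s - cnj t))) - id_blinfun) \<le>
          K * (norm (s - cnj t) * (C / norm s)) + norm (id_blinfun :: ('v, 'n) cl_op)"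
      proof (rule order_trans[OF norm_triangle_ineq4], rule add_right_mono)
        show "norm (Sb s o\<^sub>L lmul_op (e (s - cnj t))) \<le> K * (norm (s - cnj t) * (C / norm s))"
          by (rule order_trans[OF K(2)]) (use K(1) norm_Sb[OF s] in \<open>intro mult_left_mono, auto\<close>)
      qed
      then have "norm (Sq t s) \<le> norm (Ab t) * (K * (norm (s - cnj t) * (C / norm s)) + norm (id_blinfun :: ('v, 'n) cl_op))"
        unfolding Sq_def by (rule order_trans[OF norm_blinfun_compose mult_left_mono]) simp
      then show ?thesis
        unfolding Sb_diff[OF s t] g_def using K(1)
        by (intro order_trans[OF K(2)] mult_left_mono) auto
    qed
    then show "\<forall>\<^sub>F s in at t within X. norm (Sb s - Sb t) \<le> g s"
      by (auto simp: eventually_at_filter)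
  qed
  then show "(Sb \<longlongrightarrow> Sb t) (at t within X)" by (rule LIM_zero_cancel)
qed

lemma continuous_on_lmul_op_e:
  "continuous_on Y f \<Longrightarrow> continuous_on Y (\<lambda>s. lmul_op (e (f s)) :: ('v, 'n) cl_op)"
  by (rule bounded_linear.continuous_on[OF bounded_linear_compose[OF bounded_linear_lmul_op bounded_linear_slice_emb]])

text \<open>\<open>S_cnj_diff\<close> is solved for A by dividing by cnj z - z, which is nonzero off
  the real axis.\<close>

lemma continuous_on_Ab: "continuous_on X Ab"
proof -
  have eq: "(Sb z - Sb (cnj z)) o\<^sub>L lmul_op (e (1 / (cnj z - z))) = Ab z" if z: "z \<in> X" for z
  proof (rule blinfun_eqI)
    fix v :: "('v, 'n) cl_module"
    have "cnj z - z \<noteq> 0" using X_Im[OF z] by (simp add: complex_eq_iff)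
    then have "lmul (e (cnj z - z)) (lmul (e (1 / (cnj z - z))) v) = v"
      by (simp only: lmul_e) simp
    then show "((Sb z - Sb (cnj z)) o\<^sub>L lmul_op (e (1 / (cnj z - z)))) v = Ab z v"
      using S_cnj_diff[OF X_resolvent[OF z]] z X_cnj[OF z]
      by (simp add: blinfun.add_left blinfun.diff_left del: slice_emb_simps)
  qed
  have "continuous_on X (\<lambda>z. (Sb z - Sb (cnj z)) o\<^sub>L lmul_op (e (1 / (cnj z - z))))"
  proof (intro bounded_bilinear.continuous_on[OF bounded_bilinear_blinfun_compose] continuous_on_diff
      continuous_on_Sb continuous_on_lmul_op_e)
    show "continuous_on X (\<lambda>z. Sb (cnj z))"
      by (rule continuous_on_compose2[OF continuous_on_Sb]) (use X_cnj in \<open>auto intro!: continuous_intros\<close>)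
    show "continuous_on X (\<lambda>z. 1 / (cnj z - z))"
      by (intro continuous_intros) (use X_Im in \<open>auto simp: complex_eq_iff\<close>)
  qed
  then show ?thesis by (simp cong: continuous_on_cong add: eq)
qed

lemma Sb_holo: "op.holo_on Sb (\<lambda>z. Sq z z) X"
  unfolding op.holo_on_def
proof (intro conjI ballI)
  note intros = bounded_bilinear.continuous_on[OF bounded_bilinear_blinfun_compose] continuous_on_diff
      continuous_on_Sb continuous_on_Ab continuous_on_lmul_op_e continuous_on_const continuous_on_id
      continuous_on_cnj
  show "continuous_on X (\<lambda>z. Sq z z)" unfolding Sq_def by (intro intros)
  fix t assume t: "t \<in> X"
  have "continuous_on X (Sq t)" unfolding Sq_def by (intro intros)
  then have "(Sq t \<longlongrightarrow> Sq t t) (at t within X)" using t by (simp add: continuous_on_def)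
  then show "(Sb has_derivative (\<lambda>h. Sq t t o\<^sub>L lmul_op (e h))) (at t within X)"
    by (intro op.holo_derivativeI[OF Sb_diff]) (use t in auto)
qed

section \<open>Products of the resolvent with R and P\<close>

lemma compose_R_Sb:
  assumes s: "s \<in> X"
  shows "R o\<^sub>L (Sb s o\<^sub>L lmul_op (e (1 + s\<^sup>2))) = Sb s + P + (R o\<^sub>L lmul_op (e s))"
proof (rule blinfun_eqI)
  fix v :: "('v, 'n) cl_module"
  have "(s - \<i>) * (s - cnj \<i>) = 1 + s\<^sup>2" by (simp add: algebra_simps power2_eq_square)
  then show "(R o\<^sub>L (Sb s o\<^sub>L lmul_op (e (1 + s\<^sup>2)))) v = (Sb s + P + (R o\<^sub>L lmul_op (e s))) v"
    using resolvent_identity[OF X_resolvent[OF s] X_resolvent[OF X_i] bounded_linear_S[OF s], of v]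
    by (simp add: s blinfun.add_left blinfun.diff_left del: slice_emb_simps)
qed

lemma T_A_i: "T (A \<i> v) = Some (TA \<i> v)" and T_TA_i: "T (TA \<i> v) = Some (v - A \<i> v)"
  using T_A[OF X_resolvent[OF X_i]] T_TA[OF X_resolvent[OF X_i]] by simp_all

text \<open>T is applied to the identity for R; the -v from \<open>T_S\<close> and the +v from
  \<open>T_TA_i\<close> cancel.\<close>

lemma compose_P_Sb:
  assumes s: "s \<in> X"
  shows "P o\<^sub>L (Sb s o\<^sub>L lmul_op (e (1 + s\<^sup>2))) = (Sb s o\<^sub>L lmul_op (e s)) + (P o\<^sub>L lmul_op (e s)) - R"
proof (rule blinfun_eqI)
  fix v :: "('v, 'n) cl_module"
  have "A \<i> (S s (lmul (e (1 + s\<^sup>2)) v)) = S s v + TA \<i> v + A \<i> (lmul (e s) v)"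
    using arg_cong[OF compose_R_Sb[OF s], of "\<lambda>B. blinfun_apply B v"]
    by (simp add: s blinfun.add_left blinfun.diff_left del: slice_emb_simps)
  then have "T (A \<i> (S s (lmul (e (1 + s\<^sup>2)) v))) =
      Some ((S s (lmul (e s) v) - v) + (v - A \<i> v) + TA \<i> (lmul (e s) v))"
    by (simp only:) (intro linear_pmap_add[OF lin] T_S[OF X_resolvent[OF s]] T_TA_i T_A_i)
  then show "(P o\<^sub>L (Sb s o\<^sub>L lmul_op (e (1 + s\<^sup>2)))) v =
      ((Sb s o\<^sub>L lmul_op (e s)) + (P o\<^sub>L lmul_op (e s)) - R) v"
    by (simp add: T_A_i s blinfun.add_left blinfun.diff_left del: slice_emb_simps)
qed

text \<open>Shows that P S(s) s differs from P by terms of size 1/|s|, the behaviour at infinity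
  required by \<open>truncated_sector_limit\<close>.\<close>

lemma P_Sb_large:
  assumes s: "s \<in> X"
  shows "P o\<^sub>L (Sb s o\<^sub>L lmul_op (e s)) = Sb s - (R o\<^sub>L Sb s) + P"
proof (rule blinfun_eqI)
  fix v :: "('v, 'n) cl_module"
  interpret TA: linear "TA \<i>" by (rule linear_TA[OF X_resolvent[OF X_i]])
  note i = X_resolvent[OF X_i]
  have TS: "T (S s v) = Some (S s (lmul (e s) v) - v)" by (rule T_S[OF X_resolvent[OF s]])
  have "T (A \<i> (S s (lmul (e s) v) - v)) = Some (S s v - A \<i> (S s v))"
    unfolding A_commute[OF i TS] by (rule T_TA_i)
  then have "TA \<i> (S s (lmul (e s) v)) - TA \<i> v = S s v - A \<i> (S s v)"
    by (simp add: T_A_i TA.diff)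
  then show "(P o\<^sub>L (Sb s o\<^sub>L lmul_op (e s))) v = (Sb s - (R o\<^sub>L Sb s) + P) v"
    by (simp add: s blinfun.bilinear_simps algebra_simps)
qed

text \<open>The counterpart at 0: as S(s) s is bounded, so is P S(s), whereas S(s) alone is only
  bounded by C / |s|.\<close>

lemma P_Sb_small:
  assumes s: "s \<in> X"
  shows "P o\<^sub>L Sb s = R o\<^sub>L ((Sb s o\<^sub>L lmul_op (e s)) - id_blinfun)"
proof (rule blinfun_eqI)
  fix v :: "('v, 'n) cl_module"
  show "(P o\<^sub>L Sb s) v = (R o\<^sub>L ((Sb s o\<^sub>L lmul_op (e s)) - id_blinfun)) v"
    using A_commute[OF X_resolvent[OF X_i] T_S[OF X_resolvent[OF s], of v]]
    by (simp add: s blinfun.add_left blinfun.diff_left)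
qed

end

section \<open>The calculus along truncated rays\<close>

lemma set_integrable_inverse_1_plus_square: "set_integrable lborel {0<..} (\<lambda>t. 1 / (1 + t\<^sup>2) :: real)"
proof -
  have "(\<integral>\<^sup>+ t. ennreal (1 / (1 + t\<^sup>2)) * indicator {0..} t \<partial>lborel) = ennreal (pi / 2 - arctan 0)"
  proof (rule nn_integral_FTC_atLeast)
    show "DERIV arctan t :> 1 / (1 + t\<^sup>2)" for t
      using DERIV_arctan[of t] by (simp add: inverse_eq_divide)
  qed (auto intro: tendsto_arctan_at_top)
  moreover have "ennreal (1 / (1 + t\<^sup>2)) * indicator {0..} t = ennreal (indicator {0..} t *\<^sub>R (1 / (1 + t\<^sup>2)))" for t :: real
    by (auto simp: indicator_def)
  ultimately have *: "(\<integral>\<^sup>+ t. ennreal (indicator {0..} t *\<^sub>R (1 / (1 + t\<^sup>2))) \<partial>lborel) < \<infinity>"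
    by (simp only:) simp
  have "set_integrable lborel {0..} (\<lambda>t. 1 / (1 + t\<^sup>2) :: real)"
    unfolding set_integrable_def
    by (rule integrableI_nonneg[OF _ _ *]) auto
  then show ?thesis by (rule set_integrable_subset) auto
qed

definition trunc :: "nat \<Rightarrow> real set" where
  "trunc n = {1 / real (Suc n)..real (Suc n)}"

definition E0 :: "complex \<Rightarrow> complex" where "E0 z = 1 / (1 + z\<^sup>2)"
definition E1 :: "complex \<Rightarrow> complex" where "E1 z = z / (1 + z\<^sup>2)"

text \<open>X is the complement of the open double sector of angle \<phi>, without 0. It meets the
  closed sectors \<open>DS\<close> exactly in the four rays of integration.\<close>

locale sector_calculus = slice_resolvent_bound T J X C
  for T :: "('v::banach, 'n::{finite,linorder}) cl_module \<rightharpoonup> ('v, 'n) cl_module" and J X C +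
  fixes \<phi> :: real
  assumes \<phi>: "0 < \<phi>" "\<phi> < pi / 2"
    and X_eq: "X = {z. z \<noteq> 0 \<and> \<bar>Re z\<bar> \<le> cos \<phi> * norm z}"
begin

text \<open>The signs are the orientations of the two paths: the rays of angle -\<phi> and pi -
  \<phi> are run outwards, the other two inwards.\<close>

definition quad :: "(real \<Rightarrow> 'b::real_normed_vector) \<Rightarrow> 'b" where
  "quad h = h (- \<phi>) - h \<phi> + h (pi - \<phi>) - h (pi + \<phi>)"

definition rays :: "real set" where "rays = {- \<phi>, \<phi>, pi - \<phi>, pi + \<phi>}"

definition DS :: "complex set" where "DS = sector (- \<phi>) \<phi> \<union> sector (pi - \<phi>) (pi + \<phi>)"

text \<open>What a function of \<open>SH_L0 \<theta>\<close> leaves on one slice over the closed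
  sectors of the smaller angle \<phi>. The class is closed under multiplication by \<open>E0\<close>
  and \<open>E1\<close>.\<close>

definition admissible :: "(complex \<Rightarrow> 'n clifford) \<Rightarrow> bool" where
  "admissible F \<longleftrightarrow> (\<exists>D. cl.holo_on F D DS) \<and> (\<exists>M. \<forall>z\<in>DS. norm (F z) \<le> M) \<and>
     (\<forall>\<psi>\<in>rays. set_integrable lborel {0<..} (\<lambda>t. norm (F (polar t \<psi>)) / t))"

text \<open>The truncated contour integral of F without the resolvent. Such terms split off in the
  product rule.\<close>

definition Z :: "nat \<Rightarrow> (complex \<Rightarrow> 'n clifford) \<Rightarrow> 'n clifford" where
  "Z n F = (1 / (2 * pi)) *\<^sub>R quad (\<lambda>\<psi>. integral (trunc n) (\<lambda>t. e (cis \<psi> / \<i>) * F (polar t \<psi>)))"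

definition K :: "nat \<Rightarrow> (complex \<Rightarrow> 'n clifford) \<Rightarrow> ('v, 'n) cl_op" where
  "K n F = (1 / (2 * pi)) *\<^sub>R quad (\<lambda>\<psi>. integral (trunc n)
     (\<lambda>t. Sb (polar t \<psi>) o\<^sub>L lmul_op (e (cis \<psi> / \<i>) * F (polar t \<psi>))))"

text \<open>Limits of truncated integrals: algebraic identities are integrated over compact
  intervals for each n, and the error terms disappear in the limit.\<close>

definition has_calc :: "(complex \<Rightarrow> 'n clifford) \<Rightarrow> (('v, 'n) cl_op) \<Rightarrow> bool" where
  "has_calc F B \<longleftrightarrow> admissible F \<and> (\<lambda>n. K n F) \<longlonglongrightarrow> B"

section \<open>Geometry of the sectors and size of the rational functions\<close>

lemma cos_pos: "0 < cos \<phi>"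
  using \<phi> by (intro cos_gt_zero_pi) auto

lemma cos_le_abs_cos:
  assumes "\<psi> \<in> {- \<phi>..\<phi>} \<union> {pi - \<phi>..pi + \<phi>}"
  shows "cos \<phi> \<le> \<bar>cos \<psi>\<bar>"
proof -
  have *: "cos \<phi> \<le> cos x" if "\<bar>x\<bar> \<le> \<phi>" for x
    using cos_monotone_0_pi_le[of "\<bar>x\<bar>" \<phi>] that \<phi> by (simp add: cos_abs_real)
  show ?thesis
  proof (cases "\<psi> \<in> {- \<phi>..\<phi>}")
    case True
    then show ?thesis using *[of \<psi>] abs_ge_self[of "cos \<psi>"] by (auto simp: abs_le_iff)
  next
    case False
    then have "\<bar>\<psi> - pi\<bar> \<le> \<phi>" using assms by auto
    from *[OF this] show ?thesis by (simp add: cos_diff)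
  qed
qed

lemma abs_cos_le_cos:
  assumes "\<psi> \<in> {\<phi>..pi - \<phi>} \<union> {pi + \<phi>..2 * pi - \<phi>}"
  shows "\<bar>cos \<psi>\<bar> \<le> cos \<phi>"
proof -
  have *: "\<bar>cos x\<bar> \<le> cos \<phi>" if "\<phi> \<le> x" "x \<le> pi - \<phi>" for x
    using cos_monotone_0_pi_le[of \<phi> x] cos_monotone_0_pi_le[of x "pi - \<phi>"] that \<phi>
    by (simp add: cos_diff abs_le_iff)
  show ?thesis
  proof (cases "\<psi> \<in> {\<phi>..pi - \<phi>}")
    case False
    then have "\<phi> \<le> \<psi> - pi" "\<psi> - pi \<le> pi - \<phi>" using assms by auto
    from *[OF this] show ?thesis by (simp add: cos_diff)
  qed (use * in auto)
qed

lemma norm_ray: "0 < t \<Longrightarrow> norm (polar t \<psi>) = t"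
  by (simp add: norm_mult)

lemma DS_E:
  assumes "z \<in> DS"
  obtains t \<psi> where "z = polar t \<psi>" "0 < t" "cos \<phi> \<le> \<bar>cos \<psi>\<bar>"
  using assms cos_le_abs_cos unfolding DS_def sector_def by blast

lemma DS_nz: "z \<in> DS \<Longrightarrow> z \<noteq> 0"
  by (auto elim!: DS_E)

text \<open>In polar form |1 + z^2|^2 = (1 - t^2)^2 + 4 t^2 (cos \<psi>)^2. Bounding 1 and (cos
  \<psi>)^2 below by (cos \<phi>)^2 completes the square. This keeps the poles i and -i away from
  \<open>DS\<close>.\<close>

lemma norm_one_plus_square:
  assumes "z \<in> DS"
  shows "cos \<phi> * (1 + (norm z)\<^sup>2) \<le> norm (1 + z\<^sup>2)"
proof -
  obtain t \<psi> where z: "z = polar t \<psi>" "0 < t" "cos \<phi> \<le> \<bar>cos \<psi>\<bar>" using DS_E[OF assms] .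
  have c: "(cos \<phi>)\<^sup>2 \<le> (cos \<psi>)\<^sup>2" using power_mono[OF z(3), of 2] cos_pos by simp
  have c1: "(cos \<phi>)\<^sup>2 \<le> 1" by (simp add: abs_square_le_1)
  have cis2: "(cis \<psi>)\<^sup>2 = cis (2 * \<psi>)" by (simp add: power2_eq_square cis_mult)
  have z2: "1 + z\<^sup>2 = Complex (1 + t\<^sup>2 * cos (2 * \<psi>)) (t\<^sup>2 * sin (2 * \<psi>))"
    by (simp add: z(1) power_mult_distrib cis2 complex_eq_iff flip: of_real_power)
  have "(norm (1 + z\<^sup>2))\<^sup>2 = (1 + t\<^sup>2 * cos (2 * \<psi>))\<^sup>2 + (t\<^sup>2 * sin (2 * \<psi>))\<^sup>2"
    by (simp add: z2 cmod_power2)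
  also have "\<dots> = 1 + 2 * t\<^sup>2 * cos (2 * \<psi>) + (t\<^sup>2)\<^sup>2 * ((sin (2 * \<psi>))\<^sup>2 + (cos (2 * \<psi>))\<^sup>2)"
    by algebra
  also have "\<dots> = (1 - t\<^sup>2)\<^sup>2 + 4 * t\<^sup>2 * (cos \<psi>)\<^sup>2"
    unfolding sin_cos_squared_add unfolding cos_double_cos by algebra
  also have "\<dots> \<ge> (cos \<phi>)\<^sup>2 * (1 - t\<^sup>2)\<^sup>2 + 4 * t\<^sup>2 * (cos \<phi>)\<^sup>2"
    using c c1 by (intro add_mono mult_left_mono) (auto simp: mult_left_le_one_le)
  also have "(cos \<phi>)\<^sup>2 * (1 - t\<^sup>2)\<^sup>2 + 4 * t\<^sup>2 * (cos \<phi>)\<^sup>2 = (cos \<phi> * (1 + t\<^sup>2))\<^sup>2" by algebra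
  finally have "cos \<phi> * (1 + t\<^sup>2) \<le> norm (1 + z\<^sup>2)" by (rule power2_le_imp_le) simp
  then show ?thesis using z by (simp add: norm_ray)
qed

lemma one_plus_square_nz: "z \<in> DS \<Longrightarrow> 1 + z\<^sup>2 \<noteq> 0"
  using norm_one_plus_square[of z] cos_pos by (metis add_pos_nonneg mult_pos_pos norm_zero not_le zero_le_power2 zero_less_one)

lemma norm_E0:
  assumes "z \<in> DS"
  shows "norm (E0 z) \<le> 1 / (cos \<phi> * (1 + (norm z)\<^sup>2))"
  unfolding E0_def norm_divide using norm_one_plus_square[OF assms] cos_pos
  by (auto intro!: divide_left_mono mult_pos_pos simp: one_plus_square_nz[OF assms] add_pos_nonneg)

lemma norm_E1: "z \<in> DS \<Longrightarrow> norm (E1 z) \<le> norm z / (cos \<phi> * (1 + (norm z)\<^sup>2))"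
  using mult_left_mono[OF norm_E0, of z "norm z"] by (simp add: E0_def E1_def norm_divide)

lemma norm_E_bounds:
  assumes "z \<in> DS"
  shows "norm (E0 z) \<le> 1 / cos \<phi>" "norm (E1 z) \<le> 1 / cos \<phi>"
    "norm (E0 z) \<le> 1 / cos \<phi> / norm z" "norm (E1 z) \<le> 1 / cos \<phi> / norm z"
proof -
  define r where "r = norm z"
  have r: "0 < r" using DS_nz[OF assms] by (simp add: r_def)
  have "0 \<le> (r - 1)\<^sup>2" "0 \<le> r * r" by auto
  then have "r \<le> 1 + r\<^sup>2" using r by (simp add: power2_eq_square algebra_simps)
  then have *: "1 / (1 + r\<^sup>2) \<le> 1" "r / (1 + r\<^sup>2) \<le> 1" "1 / (1 + r\<^sup>2) \<le> 1 / r" "r / (1 + r\<^sup>2) \<le> 1 / r"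
    using r by (auto simp: field_simps power2_eq_square add_pos_nonneg)
  show "norm (E0 z) \<le> 1 / cos \<phi>" "norm (E1 z) \<le> 1 / cos \<phi>"
    "norm (E0 z) \<le> 1 / cos \<phi> / norm z" "norm (E1 z) \<le> 1 / cos \<phi> / norm z"
    using order_trans[OF norm_E0[OF assms, folded r_def], of "1 / cos \<phi>"]
      order_trans[OF norm_E1[OF assms, folded r_def], of "1 / cos \<phi>"]
      order_trans[OF norm_E0[OF assms, folded r_def], of "1 / cos \<phi> / r"]
      order_trans[OF norm_E1[OF assms, folded r_def], of "1 / cos \<phi> / r"]
      mult_left_mono[OF *(1), of "1 / cos \<phi>"] mult_left_mono[OF *(2), of "1 / cos \<phi>"]
      mult_left_mono[OF *(3), of "1 / cos \<phi>"] mult_left_mono[OF *(4), of "1 / cos \<phi>"] cos_pos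
    by (simp_all add: r_def[symmetric])
qed

lemma E_derivative:
  assumes "z \<in> DS"
  shows "(E0 has_field_derivative - 2 * z / (1 + z\<^sup>2)\<^sup>2) (at z within Y)"
    "(E1 has_field_derivative (1 - z\<^sup>2) / (1 + z\<^sup>2)\<^sup>2) (at z within Y)"
  using one_plus_square_nz[OF assms] unfolding E0_def E1_def
  by (auto intro!: derivative_eq_intros simp: field_simps power2_eq_square)

lemma E_derivative_continuous:
  "continuous_on DS (\<lambda>z. - 2 * z / (1 + z\<^sup>2)\<^sup>2)" "continuous_on DS (\<lambda>z. (1 - z\<^sup>2) / (1 + z\<^sup>2)\<^sup>2)"
  by (auto intro!: continuous_intros simp: one_plus_square_nz)

lemma ray_DS: "\<psi> \<in> rays \<Longrightarrow> 0 < t \<Longrightarrow> polar t \<psi> \<in> DS"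
proof -
  assume \<psi>: "\<psi> \<in> rays" and t: "0 < t"
  have "(- \<phi> \<le> \<psi> \<and> \<psi> \<le> \<phi>) \<or> (pi - \<phi> \<le> \<psi> \<and> \<psi> \<le> pi + \<phi>)"
    using \<psi> \<phi> by (auto simp: rays_def)
  then show ?thesis unfolding DS_def using t by (blast intro: sectorI)
qed

lemma X_polar: "0 < t \<Longrightarrow> \<bar>cos \<psi>\<bar> \<le> cos \<phi> \<Longrightarrow> polar t \<psi> \<in> X"
  unfolding X_eq by (simp add: norm_mult abs_mult mult.commute)

lemma ray_X: "\<psi> \<in> rays \<Longrightarrow> 0 < t \<Longrightarrow> polar t \<psi> \<in> X"
  using cos_pos by (intro X_polar) (auto simp: rays_def cos_diff cos_add)

lemma trunc_pos: "t \<in> trunc n \<Longrightarrow> 0 < t"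
  unfolding trunc_def by (auto intro: less_le_trans[of 0 "1 / real (Suc n)"])

lemma continuous_on_ray_DS:
  assumes "continuous_on DS F" "\<psi> \<in> rays"
  shows "continuous_on {0<..} (\<lambda>t. F (polar t \<psi>))"
  by (rule continuous_on_compose2[OF assms(1)]) (auto intro!: continuous_intros ray_DS assms(2))

lemma continuous_on_Sb_ray:
  assumes "\<psi> \<in> rays"
  shows "continuous_on {0<..} (\<lambda>t. Sb (polar t \<psi>))"
  by (rule continuous_on_compose2[OF continuous_on_Sb]) (auto intro!: continuous_intros ray_X assms)

lemma integrable_trunc:
  fixes g :: "real \<Rightarrow> 'b::banach"
  assumes "continuous_on {0<..} g"
  shows "g integrable_on trunc n"
  unfolding trunc_def
  by (rule integrable_continuous_interval, rule continuous_on_subset[OF assms])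
     (use trunc_pos in \<open>auto simp: trunc_def\<close>)

section \<open>Closure properties of admissible functions\<close>

lemma admissible_continuous: "admissible F \<Longrightarrow> continuous_on DS F"
  unfolding admissible_def using cl.holo_on_continuous by blast

lemma set_borel_measurable_ray:
  assumes "continuous_on DS F" "\<psi> \<in> rays"
  shows "set_borel_measurable lborel {0<..} (\<lambda>t. norm (F (polar t \<psi>)) / t)"
proof -
  have "(\<lambda>t. indicator {0<..} t *\<^sub>R (norm (F (polar t \<psi>)) / t)) \<in> borel_measurable borel"
    by (rule borel_measurable_continuous_on_indicator)
       (use continuous_on_ray_DS[OF assms] in \<open>auto intro!: continuous_intros\<close>)
  then show ?thesis unfolding set_borel_measurable_def by simp
qed

lemma admissible_comp:
  assumes "cl.holo_on H D DS" and M: "\<And>z. z \<in> DS \<Longrightarrow> norm (H z) \<le> M * norm (F z)" "0 \<le> M"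
    and F: "admissible F"
  shows "admissible H"
  unfolding admissible_def
proof (intro conjI ballI)
  obtain M' where M': "\<And>z. z \<in> DS \<Longrightarrow> norm (F z) \<le> M'" using F unfolding admissible_def by blast
  show "\<exists>M. \<forall>z\<in>DS. norm (H z) \<le> M"
    using order_trans[OF M(1) mult_left_mono[OF M' M(2)]] by blast
  fix \<psi> assume \<psi>: "\<psi> \<in> rays"
  have "set_integrable lborel {0<..} (\<lambda>t. M * (norm (F (polar t \<psi>)) / t))"
    using F \<psi> by (intro set_integrable_mult_right) (simp add: admissible_def)
  then show "set_integrable lborel {0<..} (\<lambda>t. norm (H (polar t \<psi>)) / t)"
  proof (rule set_integrable_bound[OF _ set_borel_measurable_ray[OF cl.holo_on_continuous[OF assms(1)] \<psi>]])
    show "AE t in lborel. t \<in> {0<..} \<longrightarrow> norm (norm (H (polar t \<psi>)) / t) \<le>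
        norm (M * (norm (F (polar t \<psi>)) / t))"
      using M ray_DS[OF \<psi>] by (auto intro!: AE_I2 divide_right_mono simp: abs_mult)
  qed
qed (use assms(1) in blast)

lemma admissible_act:
  assumes F: "admissible F" and E': "continuous_on DS E'"
    and E: "\<And>z. z \<in> DS \<Longrightarrow> (E has_field_derivative E' z) (at z within DS)"
    and M: "\<And>z. z \<in> DS \<Longrightarrow> norm (E z) \<le> M" "0 \<le> M"
  shows "admissible (\<lambda>z. e (E z) * F z)"
proof -
  obtain D where D: "cl.holo_on F D DS" using F unfolding admissible_def by blast
  obtain c where c: "0 < c" "\<And>z x. norm (e z * x) \<le> c * (norm z * norm x)"
    using cl.norm_act_le by metis
  show ?thesis
  proof (rule admissible_comp[OF cl.holo_on_act[OF D E' E] _ _ F])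
    show "norm (e (E z) * F z) \<le> c * M * norm (F z)" if "z \<in> DS" for z
    proof -
      have "norm (e (E z) * F z) \<le> c * (norm (E z) * norm (F z))" by (rule c)
      also have "\<dots> \<le> c * (M * norm (F z))" using c(1) M(1)[OF that] by (intro mult_left_mono mult_right_mono) auto
      finally show ?thesis by (simp add: mult.assoc)
    qed
  qed (use c M in auto)
qed

lemma admissible_E:
  assumes "admissible F"
  shows "admissible (\<lambda>z. e (E0 z) * F z)" "admissible (\<lambda>z. e (E1 z) * F z)"
  using cos_pos
  by (auto intro!: admissible_act[OF assms E_derivative_continuous(1) E_derivative(1) norm_E_bounds(1)]
      admissible_act[OF assms E_derivative_continuous(2) E_derivative(2) norm_E_bounds(2)])

lemma admissible_add:
  assumes "admissible F" "admissible G"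
  shows "admissible (\<lambda>z. F z + G z)"
  unfolding admissible_def
proof (intro conjI ballI)
  obtain D D' where D: "cl.holo_on F D DS" "cl.holo_on G D' DS" using assms unfolding admissible_def by blast
  note holo = cl.holo_on_add[OF D]
  then show "\<exists>D. cl.holo_on (\<lambda>z. F z + G z) D DS" by blast
  obtain M M' where "\<And>z. z \<in> DS \<Longrightarrow> norm (F z) \<le> M" "\<And>z. z \<in> DS \<Longrightarrow> norm (G z) \<le> M'"
    using assms unfolding admissible_def by blast
  then show "\<exists>M. \<forall>z\<in>DS. norm (F z + G z) \<le> M"
    using norm_triangle_mono by metis
  fix \<psi> assume \<psi>: "\<psi> \<in> rays"
  have "set_integrable lborel {0<..} (\<lambda>t. norm (F (polar t \<psi>)) / t + norm (G (polar t \<psi>)) / t)"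
    using assms \<psi> by (intro set_integral_add) (auto simp: admissible_def)
  then show "set_integrable lborel {0<..} (\<lambda>t. norm (F (polar t \<psi>) + G (polar t \<psi>)) / t)"
  proof (rule set_integrable_bound[OF _ set_borel_measurable_ray[OF cl.holo_on_continuous[OF holo] \<psi>]])
    show "AE t in lborel. t \<in> {0<..} \<longrightarrow> norm (norm (F (polar t \<psi>) + G (polar t \<psi>)) / t) \<le>
        norm (norm (F (polar t \<psi>)) / t + norm (G (polar t \<psi>)) / t)"
      by (auto intro!: AE_I2 divide_right_mono norm_triangle_ineq simp flip: add_divide_distrib)
  qed
qed

lemma admissible_mult_right:
  assumes F: "admissible F"
  shows "admissible (\<lambda>z. F z * c)"
proof -
  interpret m: bounded_linear "\<lambda>a. a * c"
    by (rule bounded_bilinear.bounded_linear_left[OF bounded_bilinear_clifford_mult])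
  obtain D where D: "cl.holo_on F D DS" using F unfolding admissible_def by blast
  obtain M where M: "0 < M" "\<And>a. norm (a * c) \<le> norm a * M" using m.pos_bounded by blast
  have "cl.holo_on (\<lambda>z. F z * c) (\<lambda>z. D z * c) DS"
    using D m.has_derivative m.continuous_on by (fastforce simp: cl.holo_on_def mult.assoc)
  then show ?thesis
    by (rule admissible_comp[where M = M and F = F]) (use M F in \<open>auto simp: mult.commute\<close>)
qed


section \<open>Linearity of the truncated calculus\<close>

lemma quad_add: "quad (\<lambda>\<psi>. f \<psi> + g \<psi>) = quad f + quad g"
  by (simp add: quad_def)

lemma quad_diff: "quad (\<lambda>\<psi>. f \<psi> - g \<psi>) = quad f - quad g"
  by (simp add: quad_def)

lemma quad_linear: "bounded_linear h \<Longrightarrow> quad (\<lambda>\<psi>. h (f \<psi>)) = h (quad f)"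
  by (simp add: quad_def linear_simps)

lemma quad_cong: "(\<And>\<psi>. \<psi> \<in> rays \<Longrightarrow> f \<psi> = g \<psi>) \<Longrightarrow> quad f = quad g"
  by (simp add: quad_def rays_def)

lemma integral_trunc_linear:
  fixes g :: "real \<Rightarrow> 'a::banach" and h :: "'a \<Rightarrow> 'b::banach"
  assumes "bounded_linear h" "continuous_on {0<..} g"
  shows "integral (trunc n) (\<lambda>t. h (g t)) = h (integral (trunc n) g)"
  using integral_linear[OF integrable_trunc[OF assms(2)] assms(1)] by (simp add: o_def)

lemma bounded_linear_mult_left_cl: "bounded_linear (\<lambda>x. a * x :: 'n clifford)"
  by (rule bounded_bilinear.bounded_linear_right[OF bounded_bilinear_clifford_mult])

lemma bounded_linear_compose_lmul_op: "bounded_linear (\<lambda>x. B o\<^sub>L lmul_op x)"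
  by (rule bounded_linear_compose[OF
      bounded_bilinear.bounded_linear_right[OF bounded_bilinear_blinfun_compose] bounded_linear_lmul_op])

lemma bounded_linear_compose_left: "bounded_linear (\<lambda>A. B o\<^sub>L A)"
  by (rule bounded_bilinear.bounded_linear_right[OF bounded_bilinear_blinfun_compose])

lemma bounded_linear_compose_right: "bounded_linear (\<lambda>A. A o\<^sub>L B)"
  by (rule bounded_bilinear.bounded_linear_left[OF bounded_bilinear_blinfun_compose])

lemma compose_assoc: "(B1 o\<^sub>L B2) o\<^sub>L B3 = B1 o\<^sub>L (B2 o\<^sub>L B3)"
  by (rule blinfun_eqI) simp

lemma continuous_on_integrand:
  assumes F: "continuous_on DS F" and \<psi>: "\<psi> \<in> rays"
  shows "continuous_on {0<..} (\<lambda>t. c * F (polar t \<psi>))"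
    "continuous_on {0<..} (\<lambda>t. Sb (polar t \<psi>) o\<^sub>L lmul_op (c * F (polar t \<psi>)))"
proof -
  show *: "continuous_on {0<..} (\<lambda>t. c * F (polar t \<psi>))"
    by (rule bounded_linear.continuous_on[OF bounded_linear_mult_left_cl continuous_on_ray_DS[OF F \<psi>]])
  show "continuous_on {0<..} (\<lambda>t. Sb (polar t \<psi>) o\<^sub>L lmul_op (c * F (polar t \<psi>)))"
    by (intro bounded_bilinear.continuous_on[OF bounded_bilinear_blinfun_compose] continuous_on_Sb_ray \<psi>
        bounded_linear.continuous_on[OF bounded_linear_lmul_op *])
qed

lemma K_add:
  assumes "continuous_on DS F" "continuous_on DS G"
  shows "K n (\<lambda>z. F z + G z) = K n F + K n G"
proof -
  have "integral (trunc n) (\<lambda>t. Sb (polar t \<psi>) o\<^sub>L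
        lmul_op (e (cis \<psi> / \<i>) * (F (polar t \<psi>) + G (polar t \<psi>)))) =
      integral (trunc n) (\<lambda>t. Sb (polar t \<psi>) o\<^sub>L lmul_op (e (cis \<psi> / \<i>) * F (polar t \<psi>))) +
      integral (trunc n) (\<lambda>t. Sb (polar t \<psi>) o\<^sub>L lmul_op (e (cis \<psi> / \<i>) * G (polar t \<psi>)))"
    if \<psi>: "\<psi> \<in> rays" for \<psi>
    unfolding distrib_left linear_simps(1)[OF bounded_linear_compose_lmul_op]
    by (intro integral_add integrable_trunc continuous_on_integrand assms \<psi>)
  then show ?thesis by (simp add: K_def quad_add scaleR_add_right cong: quad_cong)
qed

lemma K_mult_right:
  assumes F: "continuous_on DS F"
  shows "K n (\<lambda>z. F z * c) = K n F o\<^sub>L lmul_op c"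
proof -
  have "integral (trunc n) (\<lambda>t. Sb (polar t \<psi>) o\<^sub>L lmul_op (e (cis \<psi> / \<i>) * (F (polar t \<psi>) * c))) =
      integral (trunc n) (\<lambda>t. Sb (polar t \<psi>) o\<^sub>L lmul_op (e (cis \<psi> / \<i>) * F (polar t \<psi>))) o\<^sub>L lmul_op c"
    if \<psi>: "\<psi> \<in> rays" for \<psi>
    by (subst integral_trunc_linear[OF bounded_linear_compose_right continuous_on_integrand(2)[OF F \<psi>], symmetric])
       (simp only: mult.assoc[symmetric] lmul_op_mult[of _ c] compose_assoc)
  then show ?thesis
    by (simp add: K_def quad_linear[OF bounded_linear_compose_right] linear_simps[OF bounded_linear_compose_right]
        cong: quad_cong)
qed

lemma K_cong:
  assumes "\<And>z. z \<in> DS \<Longrightarrow> F z = G z"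
  shows "K n F = K n G"
  unfolding K_def
  by (intro arg_cong2[where f = scaleR] refl quad_cong integral_cong)
     (simp add: assms ray_DS[OF _ trunc_pos])

lemma has_calc_add:
  "has_calc F B \<Longrightarrow> has_calc G C' \<Longrightarrow> has_calc (\<lambda>z. F z + G z) (B + C')"
  unfolding has_calc_def
  by (simp add: K_add[OF admissible_continuous admissible_continuous] admissible_add tendsto_add)

lemma has_calc_mult_right: "has_calc F B \<Longrightarrow> has_calc (\<lambda>z. F z * c) (B o\<^sub>L lmul_op c)"
  unfolding has_calc_def
  by (simp add: K_mult_right[OF admissible_continuous] admissible_mult_right
      bounded_linear.tendsto[OF bounded_linear_compose_right])

lemma has_calc_scaleR:
  assumes "has_calc F B"
  shows "has_calc (\<lambda>z. r *\<^sub>R F z) (r *\<^sub>R B)"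
proof -
  have "F z * of_real r = r *\<^sub>R F z" for z by (simp add: of_real_def)
  moreover have "B o\<^sub>L lmul_op (of_real r) = r *\<^sub>R B"
    by (rule blinfun_eqI) (simp add: lmul_of_real blinfun.bilinear_simps)
  ultimately show ?thesis using has_calc_mult_right[OF assms, of "of_real r"] by (simp only:)
qed

lemma has_calc_cong:
  assumes F: "has_calc F B" and eq: "\<And>z. z \<in> DS \<Longrightarrow> G z = F z"
  shows "has_calc G B"
proof -
  obtain D where "cl.holo_on F D DS" using F by (auto simp: has_calc_def admissible_def)
  then have D: "cl.holo_on G D DS"
    unfolding cl.holo_on_def by (blast intro: has_derivative_transform eq)
  have "admissible G"
    by (rule admissible_comp[where M = 1 and F = F, OF D]) (use eq F in \<open>simp_all add: has_calc_def\<close>)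
  then show ?thesis using F K_cong[of G F, OF eq] by (simp add: has_calc_def)
qed

lemma has_calc_unique: "has_calc F B \<Longrightarrow> has_calc F B' \<Longrightarrow> B = B'"
  unfolding has_calc_def using LIMSEQ_unique by blast

text \<open>The four rays bound two sectors inside \<open>DS\<close>, around the directions 0 and
  pi; \<open>truncated_sector_vanishing\<close> applies to each of them.\<close>

lemma Z_tendsto_0:
  assumes holo: "cl.holo_on H D DS"
    and bounded: "\<And>z. z \<in> DS \<Longrightarrow> norm (H z) \<le> M" and decay: "\<And>z. z \<in> DS \<Longrightarrow> norm (H z) \<le> M / norm z"
    and int: "\<And>\<psi>. \<psi> \<in> rays \<Longrightarrow> set_integrable lborel {0<..} (\<lambda>t. norm (H (polar t \<psi>)))"
  shows "(\<lambda>n. Z n H) \<longlonglongrightarrow> 0"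
proof -
  define W where "W n \<psi> = integral (trunc n) (\<lambda>t. e (cis \<psi>) * H (polar t \<psi>))" for n \<psi>
  have Z: "Z n H = (1 / (2 * pi)) *\<^sub>R (e (1 / \<i>) * quad (W n))" for n
  proof -
    have "integral (trunc n) (\<lambda>t. e (cis \<psi> / \<i>) * H (polar t \<psi>)) = e (1 / \<i>) * W n \<psi>" if "\<psi> \<in> rays" for \<psi>
    proof -
      have "cis \<psi> / \<i> = 1 / \<i> * cis \<psi>" by simp
      then have "e (cis \<psi> / \<i>) * x = e (1 / \<i>) * (e (cis \<psi>) * x)" for x
        by (simp only: slice_emb_mult[OF unit] mult.assoc)
      then show ?thesis
        unfolding W_def
        using integral_trunc_linear[OF bounded_linear_mult_left_cl
            continuous_on_integrand(1)[OF cl.holo_on_continuous[OF holo] that]] by simp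
    qed
    then have "quad (\<lambda>\<psi>. integral (trunc n) (\<lambda>t. e (cis \<psi> / \<i>) * H (polar t \<psi>))) =
        quad (\<lambda>\<psi>. e (1 / \<i>) * W n \<psi>)" by (rule quad_cong)
    also have "\<dots> = e (1 / \<i>) * quad (W n)" by (rule quad_linear[OF bounded_linear_mult_left_cl])
    finally show ?thesis by (simp only: Z_def)
  qed
  have lim: "(\<lambda>n. W n (\<mu> + \<phi>) - W n (\<mu> - \<phi>)) \<longlonglongrightarrow> 0"
    if sub: "sector (\<mu> - \<phi>) (\<mu> + \<phi>) \<subseteq> DS" and "\<mu> - \<phi> \<in> rays" "\<mu> + \<phi> \<in> rays" for \<mu>
    unfolding W_def trunc_def
    by (rule cl.truncated_sector_vanishing[OF cl.holo_on_subset[OF holo sub] \<phi>, where C = M])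
       (use bounded decay int sub that in auto)
  have "(\<lambda>n. W n (0 + \<phi>) - W n (0 - \<phi>)) \<longlonglongrightarrow> 0" "(\<lambda>n. W n (pi + \<phi>) - W n (pi - \<phi>)) \<longlonglongrightarrow> 0"
    by (rule lim; simp add: DS_def rays_def)+
  then have "(\<lambda>n. - (W n (0 + \<phi>) - W n (0 - \<phi>)) - (W n (pi + \<phi>) - W n (pi - \<phi>))) \<longlonglongrightarrow> - 0 - 0"
    by (intro tendsto_intros)
  then have "(\<lambda>n. quad (W n)) \<longlonglongrightarrow> 0" by (simp add: quad_def algebra_simps)
  from tendsto_scaleR[OF tendsto_const bounded_linear.tendsto[OF bounded_linear_mult_left_cl[of "e (1 / \<i>)"] this],
      of "1 / (2 * pi)"]
  show ?thesis unfolding Z by simp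
qed

text \<open>F itself need not decay, but \<open>E0\<close> and \<open>E1\<close> are bounded by a
  multiple of 1/|z|. This gives the product borderline decay and turns integrability against dt/t
  into integrability against dt.\<close>

lemma Z_E_tendsto_0:
  assumes F: "admissible F" and E: "E \<in> {E0, E1}"
  shows "(\<lambda>n. Z n (\<lambda>z. e (E z) * F z)) \<longlonglongrightarrow> 0"
proof -
  have adm: "admissible (\<lambda>z. e (E z) * F z)" using admissible_E[OF F] E by auto
  then obtain D where D: "cl.holo_on (\<lambda>z. e (E z) * F z) D DS" by (auto simp: admissible_def)
  obtain c where c: "0 < c" "\<And>z x. norm (e z * x) \<le> c * (norm z * norm x)"
    using cl.norm_act_le by metis
  obtain M where M: "\<And>z. z \<in> DS \<Longrightarrow> norm (F z) \<le> M" using F unfolding admissible_def by blast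
  have Eb: "norm (E z) \<le> 1 / cos \<phi>" "norm (E z) \<le> 1 / cos \<phi> / norm z" if "z \<in> DS" for z
    using E norm_E_bounds[OF that] by auto
  have le: "norm (e (E z) * F z) \<le> c * (m * norm (F z))" if "z \<in> DS" "norm (E z) \<le> m" for z m
    by (rule order_trans[OF c(2)]) (use c(1) that in \<open>auto intro!: mult_left_mono mult_right_mono\<close>)
  show ?thesis
  proof (rule Z_tendsto_0[OF D])
    fix z assume z: "z \<in> DS"
    have "c * (m * norm (F z)) \<le> c * (m * M)" if "0 \<le> m" for m
      using c(1) M[OF z] that by (intro mult_left_mono) auto
    from order_trans[OF le[OF z Eb(1)[OF z]] this] order_trans[OF le[OF z Eb(2)[OF z]] this]
    show "norm (e (E z) * F z) \<le> c * (1 / cos \<phi> * M)"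
      "norm (e (E z) * F z) \<le> c * (1 / cos \<phi> * M) / norm z"
      using cos_pos by simp_all
  next
    fix \<psi> assume \<psi>: "\<psi> \<in> rays"
    have "set_integrable lborel {0<..} (\<lambda>t. c * (1 / cos \<phi>) * (norm (F (polar t \<psi>)) / t))"
      using F \<psi> by (intro set_integrable_mult_right) (simp add: admissible_def)
    then show "set_integrable lborel {0<..} (\<lambda>t. norm (e (E (polar t \<psi>)) * F (polar t \<psi>)))"
    proof (rule set_integrable_bound)
      have "(\<lambda>t. indicator {0<..} t *\<^sub>R norm (e (E (polar t \<psi>)) * F (polar t \<psi>))) \<in> borel_measurable borel"
        by (rule borel_measurable_continuous_on_indicator)
           (use continuous_on_ray_DS[OF admissible_continuous[OF adm] \<psi>] in \<open>auto intro!: continuous_intros\<close>)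
      then show "set_borel_measurable lborel {0<..} (\<lambda>t. norm (e (E (polar t \<psi>)) * F (polar t \<psi>)))"
        unfolding set_borel_measurable_def by simp
      have "norm (e (E (polar t \<psi>)) * F (polar t \<psi>)) \<le>
          c * (1 / cos \<phi>) * (norm (F (polar t \<psi>)) / t)" if "0 < t" for t
        using le[OF ray_DS[OF \<psi> that] Eb(2)[OF ray_DS[OF \<psi> that]]] that by (simp add: norm_ray)
      then show "AE t in lborel. t \<in> {0<..} \<longrightarrow> norm (norm (e (E (polar t \<psi>)) * F (polar t \<psi>))) \<le>
          norm (c * (1 / cos \<phi>) * (norm (F (polar t \<psi>)) / t))"
        by (intro AE_I2 impI) (use abs_ge_self order_trans in fastforce)
    qed
  qed
qed

section \<open>Product rule for the two rational functions\<close>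

lemma e_commute: "e z * (e w * x) = e w * (e z * x)"
  by (simp add: mult.assoc[symmetric] slice_emb_mult[OF unit, symmetric] mult.commute)

lemma e_E0: "z \<in> DS \<Longrightarrow> e (1 + z\<^sup>2) * (e (E0 z) * x) = x"
  using one_plus_square_nz[of z]
  by (simp only: mult.assoc[symmetric] slice_emb_mult[OF unit, symmetric] E0_def) simp

lemma e_E1: "e z * (e (E0 z) * x) = e (E1 z) * x"
  by (simp only: mult.assoc[symmetric] slice_emb_mult[OF unit, symmetric] E0_def E1_def) simp

text \<open>The resolvent identity divided by 1 + z^2; only the first term on the right still
  contains the resolvent.\<close>

lemma R_Sb_ray:
  assumes "z \<in> X" "z \<in> DS"
  shows "R o\<^sub>L (Sb z o\<^sub>L lmul_op x) = (Sb z o\<^sub>L lmul_op (e (E0 z) * x)) +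
    (P o\<^sub>L lmul_op (e (E0 z) * x)) + (R o\<^sub>L lmul_op (e (E1 z) * x))"
proof -
  have "(R o\<^sub>L (Sb z o\<^sub>L lmul_op (e (1 + z\<^sup>2)))) o\<^sub>L lmul_op (e (E0 z) * x) =
      (Sb z + P + (R o\<^sub>L lmul_op (e z))) o\<^sub>L lmul_op (e (E0 z) * x)"
    unfolding compose_R_Sb[OF assms(1)] ..
  moreover have "lmul_op (e (1 + z\<^sup>2)) o\<^sub>L lmul_op (e (E0 z) * x) =
      (lmul_op x :: ('v, 'n) cl_op)"
    "lmul_op (e z) o\<^sub>L lmul_op (e (E0 z) * x) =
      (lmul_op (e (E1 z) * x) :: ('v, 'n) cl_op)"
    using e_E0[OF assms(2)] e_E1 by (simp_all only: lmul_op_mult[symmetric])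
  ultimately show ?thesis
    by (simp only: compose_assoc linear_simps[OF bounded_linear_compose_right])
qed

lemma P_Sb_ray:
  assumes "z \<in> X" "z \<in> DS"
  shows "P o\<^sub>L (Sb z o\<^sub>L lmul_op x) = (Sb z o\<^sub>L lmul_op (e (E1 z) * x)) +
    (P o\<^sub>L lmul_op (e (E1 z) * x)) - (R o\<^sub>L lmul_op (e (E0 z) * x))"
proof -
  have "(P o\<^sub>L (Sb z o\<^sub>L lmul_op (e (1 + z\<^sup>2)))) o\<^sub>L lmul_op (e (E0 z) * x) =
      ((Sb z o\<^sub>L lmul_op (e z)) + (P o\<^sub>L lmul_op (e z)) - R) o\<^sub>L lmul_op (e (E0 z) * x)"
    unfolding compose_P_Sb[OF assms(1)] ..
  moreover have "lmul_op (e (1 + z\<^sup>2)) o\<^sub>L lmul_op (e (E0 z) * x) =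
      (lmul_op x :: ('v, 'n) cl_op)"
    "lmul_op (e z) o\<^sub>L lmul_op (e (E0 z) * x) =
      (lmul_op (e (E1 z) * x) :: ('v, 'n) cl_op)"
    using e_E0[OF assms(2)] e_E1 by (simp_all only: lmul_op_mult[symmetric])
  ultimately show ?thesis
    by (simp only: compose_assoc linear_simps[OF bounded_linear_compose_right])
qed


text \<open>Common form of the product rules for R and P. The terms with B1 and B2 are constant
  operators composed with integrals \<open>Z n\<close>, which tend to 0.\<close>

lemma has_calc_compose:
  assumes F: "has_calc F C'" and E: "E \<in> {E0, E1}" and E': "E' \<in> {E0, E1}"
    and eq: "\<And>z x. z \<in> X \<Longrightarrow> z \<in> DS \<Longrightarrow> B o\<^sub>L (Sb z o\<^sub>L lmul_op x) = (Sb z o\<^sub>L lmul_op (e (E z) * x)) +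
      (B1 o\<^sub>L lmul_op (e (E z) * x)) + (B2 o\<^sub>L lmul_op (e (E' z) * x))"
  shows "has_calc (\<lambda>z. e (E z) * F z) (B o\<^sub>L C')"
proof -
  have admF: "admissible F" using F by (simp add: has_calc_def)
  have adm: "admissible (\<lambda>z. e (E z) * F z)" "admissible (\<lambda>z. e (E' z) * F z)"
    using admissible_E[OF admF] E E' by auto
  note cont = admissible_continuous[OF admF] admissible_continuous[OF adm(1)] admissible_continuous[OF adm(2)]
  have ray: "B o\<^sub>L integral (trunc n) (\<lambda>t. Sb (polar t \<psi>) o\<^sub>L lmul_op (e (cis \<psi> / \<i>) * F (polar t \<psi>))) =
      integral (trunc n) (\<lambda>t. Sb (polar t \<psi>) o\<^sub>L
        lmul_op (e (cis \<psi> / \<i>) * (e (E (polar t \<psi>)) * F (polar t \<psi>)))) +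
      (B1 o\<^sub>L lmul_op (integral (trunc n) (\<lambda>t. e (cis \<psi> / \<i>) * (e (E (polar t \<psi>)) * F (polar t \<psi>))))) +
      (B2 o\<^sub>L lmul_op (integral (trunc n) (\<lambda>t. e (cis \<psi> / \<i>) * (e (E' (polar t \<psi>)) * F (polar t \<psi>)))))"
    (is "?L = ?I1 + ?I2 + ?I3") if \<psi>: "\<psi> \<in> rays" for n \<psi>
  proof -
    let ?c = "e (cis \<psi> / \<i>)"
    have c1: "continuous_on {0<..} (\<lambda>t. Sb (polar t \<psi>) o\<^sub>L
        lmul_op (?c * (e (E (polar t \<psi>)) * F (polar t \<psi>))))"
      by (rule continuous_on_integrand(2)[OF cont(2) \<psi>])
    have c2: "continuous_on {0<..} (\<lambda>t. B1 o\<^sub>L lmul_op (?c * (e (E (polar t \<psi>)) * F (polar t \<psi>))))"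
      by (rule bounded_linear.continuous_on[OF bounded_linear_compose_lmul_op continuous_on_integrand(1)[OF cont(2) \<psi>]])
    have c3: "continuous_on {0<..} (\<lambda>t. B2 o\<^sub>L lmul_op (?c * (e (E' (polar t \<psi>)) * F (polar t \<psi>))))"
      by (rule bounded_linear.continuous_on[OF bounded_linear_compose_lmul_op continuous_on_integrand(1)[OF cont(3) \<psi>]])
    have "?L = integral (trunc n) (\<lambda>t. B o\<^sub>L (Sb (polar t \<psi>) o\<^sub>L lmul_op (?c * F (polar t \<psi>))))"
      by (rule integral_trunc_linear[OF bounded_linear_compose_left continuous_on_integrand(2)[OF cont(1) \<psi>], symmetric])
    also have "\<dots> = integral (trunc n) (\<lambda>t. ((Sb (polar t \<psi>) o\<^sub>L
        lmul_op (?c * (e (E (polar t \<psi>)) * F (polar t \<psi>)))) +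
        (B1 o\<^sub>L lmul_op (?c * (e (E (polar t \<psi>)) * F (polar t \<psi>))))) +
        (B2 o\<^sub>L lmul_op (?c * (e (E' (polar t \<psi>)) * F (polar t \<psi>)))))"
      by (rule integral_cong) (simp only: eq[OF ray_X[OF \<psi> trunc_pos] ray_DS[OF \<psi> trunc_pos]] e_commute)
    also have "\<dots> = ?I1 + integral (trunc n) (\<lambda>t. B1 o\<^sub>L lmul_op (?c * (e (E (polar t \<psi>)) * F (polar t \<psi>)))) +
        integral (trunc n) (\<lambda>t. B2 o\<^sub>L lmul_op (?c * (e (E' (polar t \<psi>)) * F (polar t \<psi>))))"
      by (simp only: integral_add integrable_add integrable_trunc c1 c2 c3)
    also have "\<dots> = ?I1 + ?I2 + ?I3"
      by (simp only: integral_trunc_linear[OF bounded_linear_compose_lmul_op] continuous_on_integrand(1)[OF cont(2) \<psi>]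
          continuous_on_integrand(1)[OF cont(3) \<psi>])
    finally show ?thesis .
  qed
  let ?Z1 = "\<lambda>n. B1 o\<^sub>L lmul_op (Z n (\<lambda>z. e (E z) * F z))"
    and ?Z2 = "\<lambda>n. B2 o\<^sub>L lmul_op (Z n (\<lambda>z. e (E' z) * F z))"
  have "B o\<^sub>L K n F = K n (\<lambda>z. e (E z) * F z) + ?Z1 n + ?Z2 n" for n
    unfolding K_def Z_def linear_simps[OF bounded_linear_compose_left] linear_simps[OF bounded_linear_compose_lmul_op]
      scaleR_add_right[symmetric] quad_linear[OF bounded_linear_compose_left, symmetric]
      quad_linear[OF bounded_linear_compose_lmul_op, symmetric] quad_add[symmetric]
    by (intro arg_cong2[where f = scaleR] refl quad_cong ray)
  then have eqK: "K n (\<lambda>z. e (E z) * F z) = (B o\<^sub>L K n F) - ?Z1 n - ?Z2 n" for n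
    by (simp add: algebra_simps)
  have "(\<lambda>n. (B o\<^sub>L K n F) - ?Z1 n - ?Z2 n) \<longlonglongrightarrow> (B o\<^sub>L C') - (B1 o\<^sub>L lmul_op 0) - (B2 o\<^sub>L lmul_op 0)"
    using F by (intro tendsto_diff bounded_linear.tendsto[OF bounded_linear_compose_left]
        bounded_linear.tendsto[OF bounded_linear_compose_lmul_op] Z_E_tendsto_0[OF admF] E E')
      (simp add: has_calc_def)
  then have "(\<lambda>n. K n (\<lambda>z. e (E z) * F z)) \<longlonglongrightarrow> (B o\<^sub>L C')"
    by (simp add: eqK linear_simps[OF bounded_linear_compose_lmul_op])
  with adm show ?thesis by (simp add: has_calc_def)
qed

lemma has_calc_E0: "has_calc F B \<Longrightarrow> has_calc (\<lambda>z. e (E0 z) * F z) (R o\<^sub>L B)"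
  by (rule has_calc_compose[where E' = E1 and ?B1.0 = P and ?B2.0 = R]) (auto simp: R_Sb_ray)

lemma has_calc_E1: "has_calc F B \<Longrightarrow> has_calc (\<lambda>z. e (E1 z) * F z) (P o\<^sub>L B)"
proof (rule has_calc_compose[where E' = E0 and ?B1.0 = P and ?B2.0 = "- R"])
  fix z x assume "z \<in> X" "z \<in> DS"
  moreover have "(- R) o\<^sub>L lmul_op (e (E0 z) * x) = - (R o\<^sub>L lmul_op (e (E0 z) * x))"
    by (rule blinfun_eqI) (simp add: blinfun.bilinear_simps)
  ultimately show "P o\<^sub>L (Sb z o\<^sub>L lmul_op x) = (Sb z o\<^sub>L lmul_op (e (E1 z) * x)) +
      (P o\<^sub>L lmul_op (e (E1 z) * x)) + ((- R) o\<^sub>L lmul_op (e (E0 z) * x))"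
    by (simp only: P_Sb_ray diff_conv_add_uminus)
qed auto

section \<open>The value of the calculus at s / (1 + s^2)\<close>

lemma admissible_e_E1: "admissible (\<lambda>z. e (E1 z))"
  unfolding admissible_def
proof (intro conjI ballI)
  have "cl.holo_on (\<lambda>z. e (E1 z) * 1) (\<lambda>z. e ((1 - z\<^sup>2) / (1 + z\<^sup>2)\<^sup>2) * 1 + e (E1 z) * 0) DS"
    by (rule cl.holo_on_act[OF cl.holo_on_const E_derivative_continuous(2) E_derivative(2)])
  then show holo: "\<exists>D. cl.holo_on (\<lambda>z. e (E1 z)) D DS" by auto
  show "\<exists>M. \<forall>z\<in>DS. norm (e (E1 z)) \<le> M"
    using norm_E_bounds(2) by (auto simp: norm_slice_emb[OF unit])
  fix \<psi> assume \<psi>: "\<psi> \<in> rays"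
  \<comment> \<open>The zero of \<open>E1\<close> at 0 cancels the factor 1/t and leaves a multiple
    of 1/(1 + t^2).\<close>
  have "set_integrable lborel {0<..} (\<lambda>t. 1 / cos \<phi> * (1 / (1 + t\<^sup>2)))"
    by (intro set_integrable_mult_right set_integrable_inverse_1_plus_square)
  then show "set_integrable lborel {0<..} (\<lambda>t. norm (e (E1 (polar t \<psi>))) / t)"
  proof (rule set_integrable_bound)
    show "set_borel_measurable lborel {0<..} (\<lambda>t. norm (e (E1 (polar t \<psi>))) / t)"
      using holo cl.holo_on_continuous \<psi> by (intro set_borel_measurable_ray) blast+
    have "norm (e (E1 (polar t \<psi>))) / t \<le> 1 / cos \<phi> * (1 / (1 + t\<^sup>2))" if "0 < t" for t
    proof -
      have "norm (e (E1 (polar t \<psi>))) \<le> t / (cos \<phi> * (1 + t\<^sup>2))"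
        using norm_E1[OF ray_DS[OF \<psi> that]] by (simp only: norm_slice_emb[OF unit] norm_ray[OF that])
      from divide_right_mono[OF this, of t] that show ?thesis by simp
    qed
    then show "AE t in lborel. t \<in> {0<..} \<longrightarrow> norm (norm (e (E1 (polar t \<psi>))) / t) \<le>
        norm (1 / cos \<phi> * (1 / (1 + t\<^sup>2)))"
      using cos_pos by (intro AE_I2 impI) (auto simp: abs_mult)
  qed
qed

lemma sector_X:
  assumes "{\<alpha>..\<beta>} \<subseteq> {\<phi>..pi - \<phi>} \<union> {pi + \<phi>..2 * pi - \<phi>}"
  shows "sector \<alpha> \<beta> \<subseteq> X"
  using assms by (auto simp: sector_def intro!: X_polar abs_cos_le_cos)

lemma op_holo_compose_left:
  assumes "op.holo_on G D Y"
  shows "op.holo_on (\<lambda>z. B o\<^sub>L G z) (\<lambda>z. B o\<^sub>L D z) Y"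
  unfolding op.holo_on_def
proof (intro conjI ballI)
  show "continuous_on Y (\<lambda>z. B o\<^sub>L D z)"
    using assms by (intro bounded_linear.continuous_on[OF bounded_linear_compose_left]) (simp add: op.holo_on_def)
  show "((\<lambda>z. B o\<^sub>L G z) has_derivative (\<lambda>h. (B o\<^sub>L D z) o\<^sub>L lmul_op (e h))) (at z within Y)" if "z \<in> Y" for z
    unfolding compose_assoc
    by (rule bounded_linear.has_derivative[OF bounded_linear_compose_left])
       (use assms that in \<open>simp add: op.holo_on_def\<close>)
qed

text \<open>Concerns the gaps between the sectors. They contain the poles i and -i of
  \<open>E1\<close>, but P S is holomorphic there. The limit value P of P S(z) z at infinity enters
  through \<open>truncated_sector_limit\<close>.\<close>

lemma act_P_Sb_limit:
  assumes sub: "{\<alpha>..\<beta>} \<subseteq> {\<phi>..pi - \<phi>} \<union> {pi + \<phi>..2 * pi - \<phi>}" and "\<alpha> \<le> \<beta>"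
  shows "(\<lambda>n. integral (trunc n) (\<lambda>r. (P o\<^sub>L Sb (polar r \<beta>)) o\<^sub>L lmul_op (e (cis \<beta>))) -
      integral (trunc n) (\<lambda>r. (P o\<^sub>L Sb (polar r \<alpha>)) o\<^sub>L lmul_op (e (cis \<alpha>))))
    \<longlonglongrightarrow> (\<beta> - \<alpha>) *\<^sub>R (P o\<^sub>L lmul_op (e \<i>))"
proof -
  obtain c where c: "0 < c" "\<And>z B. norm (B o\<^sub>L lmul_op (e z) :: ('v, 'n) cl_op) \<le> c * (norm z * norm B)"
    using op.norm_act_le by metis
  note X = subsetD[OF sector_X[OF sub]]
  define M1 where "M1 = C + norm R * C"
  define M2 where "M2 = c * (norm R * (c * C + norm (id_blinfun :: ('v, 'n) cl_op)))"
  have M: "0 \<le> M1" "0 \<le> M2" using C_nonneg c(1) by (auto simp: M1_def M2_def)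
  show ?thesis
    unfolding trunc_def
  proof (rule op.truncated_sector_limit[where C = "M1 + M2", OF _ \<open>\<alpha> \<le> \<beta>\<close>])
    show "op.holo_on (\<lambda>z. P o\<^sub>L Sb z) (\<lambda>z. P o\<^sub>L Sq z z) (sector \<alpha> \<beta>)"
      by (rule op_holo_compose_left[OF op.holo_on_subset[OF Sb_holo sector_X[OF sub]]])
  next
    fix z assume z: "z \<in> sector \<alpha> \<beta>"
    have z0: "norm z > 0" using X[OF z] X_0 by auto
    have "norm (Sb z - (R o\<^sub>L Sb z)) \<le> norm (Sb z) + norm R * norm (Sb z)"
      using norm_triangle_ineq4[of "Sb z" "R o\<^sub>L Sb z"] norm_blinfun_compose[of R "Sb z"] by linarith
    also have "\<dots> \<le> C / norm z + norm R * (C / norm z)"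
      using norm_Sb[OF X[OF z]] by (intro add_mono mult_left_mono) auto
    also have "\<dots> = M1 / norm z" by (simp add: M1_def add_divide_distrib)
    also have "\<dots> \<le> (M1 + M2) / norm z" using M by (intro divide_right_mono) auto
    finally show "norm (((P o\<^sub>L Sb z) o\<^sub>L lmul_op (e z)) - P) \<le> (M1 + M2) / norm z"
      by (simp only: compose_assoc P_Sb_large[OF X[OF z]]) simp
    have "norm (Sb z o\<^sub>L lmul_op (e z)) \<le> c * (norm z * (C / norm z))"
      using c(1) norm_Sb[OF X[OF z]] by (intro order_trans[OF c(2)] mult_left_mono) auto
    then have "norm ((Sb z o\<^sub>L lmul_op (e z)) - id_blinfun) \<le> c * C + norm (id_blinfun :: ('v, 'n) cl_op)"
      using norm_triangle_ineq4[of "Sb z o\<^sub>L lmul_op (e z)" id_blinfun] z0 by simp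
    then have "norm (P o\<^sub>L Sb z) \<le> norm R * (c * C + norm (id_blinfun :: ('v, 'n) cl_op))"
      unfolding P_Sb_small[OF X[OF z]] by (intro order_trans[OF norm_blinfun_compose] mult_left_mono) auto
    then have "norm ((P o\<^sub>L Sb z) o\<^sub>L lmul_op (e z)) \<le>
        c * (norm z * (norm R * (c * C + norm (id_blinfun :: ('v, 'n) cl_op))))"
      using c(1) by (intro order_trans[OF c(2)] mult_left_mono) auto
    also have "\<dots> = M2 * norm z" by (simp add: M2_def)
    also have "\<dots> \<le> (M1 + M2) * norm z" using M by (intro mult_right_mono) auto
    finally show "norm ((P o\<^sub>L Sb z) o\<^sub>L lmul_op (e z)) \<le> (M1 + M2) * norm z" .
  qed
qed

text \<open>Here the sectors themselves are used, where \<open>E0\<close> and \<open>E1\<close> are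
  regular. From z \<open>E1\<close> z = 1 - \<open>E0\<close> z and z \<open>E0\<close> z =
  \<open>E1\<close> z, the product of z with the rational part tends to P at infinity.\<close>

lemma act_P_R_limit:
  assumes sub: "sector \<alpha> \<beta> \<subseteq> DS" and "\<alpha> \<le> \<beta>"
  defines "G \<equiv> \<lambda>z. (P o\<^sub>L lmul_op (e (E1 z))) - (R o\<^sub>L lmul_op (e (E0 z)))"
  shows "(\<lambda>n. integral (trunc n) (\<lambda>r. G (polar r \<beta>) o\<^sub>L lmul_op (e (cis \<beta>))) -
      integral (trunc n) (\<lambda>r. G (polar r \<alpha>) o\<^sub>L lmul_op (e (cis \<alpha>))))
    \<longlonglongrightarrow> (\<beta> - \<alpha>) *\<^sub>R (P o\<^sub>L lmul_op (e \<i>))"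
proof -
  obtain c where c: "0 < c" "\<And>z B. norm (B o\<^sub>L lmul_op (e z) :: ('v, 'n) cl_op) \<le> c * (norm z * norm B)"
    using op.norm_act_le by metis
  note DS = subsetD[OF sub]
  define M where "M = c * (1 / cos \<phi> * norm P) + c * (1 / cos \<phi> * norm R)"
  have act: "(B o\<^sub>L lmul_op (e w)) o\<^sub>L lmul_op (e z) = B o\<^sub>L lmul_op (e (z * w))" for B :: "('v, 'n) cl_op" and z w
    by (rule op.act_mult[symmetric])
  have bound: "norm ((P o\<^sub>L lmul_op (e a)) - (R o\<^sub>L lmul_op (e b))) \<le> M * x"
    "norm ((P o\<^sub>L lmul_op (e a)) + (R o\<^sub>L lmul_op (e b))) \<le> M * x"
    if ab: "norm a \<le> 1 / cos \<phi> * x" "norm b \<le> 1 / cos \<phi> * x" for a b x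
  proof -
    have "norm (P o\<^sub>L lmul_op (e a)) \<le> c * (1 / cos \<phi> * x * norm P)"
      "norm (R o\<^sub>L lmul_op (e b)) \<le> c * (1 / cos \<phi> * x * norm R)"
      using c(1) by (intro order_trans[OF c(2)] mult_left_mono mult_right_mono ab; simp)+
    moreover have "c * (1 / cos \<phi> * x * norm P) + c * (1 / cos \<phi> * x * norm R) = M * x"
      by (simp add: M_def algebra_simps)
    ultimately show "norm ((P o\<^sub>L lmul_op (e a)) - (R o\<^sub>L lmul_op (e b))) \<le> M * x"
      "norm ((P o\<^sub>L lmul_op (e a)) + (R o\<^sub>L lmul_op (e b))) \<le> M * x"
      using norm_triangle_ineq4[of "P o\<^sub>L lmul_op (e a)" "R o\<^sub>L lmul_op (e b)"]
        norm_triangle_ineq[of "P o\<^sub>L lmul_op (e a)" "R o\<^sub>L lmul_op (e b)"] by linarith+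
  qed
  show ?thesis
    unfolding trunc_def
  proof (rule op.truncated_sector_limit[where C = M, OF _ \<open>\<alpha> \<le> \<beta>\<close>])
    show "op.holo_on G (\<lambda>z. ((P o\<^sub>L lmul_op (e ((1 - z\<^sup>2) / (1 + z\<^sup>2)\<^sup>2))) + (0 o\<^sub>L lmul_op (e (E1 z)))) -
        ((R o\<^sub>L lmul_op (e (- 2 * z / (1 + z\<^sup>2)\<^sup>2))) + (0 o\<^sub>L lmul_op (e (E0 z))))) (sector \<alpha> \<beta>)"
      unfolding G_def
      by (intro op.holo_on_subset[OF _ sub] op.holo_on_diff op.holo_on_act op.holo_on_const
          E_derivative_continuous E_derivative)
  next
    fix z assume z: "z \<in> sector \<alpha> \<beta>"
    have nz: "1 + z\<^sup>2 \<noteq> 0" by (rule one_plus_square_nz[OF DS[OF z]])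
    have "z * E1 z = 1 - E0 z" using nz by (simp add: E0_def E1_def field_simps power2_eq_square)
    moreover have "z * E0 z = E1 z" by (simp add: E0_def E1_def)
    moreover have "P o\<^sub>L lmul_op (e (1 - E0 z)) = P - (P o\<^sub>L lmul_op (e (E0 z)))"
      using op.diff_left[of P 1 "E0 z"] op.act_one[of P] by simp
    ultimately have "(G z o\<^sub>L lmul_op (e z)) - P = - ((P o\<^sub>L lmul_op (e (E0 z))) + (R o\<^sub>L lmul_op (e (E1 z))))"
      unfolding G_def linear_simps(2)[OF bounded_linear_compose_right] act by simp
    moreover have "norm ((P o\<^sub>L lmul_op (e (E0 z))) + (R o\<^sub>L lmul_op (e (E1 z)))) \<le> M * (1 / norm z)"
      using norm_E_bounds(3,4)[OF DS[OF z]] by (intro bound(2)) auto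
    ultimately show "norm ((G z o\<^sub>L lmul_op (e z)) - P) \<le> M / norm z"
      by (simp only: norm_minus_cancel) simp
    have "norm (z * E1 z) \<le> 1 / cos \<phi> * norm z" "norm (z * E0 z) \<le> 1 / cos \<phi> * norm z"
      using norm_E_bounds(1,2)[OF DS[OF z], THEN mult_right_mono[of _ _ "norm z"]]
      by (simp_all add: norm_mult mult.commute[of "norm z"])
    from bound(1)[OF this] show "norm (G z o\<^sub>L lmul_op (e z)) \<le> M * norm z"
      unfolding G_def linear_simps(2)[OF bounded_linear_compose_right] act .
  qed
qed

text \<open>Subtracting the poles at \<open>\<plusminus>J\<close>, which lie between the two sectors, by means of the resolvent
  identity: \<open>P S\<close> has no poles there, and the remaining rational part has none in the sectors.\<close>

lemma has_calc_e_E1: "has_calc (\<lambda>z. e (E1 z)) P"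
proof -
  define V where "V G n \<psi> = integral (trunc n) (\<lambda>r. G (polar r \<psi>) o\<^sub>L lmul_op (e (cis \<psi>)))"
    for G :: "complex \<Rightarrow> ('v, 'n) cl_op" and n \<psi>
  define Gx where "Gx z = P o\<^sub>L Sb z" for z
  define Gi where "Gi z = (P o\<^sub>L lmul_op (e (E1 z))) - (R o\<^sub>L lmul_op (e (E0 z)))" for z
  define PJ where "PJ = P o\<^sub>L lmul_op (e \<i>)"
  have Gxc: "continuous_on {0<..} (\<lambda>t. Gx (polar t \<psi>) o\<^sub>L lmul_op (e (cis \<psi>)))" if "\<psi> \<in> rays" for \<psi>
    unfolding Gx_def
    by (intro bounded_linear.continuous_on[OF bounded_linear_compose_right]
        bounded_linear.continuous_on[OF bounded_linear_compose_left] continuous_on_Sb_ray that)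
  have "continuous_on DS E1" "continuous_on DS E0"
    unfolding continuous_on_eq_continuous_within using E_derivative DERIV_continuous by blast+
  from this[THEN bounded_linear.continuous_on[OF bounded_linear_slice_emb]]
  have "continuous_on DS (\<lambda>z. e (E1 z))" "continuous_on DS (\<lambda>z. e (E0 z))" .
  then have Gic: "continuous_on {0<..} (\<lambda>t. Gi (polar t \<psi>) o\<^sub>L lmul_op (e (cis \<psi>)))" if "\<psi> \<in> rays" for \<psi>
    unfolding Gi_def
    by (intro bounded_linear.continuous_on[OF bounded_linear_compose_right] continuous_on_diff
        bounded_linear.continuous_on[OF bounded_linear_compose_lmul_op] continuous_on_ray_DS that)
  \<comment> \<open>\<open>P_Sb_ray\<close> with x = 1, solved for the term with
    \<open>E1\<close>.\<close>
  have split: "Sb z o\<^sub>L lmul_op (e (cis \<psi> / \<i>) * e (E1 z)) =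
      ((Gx z o\<^sub>L lmul_op (e (cis \<psi>))) - (Gi z o\<^sub>L lmul_op (e (cis \<psi>)))) o\<^sub>L lmul_op (e (1 / \<i>))"
    if "z \<in> X" "z \<in> DS" for z \<psi>
  proof -
    have "e (cis \<psi> / \<i>) * e (E1 z) = e (E1 z) * (e (cis \<psi>) * e (1 / \<i>))"
      by (simp only: slice_emb_mult[OF unit, symmetric]) (simp add: mult.commute)
    moreover have "Sb z o\<^sub>L lmul_op (e (E1 z)) = Gx z - Gi z"
    proof -
      have "Sb z o\<^sub>L id_blinfun = Sb z" by (rule blinfun_eqI) simp
      then show ?thesis
        using P_Sb_ray[OF that, of 1] by (simp add: Gx_def Gi_def lmul_op_one algebra_simps)
    qed
    ultimately show ?thesis
      by (simp only: lmul_op_mult compose_assoc[symmetric] linear_simps(2)[OF bounded_linear_compose_right])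
  qed
  have K: "K n (\<lambda>z. e (E1 z)) = (1 / (2 * pi)) *\<^sub>R ((quad (V Gx n) - quad (V Gi n)) o\<^sub>L lmul_op (e (1 / \<i>)))" for n
  proof -
    have "integral (trunc n) (\<lambda>t. Sb (polar t \<psi>) o\<^sub>L lmul_op (e (cis \<psi> / \<i>) * e (E1 (polar t \<psi>)))) =
        (V Gx n \<psi> - V Gi n \<psi>) o\<^sub>L lmul_op (e (1 / \<i>))" if \<psi>: "\<psi> \<in> rays" for \<psi>
    proof -
      have "integral (trunc n) (\<lambda>t. Sb (polar t \<psi>) o\<^sub>L lmul_op (e (cis \<psi> / \<i>) * e (E1 (polar t \<psi>)))) =
        integral (trunc n) (\<lambda>t. ((Gx (polar t \<psi>) o\<^sub>L lmul_op (e (cis \<psi>))) -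
          (Gi (polar t \<psi>) o\<^sub>L lmul_op (e (cis \<psi>)))) o\<^sub>L lmul_op (e (1 / \<i>)))"
        by (rule integral_cong) (rule split[OF ray_X[OF \<psi> trunc_pos] ray_DS[OF \<psi> trunc_pos]])
      also have "\<dots> = (integral (trunc n) (\<lambda>t. (Gx (polar t \<psi>) o\<^sub>L lmul_op (e (cis \<psi>))) -
          (Gi (polar t \<psi>) o\<^sub>L lmul_op (e (cis \<psi>))))) o\<^sub>L lmul_op (e (1 / \<i>))"
        by (rule integral_trunc_linear[OF bounded_linear_compose_right continuous_on_diff[OF Gxc[OF \<psi>] Gic[OF \<psi>]]])
      also have "\<dots> = (V Gx n \<psi> - V Gi n \<psi>) o\<^sub>L lmul_op (e (1 / \<i>))"
        unfolding V_def by (simp only: integral_diff integrable_trunc Gxc[OF \<psi>] Gic[OF \<psi>])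
      finally show ?thesis .
    qed
    then show ?thesis
      unfolding K_def quad_diff[symmetric] quad_linear[OF bounded_linear_compose_right, symmetric]
      by (intro arg_cong2[where f = scaleR] refl quad_cong)
  qed
  \<comment> \<open>Grouped by gaps the four rays form \<open>quad\<close>; grouped by sectors they
    form its negative. \<open>Gx\<close> is treated on the gaps and \<open>Gi\<close> on the
    sectors.\<close>
  have "(\<lambda>n. V Gx n (pi - \<phi>) - V Gx n \<phi>) \<longlonglongrightarrow> (pi - \<phi> - \<phi>) *\<^sub>R PJ"
    and 2: "(\<lambda>n. V Gx n (2 * pi - \<phi>) - V Gx n (pi + \<phi>)) \<longlonglongrightarrow> (2 * pi - \<phi> - (pi + \<phi>)) *\<^sub>R PJ"
    unfolding V_def Gx_def PJ_def by (rule act_P_Sb_limit; use \<phi> in auto)+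
  moreover have "cis (2 * pi - \<phi>) = cis (- \<phi>)" by (simp add: complex_eq_iff cos_diff sin_diff)
  then have "V Gx n (2 * pi - \<phi>) = V Gx n (- \<phi>)" for n by (simp only: V_def)
  moreover have "(\<lambda>n. V Gi n \<phi> - V Gi n (- \<phi>)) \<longlonglongrightarrow> (\<phi> - - \<phi>) *\<^sub>R PJ"
    and "(\<lambda>n. V Gi n (pi + \<phi>) - V Gi n (pi - \<phi>)) \<longlonglongrightarrow> (pi + \<phi> - (pi - \<phi>)) *\<^sub>R PJ"
    unfolding V_def Gi_def PJ_def by (rule act_P_R_limit; use \<phi> in \<open>auto simp: DS_def\<close>)+
  ultimately have "(\<lambda>n. (V Gx n (pi - \<phi>) - V Gx n \<phi>) + (V Gx n (- \<phi>) - V Gx n (pi + \<phi>)) +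
      ((V Gi n \<phi> - V Gi n (- \<phi>)) + (V Gi n (pi + \<phi>) - V Gi n (pi - \<phi>)))) \<longlonglongrightarrow>
      (pi - \<phi> - \<phi>) *\<^sub>R PJ + (2 * pi - \<phi> - (pi + \<phi>)) *\<^sub>R PJ + ((\<phi> - - \<phi>) *\<^sub>R PJ + (pi + \<phi> - (pi - \<phi>)) *\<^sub>R PJ)"
    by (intro tendsto_add) simp_all
  \<comment> \<open>The openings of the two gaps and the two sectors add up to the full angle 2 pi,
    which the normalization of the integral cancels.\<close>
  also have "(pi - \<phi> - \<phi>) *\<^sub>R PJ + (2 * pi - \<phi> - (pi + \<phi>)) *\<^sub>R PJ + ((\<phi> - - \<phi>) *\<^sub>R PJ + (pi + \<phi> - (pi - \<phi>)) *\<^sub>R PJ) =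
      (2 * pi) *\<^sub>R PJ"
    unfolding scaleR_add_left[symmetric] by simp
  also have "(\<lambda>n. (V Gx n (pi - \<phi>) - V Gx n \<phi>) + (V Gx n (- \<phi>) - V Gx n (pi + \<phi>)) +
      ((V Gi n \<phi> - V Gi n (- \<phi>)) + (V Gi n (pi + \<phi>) - V Gi n (pi - \<phi>)))) = (\<lambda>n. quad (V Gx n) - quad (V Gi n))"
    by (simp add: quad_def fun_eq_iff algebra_simps)
  finally have lim: "(\<lambda>n. quad (V Gx n) - quad (V Gi n)) \<longlonglongrightarrow> (2 * pi) *\<^sub>R PJ" .
  have "(\<lambda>n. K n (\<lambda>z. e (E1 z))) \<longlonglongrightarrow> (1 / (2 * pi)) *\<^sub>R (((2 * pi) *\<^sub>R PJ) o\<^sub>L lmul_op (e (1 / \<i>)))"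
    unfolding K by (intro tendsto_intros bounded_linear.tendsto[OF bounded_linear_compose_right] lim)
  also have "(1 / (2 * pi)) *\<^sub>R (((2 * pi) *\<^sub>R PJ) o\<^sub>L lmul_op (e (1 / \<i>))) = PJ o\<^sub>L lmul_op (e (1 / \<i>))"
    by (simp only: linear_simps(5)[OF bounded_linear_compose_right]) simp
  also have "\<dots> = P"
    unfolding PJ_def using op.act_mult[of P "1 / \<i>" \<i>] op.act_one[of P] by simp
  finally show ?thesis using admissible_e_E1 by (simp add: has_calc_def)
qed


section \<open>The functional calculus as a limit of truncated integrals\<close>

lemma vector_derivative_e_ray:
  assumes "\<And>s. s \<in> U \<Longrightarrow> g s = e (of_real s * w)" "open U" "t \<in> U"
  shows "vector_derivative g (at t) = e w"
proof (rule vector_derivative_at, rule has_vector_derivative_transform_within_open[OF _ assms(2,3)])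
  have "((\<lambda>s. of_real s * w) has_vector_derivative w) (at t)"
    by (auto intro!: derivative_eq_intros simp: has_vector_derivative_def scaleR_conv_of_real)
  then show "((\<lambda>s. e (of_real s * w)) has_vector_derivative e w) (at t)"
    by (rule bounded_linear.has_vector_derivative[OF bounded_linear_slice_emb])
qed (use assms in auto)

text \<open>Each path is folded at t = 0 into an outward and an inward half. The resolvent bound C /
  |s| makes a multiple of |F| / t a majorant, as the truncation lemma requires.\<close>

lemma has_calc_omega:
  assumes F: "admissible F" and f: "\<And>z. z \<in> DS \<Longrightarrow> f (e z) = F z"
  shows "has_calc F (omega_calc \<phi> J T f)"
proof -
  define gg where "gg \<psi> t = Sb (polar t \<psi>) o\<^sub>L lmul_op (e (cis \<psi> / \<i>) * F (polar t \<psi>))" for \<psi> t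
  define g where "g \<sigma> t = Blinfun (\<lambda>v. S_L_inv (sect_path \<sigma> \<phi> J t) T
       (lmul (vector_derivative (sect_path \<sigma> \<phi> J) (at t) * cl_inverse J * f (sect_path \<sigma> \<phi> J t)) v))" for \<sigma> t
  \<comment> \<open>The angles of the halves t > 0 and t < 0 of a path; the factor \<sigma> = -1
    shifts both by pi.\<close>
  define \<psi>p \<psi>m :: "real \<Rightarrow> real" where "\<psi>p \<sigma> = (if \<sigma> = 1 then - \<phi> else pi - \<phi>)" and "\<psi>m \<sigma> = (if \<sigma> = 1 then \<phi> else pi + \<phi>)" for \<sigma>
  have rays: "\<psi>p \<sigma> \<in> rays" "\<psi>m \<sigma> \<in> rays" for \<sigma> by (auto simp: \<psi>p_def \<psi>m_def rays_def)
  have invJ: "cl_inverse J = e (1 / \<i>)" using cl_inverse_slice_emb[OF unit, of \<i>] by simp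
  have op_eq: "Blinfun (\<lambda>v. S_L_inv (e z) T (lmul x v)) = Sb z o\<^sub>L lmul_op x" if "z \<in> X" for z x
  proof -
    have "(\<lambda>v. S_L_inv (e z) T (lmul x v)) = blinfun_apply (Sb z o\<^sub>L lmul_op x)"
      using that by (simp add: fun_eq_iff) (simp add: S_def)
    then show ?thesis by (simp add: blinfun_apply_inverse)
  qed
  have pos: "g \<sigma> t = gg (\<psi>p \<sigma>) t" if t: "0 < t" and \<sigma>: "\<sigma> \<in> {1, - 1}" for \<sigma> t
  proof -
    have cis: "polar \<sigma> (- \<phi>) = cis (\<psi>p \<sigma>)"
      using \<sigma> by (auto simp: \<psi>p_def complex_eq_iff cos_diff sin_diff)
    have path: "sect_path \<sigma> \<phi> J s = e (polar s (\<psi>p \<sigma>))" if "0 < s" for s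
      unfolding cis[symmetric] using that by (simp add: sect_path_def cl_polar_eq_slice_emb mult_ac)
    have vd: "vector_derivative (sect_path \<sigma> \<phi> J) (at t) = e (cis (\<psi>p \<sigma>))"
      by (rule vector_derivative_e_ray[of "{0<..}"]) (use t path in auto)
    have "e (cis (\<psi>p \<sigma>)) * e (1 / \<i>) = e (cis (\<psi>p \<sigma>) / \<i>)"
      by (simp only: slice_emb_mult[OF unit, symmetric] times_divide_eq_right mult_1_right)
    then show ?thesis
      unfolding g_def vd invJ path[OF t] op_eq[OF ray_X[OF rays(1) t]] f[OF ray_DS[OF rays(1) t]] gg_def
      by simp
  qed
  \<comment> \<open>On t < 0 the modulus of t has derivative -1; the velocity changes sign and
    yields the minus signs of \<open>quad\<close>.\<close>
  have neg: "g \<sigma> (- t) = - gg (\<psi>m \<sigma>) t" if t: "0 < t" and \<sigma>: "\<sigma> \<in> {1, - 1}" for \<sigma> t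
  proof -
    have cis: "polar \<sigma> \<phi> = cis (\<psi>m \<sigma>)"
      using \<sigma> by (auto simp: \<psi>m_def complex_eq_iff cos_add sin_add)
    have path: "sect_path \<sigma> \<phi> J s = e (of_real s * - cis (\<psi>m \<sigma>))" if "s < 0" for s
      unfolding cis[symmetric] using that by (simp add: sect_path_def cl_polar_eq_slice_emb mult_ac)
    have path': "sect_path \<sigma> \<phi> J (- t) = e (polar t (\<psi>m \<sigma>))" using path[of "- t"] t by simp
    have vd: "vector_derivative (sect_path \<sigma> \<phi> J) (at (- t)) = e (- cis (\<psi>m \<sigma>))"
      by (rule vector_derivative_e_ray[of "{..<0}"]) (use t path in auto)
    have "e (- cis (\<psi>m \<sigma>)) * e (1 / \<i>) = - (e (cis (\<psi>m \<sigma>)) * e (1 / \<i>))" by simp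
    also have "e (cis (\<psi>m \<sigma>)) * e (1 / \<i>) = e (cis (\<psi>m \<sigma>) / \<i>)"
      by (simp only: slice_emb_mult[OF unit, symmetric] times_divide_eq_right mult_1_right)
    finally have "e (- cis (\<psi>m \<sigma>)) * e (1 / \<i>) = - e (cis (\<psi>m \<sigma>) / \<i>)" .
    moreover have "Sb z o\<^sub>L lmul_op (- x) = - (Sb z o\<^sub>L lmul_op x)" for z x
      by (rule linear_simps(4)[OF bounded_linear_compose_lmul_op])
    ultimately show ?thesis
      unfolding g_def vd invJ path' op_eq[OF ray_X[OF rays(2) t]] f[OF ray_DS[OF rays(2) t]] gg_def
      by simp
  qed
  have gg_cont: "continuous_on {0<..} (gg \<psi>)" if "\<psi> \<in> rays" for \<psi>
    unfolding gg_def by (rule continuous_on_integrand(2)[OF admissible_continuous[OF F] that])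
  obtain c where c: "0 < c" "\<And>z x. norm (e z * x) \<le> c * (norm z * norm x)"
    using cl.norm_act_le by metis
  obtain l where l: "0 < l" "\<And>x. norm (lmul_op x :: ('v, 'n) cl_op) \<le> norm x * l"
    using bounded_linear.pos_bounded[OF bounded_linear_lmul_op] by blast
  define M where "M = C * c * l"
  have M0: "0 \<le> M" using C_nonneg c l by (simp add: M_def)
  have gg_le: "norm (gg \<psi> t) \<le> M * (norm (F (polar t \<psi>)) / t)" if \<psi>: "\<psi> \<in> rays" and t: "0 < t" for \<psi> t
  proof -
    have "norm (gg \<psi> t) \<le> norm (Sb (polar t \<psi>)) *
        norm (lmul_op (e (cis \<psi> / \<i>) * F (polar t \<psi>)) :: ('v, 'n) cl_op)"
      unfolding gg_def by (rule norm_blinfun_compose)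
    also have "\<dots> \<le> (C / t) * (c * (1 * norm (F (polar t \<psi>))) * l)"
    proof (rule mult_mono)
      show "norm (Sb (polar t \<psi>)) \<le> C / t"
        using norm_Sb[OF ray_X[OF \<psi> t]] by (simp only: norm_ray[OF t])
      have "norm (e (cis \<psi> / \<i>) * F (polar t \<psi>)) \<le> c * (1 * norm (F (polar t \<psi>)))"
        using c(2)[of "cis \<psi> / \<i>" "F (polar t \<psi>)"] by (simp only: norm_divide norm_cis norm_ii div_by_1)
      then show "norm (lmul_op (e (cis \<psi> / \<i>) * F (polar t \<psi>)) :: ('v, 'n) cl_op)
          \<le> c * (1 * norm (F (polar t \<psi>))) * l"
        using l(1) by (intro order_trans[OF l(2)] mult_right_mono) auto
    qed (use C_nonneg t in auto)
    also have "\<dots> = M * (norm (F (polar t \<psi>)) / t)" by (simp add: M_def)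
    finally show ?thesis .
  qed
  have lim: "(\<lambda>n. integral (trunc n) (gg (\<psi>p \<sigma>)) - integral (trunc n) (gg (\<psi>m \<sigma>))) \<longlonglongrightarrow> integral UNIV (g \<sigma>)"
    if \<sigma>: "\<sigma> \<in> {1, - 1}" for \<sigma>
  proof -
    let ?n = "\<lambda>\<psi> t. norm (F (polar t \<psi>)) / t"
    have int: "set_integrable lborel {0<..} (?n \<psi>)" if "\<psi> \<in> rays" for \<psi>
      using F that by (simp add: admissible_def)
    have nonneg: "0 \<le> ?n \<psi> t" if "0 < t" for \<psi> t using that by simp
    have "(\<lambda>n. integral {1 / real (Suc n)..real (Suc n)} (\<lambda>t. g \<sigma> t + g \<sigma> (- t))) \<longlonglongrightarrow> integral UNIV (g \<sigma>)"
    proof (rule truncated_integral_tendsto[where h = "\<lambda>t. M * ?n (\<psi>p \<sigma>) t + M * ?n (\<psi>m \<sigma>) t"])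
      show "set_integrable lborel {0<..} (\<lambda>t. M * ?n (\<psi>p \<sigma>) t + M * ?n (\<psi>m \<sigma>) t)"
        by (intro set_integral_add set_integrable_mult_right int rays)
      show "continuous_on {0<..} (g \<sigma>)"
        by (rule continuous_on_eq[OF gg_cont[OF rays(1)[of \<sigma>]]]) (use pos \<sigma> in auto)
      have "continuous_on {..<0} (\<lambda>t. - gg (\<psi>m \<sigma>) (- t))"
        by (intro continuous_on_minus continuous_on_compose2[OF gg_cont[OF rays(2)[of \<sigma>]]] continuous_on_id) auto
      then show "continuous_on {..<0} (g \<sigma>)"
        by (rule continuous_on_eq) (use neg[of "- _" \<sigma>] \<sigma> in auto)
      show "norm (g \<sigma> t) \<le> M * ?n (\<psi>p \<sigma>) \<bar>t\<bar> + M * ?n (\<psi>m \<sigma>) \<bar>t\<bar>" if "t \<noteq> 0" for t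
      proof (cases "0 < t")
        case True
        show ?thesis
          using add_increasing2[OF mult_nonneg_nonneg[OF M0 nonneg[OF True, of "\<psi>m \<sigma>"]] gg_le[OF rays(1) True]]
          by (simp only: pos[OF True \<sigma>] abs_of_pos[OF True])
      next
        case False
        then have t: "0 < - t" using that by simp
        have "g \<sigma> t = - gg (\<psi>m \<sigma>) (- t)" using neg[OF t \<sigma>] by simp
        moreover have "\<bar>t\<bar> = - t" using t by simp
        ultimately show ?thesis
          using add_increasing[OF mult_nonneg_nonneg[OF M0 nonneg[OF t, of "\<psi>p \<sigma>"]] gg_le[OF rays(2) t]]
          by (simp only: norm_minus_cancel)
      qed
    qed
    moreover have "integral {1 / real (Suc n)..real (Suc n)} (\<lambda>t. g \<sigma> t + g \<sigma> (- t)) =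
        integral (trunc n) (gg (\<psi>p \<sigma>)) - integral (trunc n) (gg (\<psi>m \<sigma>))" for n
    proof -
      have "integral (trunc n) (\<lambda>t. g \<sigma> t + g \<sigma> (- t)) = integral (trunc n) (\<lambda>t. gg (\<psi>p \<sigma>) t - gg (\<psi>m \<sigma>) t)"
        by (rule integral_cong) (simp add: pos[OF trunc_pos \<sigma>] neg[OF trunc_pos \<sigma>])
      also have "\<dots> = integral (trunc n) (gg (\<psi>p \<sigma>)) - integral (trunc n) (gg (\<psi>m \<sigma>))"
        by (intro integral_diff integrable_trunc gg_cont rays)
      finally show ?thesis by (simp only: trunc_def)
    qed
    ultimately show ?thesis by (simp only:)
  qed
  have "(\<lambda>n. (1 / (2 * pi)) *\<^sub>R ((integral (trunc n) (gg (\<psi>p 1)) - integral (trunc n) (gg (\<psi>m 1))) +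
      (integral (trunc n) (gg (\<psi>p (- 1))) - integral (trunc n) (gg (\<psi>m (- 1)))))) \<longlonglongrightarrow>
      (1 / (2 * pi)) *\<^sub>R (integral UNIV (g 1) + integral UNIV (g (- 1)))"
    by (intro tendsto_intros lim) auto
  also have "(\<lambda>n. (1 / (2 * pi)) *\<^sub>R ((integral (trunc n) (gg (\<psi>p 1)) - integral (trunc n) (gg (\<psi>m 1))) +
      (integral (trunc n) (gg (\<psi>p (- 1))) - integral (trunc n) (gg (\<psi>m (- 1)))))) = (\<lambda>n. K n F)"
    unfolding K_def quad_def gg_def \<psi>p_def \<psi>m_def by (simp add: add_diff_eq)
  also have "(1 / (2 * pi)) *\<^sub>R (integral UNIV (g 1) + integral UNIV (g (- 1))) = omega_calc \<phi> J T f"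
    unfolding omega_calc_def g_def by simp
  finally show ?thesis using F by (simp add: has_calc_def)
qed

text \<open>On the slice f is f0 + J f1, and the Cauchy-Riemann equations with J^2 = -1 turn its
  real derivative into multiplication by \<open>e h\<close>. The last clause keeps the positive real
  axis, which is not one of the four rays, for the comparison of components at 0.\<close>

lemma SH_L0_admissible:
  assumes f: "f \<in> SH_L0 \<theta>" and \<theta>: "\<phi> < \<theta>"
  obtains F where "admissible F" "\<And>z. z \<in> DS \<Longrightarrow> f (e z) = F z"
    "set_integrable lborel {0<..} (\<lambda>t. norm (F (of_real t)) / t)"
proof -
  have "f \<in> SH_L (D_sect \<theta> :: 'n clifford set)" using f by (simp add: SH_L0_def)
  then obtain f0 f1 f0x f0y f1x f1y where
    C1: "C1_partials (slice_dom (D_sect \<theta> :: 'n clifford set)) f0 f0x f0y" "C1_partials (slice_dom (D_sect \<theta> :: 'n clifford set)) f1 f1x f1y"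
    and all: "\<forall>(x, y)\<in>slice_dom (D_sect \<theta> :: 'n clifford set).
        (\<forall>J\<in>imag_units. f (slice_point J x y) = f0 (x, y) + J * f1 (x, y)) \<and>
        f0 (x, - y) = f0 (x, y) \<and> f1 (x, - y) = - f1 (x, y) \<and>
        f0x (x, y) = f1y (x, y) \<and> f0y (x, y) = - f1x (x, y)"
    unfolding SH_L_def mem_Collect_eq by blast
  have rep: "f (slice_point J x y) = f0 (x, y) + J * f1 (x, y)"
    and CR: "f0x (x, y) = f1y (x, y) \<and> f0y (x, y) = - f1x (x, y)"
    if "(x, y) \<in> slice_dom (D_sect \<theta> :: 'n clifford set)" for x y
    using bspec[OF all that] unit by simp_all
  let ?U = "slice_dom (D_sect \<theta> :: 'n clifford set)" and ?c = "\<lambda>z. (Re z, Im z)"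
  have polar: "cl_polar t J' \<psi> \<in> D_sect \<theta>" if "0 < t" "J' \<in> imag_units" "\<psi> \<in> I_sect \<theta>" for t J' \<psi>
    using that by (auto simp: D_sect_def)
  have U: "?c z \<in> ?U" "e z \<in> D_sect \<theta>" if "z \<in> DS" for z
  proof -
    obtain t \<psi> where z: "z = polar t \<psi>" "0 < t" "\<psi> \<in> {- \<phi>..\<phi>} \<union> {pi - \<phi>..pi + \<phi>}"
      using \<open>z \<in> DS\<close> unfolding DS_def sector_def by blast
    have \<psi>: "\<psi> \<in> I_sect \<theta>" using z(3) \<theta> by (auto simp: I_sect_def)
    have "slice_point J' (Re z) (Im z) = cl_polar t J' \<psi>" for J' :: "'n clifford"
      by (simp add: z(1) cl_polar_eq_slice_emb) (simp add: slice_emb_def)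
    then show "?c z \<in> ?U" "e z \<in> D_sect \<theta>"
      using polar[OF z(2) _ \<psi>] unit by (auto simp: slice_dom_def slice_emb_def)
  qed
  define F where "F z = f0 (?c z) + J * f1 (?c z)" for z
  define D where "D z = f0x (?c z) + J * f1x (?c z)" for z
  have fF: "f (e z) = F z" if "z \<in> DS" for z
    using rep[OF U(1)[OF that]] by (simp add: F_def slice_emb_def)
  interpret mJ: bounded_linear "\<lambda>x. J * x" by (rule bounded_linear_mult_left_cl)
  have c': "(?c has_derivative (\<lambda>h. ?c h)) (at z within DS)" for z
    by (auto intro!: derivative_eq_intros)
  have cc: "continuous_on DS ?c" by (intro continuous_intros)
  have holo: "cl.holo_on F D DS"
    unfolding cl.holo_on_def
  proof (intro conjI ballI)
    have "continuous_on DS (\<lambda>z. f0x (?c z))" "continuous_on DS (\<lambda>z. f1x (?c z))"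
      using C1 U(1) by (auto simp: C1_partials_def intro: continuous_on_compose2[OF _ cc])
    then show "continuous_on DS D" unfolding D_def by (intro continuous_on_add mJ.continuous_on)
    fix z assume z: "z \<in> DS"
    have "(f0 has_derivative (\<lambda>(h, k). h *\<^sub>R f0x (?c z) + k *\<^sub>R f0y (?c z))) (at (?c z))"
      "(f1 has_derivative (\<lambda>(h, k). h *\<^sub>R f1x (?c z) + k *\<^sub>R f1y (?c z))) (at (?c z))"
      using C1 U(1)[OF z] by (auto simp: C1_partials_def)
    note d = this[THEN has_derivative_compose[OF c'], simplified]
    have "J * J = - 1" by (rule imag_unit_square[OF unit])
    then have "(\<lambda>h. (Re h *\<^sub>R f0x (?c z) + Im h *\<^sub>R f0y (?c z)) + J * (Re h *\<^sub>R f1x (?c z) + Im h *\<^sub>R f1y (?c z))) =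
        (\<lambda>h. e h * D z)"
      using CR[OF U(1)[OF z]]
      by (simp add: fun_eq_iff slice_emb_def slice_point_def D_def algebra_simps of_real_def mult.assoc[symmetric])
    then show "(F has_derivative (\<lambda>h. e h * D z)) (at z within DS)"
      using has_derivative_add[OF d(1) mJ.has_derivative[OF d(2)]] unfolding F_def by simp
  qed
  have int: "set_integrable lborel {0<..} (\<lambda>t. norm (F (polar t \<psi>)) / t)"
    if "\<psi> \<in> I_sect \<theta>" "\<And>t. 0 < t \<Longrightarrow> polar t \<psi> \<in> DS" for \<psi>
  proof -
    have "set_integrable lborel {0<..} (\<lambda>t. norm (f (cl_polar t J \<psi>)) / t)"
      using f unit that by (simp add: SH_L0_def)
    then show ?thesis
      by (subst set_integrable_cong[OF refl refl]) (use fF that in \<open>auto simp: cl_polar_eq_slice_emb\<close>)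
  qed
  have "admissible F"
    unfolding admissible_def
  proof (intro conjI ballI)
    show "\<exists>D. cl.holo_on F D DS" using holo by blast
    have "bounded (f ` D_sect \<theta>)" using f by (simp add: SH_L0_def)
    then obtain M where "\<And>s. s \<in> D_sect \<theta> \<Longrightarrow> norm (f s) \<le> M" by (auto simp: bounded_iff)
    then show "\<exists>M. \<forall>z\<in>DS. norm (F z) \<le> M" using U(2) fF by metis
    fix \<psi> assume \<psi>: "\<psi> \<in> rays"
    show "set_integrable lborel {0<..} (\<lambda>t. norm (F (polar t \<psi>)) / t)"
      by (rule int) (use \<psi> \<theta> \<phi> in \<open>auto simp: I_sect_def rays_def intro: ray_DS\<close>)
  qed
  moreover have "of_real t * cis 0 \<in> DS" if "0 < t" for t
    unfolding DS_def using \<phi> that by (intro UnI1 sectorI) auto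
  then have "set_integrable lborel {0<..} (\<lambda>t. norm (F (of_real t)) / t)"
    using int[of 0] \<theta> \<phi> by (auto simp: I_sect_def)
  ultimately show thesis using that fF by blast
qed

end

section \<open>The product rule for polynomials\<close>

text \<open>A nonzero limit c would force |g| to exceed a positive multiple of 1/t near 0, whose
  integral diverges logarithmically.\<close>

lemma tendsto_zero_of_integrable_over_t:
  fixes h :: "real \<Rightarrow> 'b::real_normed_vector" and g :: "real \<Rightarrow> real"
  assumes lim: "(h \<longlongrightarrow> c) (at_right 0)" and g: "set_integrable lborel {0<..} g"
    and le: "\<And>t. 0 < t \<Longrightarrow> t \<le> 1 \<Longrightarrow> norm (h t) / t \<le> g t"
  shows "c = 0"
proof (rule ccontr)
  assume "c \<noteq> 0"
  define \<delta> where "\<delta> = norm c / 2"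
  have \<delta>: "0 < \<delta>" "\<delta> < norm c" using \<open>c \<noteq> 0\<close> by (auto simp: \<delta>_def)
  have "\<forall>\<^sub>F t in at_right 0. \<delta> < norm (h t)"
    using order_tendstoD(1)[OF tendsto_norm[OF lim] \<delta>(2)] .
  then obtain d where d: "0 < d" "\<And>t. 0 < t \<Longrightarrow> t < d \<Longrightarrow> \<delta> < norm (h t)"
    unfolding eventually_at_right_field by auto
  define b where "b = min 1 (d / 2)"
  have b: "0 < b" "b \<le> 1" "b < d" using d(1) by (auto simp: b_def)
  define I where "I = integral {0<..} (\<lambda>t. \<bar>g t\<bar>)"
  have gi: "set_integrable lborel {0<..} (\<lambda>t. \<bar>g t\<bar>)" by (rule set_integrable_abs[OF g])
  \<comment> \<open>Chosen so that the integral of \<delta> / t over {a..b} is I + \<delta>, more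
    than the total integral I.\<close>
  define a where "a = b * exp (- (I / \<delta> + 1))"
  have I0: "0 \<le> I"
    unfolding I_def using set_borel_integral_eq_integral(1)[OF gi] by (rule integral_nonneg) auto
  have "0 \<le> I / \<delta>" using \<delta>(1) I0 by simp
  then have a: "0 < a" "a \<le> b" using b(1) by (auto simp: a_def intro!: mult_left_le)
  have "((\<lambda>t. \<delta> / t) has_integral (\<delta> * ln b - \<delta> * ln a)) {a..b}"
    using a by (intro fundamental_theorem_of_calculus)
      (auto intro!: derivative_eq_intros simp: has_real_derivative_iff_has_vector_derivative[symmetric])
  moreover have "\<delta> / t \<le> \<bar>g t\<bar>" if "t \<in> {a..b}" for t
  proof -
    have t: "0 < t" "t \<le> 1" "t < d" using that a b by auto
    have "\<delta> / t \<le> norm (h t) / t" using d(2)[OF t(1,3)] t(1) by (intro divide_right_mono) auto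
    then show ?thesis using le[OF t(1,2)] by linarith
  qed
  moreover have ab: "(\<lambda>t. \<bar>g t\<bar>) integrable_on {a..b}"
    by (rule set_borel_integral_eq_integral(1)[OF set_integrable_subset[OF gi]]) (use a in auto)
  ultimately have "\<delta> * ln b - \<delta> * ln a \<le> integral {a..b} (\<lambda>t. \<bar>g t\<bar>)"
    by (intro has_integral_le[OF _ integrable_integral]) auto
  also have "\<dots> \<le> I"
    unfolding I_def by (rule integral_subset_le[OF _ ab set_borel_integral_eq_integral(1)[OF gi]]) (use a in auto)
  finally have "\<delta> * ln b - \<delta> * ln a \<le> I" .
  moreover have "ln a = ln b - (I / \<delta> + 1)" using b(1) by (simp add: a_def ln_mult)
  ultimately show False using \<delta>(1) by (simp add: algebra_simps)
qed

lemma sum_atMost_split_0: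
  fixes h :: "nat \<Rightarrow> 'b::comm_monoid_add"
  shows "(\<Sum>j\<le>m. h j) = h 0 + (\<Sum>j=1..m. h j)"
  by (simp add: atMost_atLeast0 sum.atLeast_Suc_atMost)

context sector_calculus
begin

section \<open>Monomials in the two rational functions\<close>

lemma has_calc_zero: "has_calc (\<lambda>_. 0) 0"
  using has_calc_mult_right[OF has_calc_e_E1, of 0]
  by (simp add: linear_simps[OF bounded_linear_compose_lmul_op])

lemma has_calc_sum:
  assumes "finite I" "\<And>i. i \<in> I \<Longrightarrow> has_calc (F i) (B i)"
  shows "has_calc (\<lambda>z. \<Sum>i\<in>I. F i z) (\<Sum>i\<in>I. B i)"
  using assms
proof (induction I rule: finite_induct)
  case empty
  show ?case by (simp add: has_calc_zero)
next
  case (insert i I)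
  then show ?case using has_calc_add[of "F i" "B i" "\<lambda>z. \<Sum>i\<in>I. F i z"] by simp
qed

text \<open>P^j R^l, the operator belonging to the scalar function \<open>cE j l\<close>.\<close>

definition PR :: "nat \<Rightarrow> nat \<Rightarrow> ('v, 'n) cl_op" where
  "PR j l = ((\<lambda>B. P o\<^sub>L B) ^^ j) (((\<lambda>B. R o\<^sub>L B) ^^ l) id_blinfun)"

lemma PR_0_0: "PR 0 0 = id_blinfun"
  and PR_0_Suc: "PR 0 (Suc l) = R o\<^sub>L PR 0 l"
  and PR_Suc: "PR (Suc j) l = P o\<^sub>L PR j l"
  by (simp_all add: PR_def)

lemma PR_apply: "PR j l v = (TA \<i> ^^ j) ((A \<i> ^^ l) v)"
proof (induction j)
  case 0
  show ?case by (induction l) (simp_all add: PR_0_0 PR_0_Suc)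
qed (simp add: PR_Suc)

lemma PR_A: "PR j l (A \<i> x) = PR j (Suc l) x"
  by (simp add: PR_apply funpow_swap1)

lemma PR_TA: "PR j l (TA \<i> x) = PR (Suc j) l x"
proof -
  have "(A \<i> ^^ l) (TA \<i> x) = TA \<i> ((A \<i> ^^ l) x)"
    by (induction l) (simp_all add: A_TA_commute[OF X_resolvent[OF X_i]])
  then show ?thesis by (simp add: PR_apply funpow_swap1)
qed

text \<open>R = R^2 + P^2, the operator form of \<open>E0\<close> = \<open>E0\<close>^2 +
  \<open>E1\<close>^2, on which \<open>cE_split\<close> rests.\<close>

lemma PR_split: "PR j (Suc l) x = PR j (Suc (Suc l)) x + PR (Suc (Suc j)) l x"
proof -
  interpret A: bounded_linear "A \<i>" by (rule bounded_linear_A[OF X_resolvent[OF X_i]])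
  have "A \<i> x = A \<i> (A \<i> x) + TA \<i> (TA \<i> x)"
    using A_commute[OF X_resolvent[OF X_i] T_TA_i[of x]] by (simp add: A.diff algebra_simps)
  then have "PR j l (A \<i> x) = PR j l (A \<i> (A \<i> x)) + PR j l (TA \<i> (TA \<i> x))"
    by (metis blinfun.add_right)
  then show ?thesis by (simp only: PR_A PR_TA)
qed

definition cE :: "nat \<Rightarrow> nat \<Rightarrow> complex \<Rightarrow> 'n clifford" where
  "cE j l z = e (E1 z ^ j * E0 z ^ l)"

lemma has_calc_PR:
  assumes "has_calc F B"
  shows "has_calc (\<lambda>z. cE j l z * F z) (PR j l o\<^sub>L B)"
proof (induction j)
  case 0
  show ?case
  proof (induction l)
    case 0
    have "id_blinfun o\<^sub>L B = B" by (rule blinfun_eqI) simp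
    then show ?case using assms by (simp add: cE_def PR_0_0)
  next
    case (Suc l)
    have "cE 0 (Suc l) z * F z = e (E0 z) * (cE 0 l z * F z)" for z
      by (simp add: cE_def slice_emb_mult[OF unit] mult.assoc)
    then show ?case using has_calc_E0[OF Suc] by (simp add: PR_0_Suc compose_assoc)
  qed
next
  case (Suc j)
  have "cE (Suc j) l z * F z = e (E1 z) * (cE j l z * F z)" for z
    by (simp add: cE_def slice_emb_mult[OF unit] mult.assoc)
  then show ?case using has_calc_E1[OF Suc] by (simp add: PR_Suc compose_assoc)
qed

text \<open>One factor \<open>E1\<close> supplies the known value P and the others are added by the
  product rule, hence the positive first index.\<close>

lemma has_calc_cE: "has_calc (\<lambda>z. cE (Suc j) l z * c) (PR (Suc j) l o\<^sub>L lmul_op c)"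
proof -
  have "cE j l z * e (E1 z) = cE (Suc j) l z" for z
    by (simp add: cE_def mult_ac flip: slice_emb_mult[OF unit])
  moreover have "PR j l o\<^sub>L P = PR (Suc j) l" by (rule blinfun_eqI) (simp add: PR_TA)
  ultimately show ?thesis using has_calc_mult_right[OF has_calc_PR[OF has_calc_e_E1, of j l], of c] by simp
qed

lemma cE_split:
  assumes "z \<in> DS"
  shows "cE j (Suc l) z = cE j (Suc (Suc l)) z + cE (Suc (Suc j)) l z"
proof -
  have "E0 z = E0 z * E0 z + E1 z * E1 z"
  proof -
    define w where "w = 1 + z\<^sup>2"
    have "1 / w * (1 / w) + z / w * (z / w) = w / (w * w)"
      by (simp add: w_def power2_eq_square flip: add_divide_distrib)
    also have "\<dots> = 1 / w" using one_plus_square_nz[OF assms] by (simp add: w_def)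
    finally show ?thesis by (simp add: E0_def E1_def w_def)
  qed
  from arg_cong[OF this, of "\<lambda>w. E1 z ^ j * E0 z ^ l * w"]
  have "E1 z ^ j * E0 z ^ Suc l = E1 z ^ j * E0 z ^ Suc (Suc l) + E1 z ^ Suc (Suc j) * E0 z ^ l"
    by (simp add: algebra_simps)
  then show ?thesis by (simp only: cE_def slice_emb_simps(4)[symmetric])
qed

lemma bnd_rest_slice:
  assumes "z \<in> DS"
  shows "bnd_rest f f0 finf (e z) = f (e z) - (finf + e (E0 z) * (f0 - finf))"
proof -
  have "1 + (e z)\<^sup>2 = e (1 + z\<^sup>2)" by (simp add: slice_emb_power[OF unit])
  then show ?thesis
    using cl_inverse_slice_emb[OF unit one_plus_square_nz[OF assms]] by (simp add: bnd_rest_def E0_def del: slice_emb_simps(4))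
qed

text \<open>As z \<open>E0\<close> z = \<open>E1\<close> z, each power of z turns one factor
  \<open>E0\<close> into \<open>E1\<close>; there are enough of them because the degree is at most
  l.\<close>

lemma sum_cE:
  fixes p :: "real poly"
  assumes "degree p \<le> l"
  shows "(\<Sum>j\<le>degree p. coeff p j *\<^sub>R cE j (l - j) z) = e (E0 z ^ l) * e (poly (map_poly of_real p) z)"
proof -
  have sum: "e (sum h I) = (\<Sum>i\<in>I. e (h i))" for h :: "nat \<Rightarrow> complex" and I
    by (induction I rule: infinite_finite_induct) auto
  have pz: "poly (map_poly of_real p) z = (\<Sum>j\<le>degree p. coeff p j *\<^sub>R z ^ j)"
    by (simp add: poly_altdef degree_map_poly coeff_map_poly scaleR_conv_of_real)
  have "cE j (l - j) z = e (E0 z ^ l) * e (z ^ j)" if "j \<le> degree p" for j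
  proof -
    have "E0 z ^ l = E0 z ^ j * E0 z ^ (l - j)" using that assms by (simp flip: power_add)
    moreover have "E1 z = z * E0 z" by (simp add: E0_def E1_def)
    ultimately have "E1 z ^ j * E0 z ^ (l - j) = E0 z ^ l * z ^ j" by (simp add: power_mult_distrib mult_ac)
    then show ?thesis by (simp only: cE_def slice_emb_mult[OF unit])
  qed
  then show ?thesis by (simp add: pz sum sum_distrib_left)
qed

text \<open>Along the positive real axis the right-hand side is continuous up to 0 with value g0 -
  p_0 f0. By the left-hand side it is integrable against dt/t near 0, so this value
  vanishes.\<close>

lemma component_at_0:
  fixes p :: "real poly" and F G :: "complex \<Rightarrow> 'n clifford"
  assumes F: "set_integrable lborel {0<..} (\<lambda>t. norm (F (of_real t)) / t)"
    and G: "set_integrable lborel {0<..} (\<lambda>t. norm (G (of_real t)) / t)"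
    and eq: "\<And>z. z \<in> DS \<Longrightarrow> e (poly (map_poly of_real p) z) * F z - G z =
      ginf + e (E0 z) * (g0 - ginf) - e (poly (map_poly of_real p) z) * (finf + e (E0 z) * (f0 - finf))"
  shows "g0 = coeff p 0 *\<^sub>R f0"
proof -
  let ?p = "\<lambda>z. poly (map_poly of_real p) z :: complex"
  define h where "h t = ginf + e (E0 (of_real t)) * (g0 - ginf) -
    e (?p (of_real t)) * (finf + e (E0 (of_real t)) * (f0 - finf))" for t :: real
  have nz: "1 + (of_real t)\<^sup>2 \<noteq> (0 :: complex)" for t :: real
  proof -
    have "0 < 1 + t\<^sup>2" by (simp add: add_pos_nonneg)
    then have "of_real (1 + t\<^sup>2) \<noteq> (0 :: complex)" by (simp only: of_real_eq_0_iff)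
    then show ?thesis by (simp only: of_real_add of_real_1 of_real_power not_False_eq_True)
  qed
  have cE0: "continuous_on UNIV (\<lambda>t :: real. E0 (of_real t))"
    unfolding E0_def
    by (rule continuous_on_divide, (intro continuous_intros)+) (simp only: nz not_False_eq_True ball_simps simp_thms)
  have cp: "continuous_on UNIV (\<lambda>t :: real. ?p (of_real t))"
    by (rule continuous_on_poly) (intro continuous_intros)
  note mult = bounded_bilinear.continuous_on[OF bounded_bilinear_clifford_mult]
  note ce = bounded_linear.continuous_on[OF bounded_linear_slice_emb]
  have ch: "continuous_on UNIV (\<lambda>t. a + e (E0 (of_real t)) * b)" for a b
    by (rule continuous_on_add[OF continuous_on_const mult[OF ce[OF cE0] continuous_on_const]])
  have "continuous_on UNIV h"
    unfolding h_def by (rule continuous_on_diff[OF ch mult[OF ce[OF cp] ch]])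
  then have "(h \<longlongrightarrow> h 0) (at 0)" unfolding continuous_on_def by blast
  then have lim: "(h \<longlongrightarrow> h 0) (at_right 0)" by (rule tendsto_mono[OF at_le[OF subset_UNIV]])
  obtain c where c: "0 < c" "\<And>z x. norm (e z * x) \<le> c * (norm z * norm x)"
    using cl.norm_act_le by metis
  \<comment> \<open>Only t <= 1 matters for the limit at 0, so growth of the polynomial along the
    ray is harmless.\<close>
  have "bounded ((\<lambda>t :: real. ?p (of_real t)) ` {0..1})"
    by (rule compact_imp_bounded[OF compact_continuous_image[OF continuous_on_subset[OF cp subset_UNIV] compact_Icc]])
  then obtain M where M0: "0 < M" "\<forall>w\<in>(\<lambda>t :: real. ?p (of_real t)) ` {0..1}. norm w \<le> M"
    unfolding bounded_pos by (elim exE conjE) (rule that)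
  have M: "norm (?p (of_real t)) \<le> M" if "t \<in> {0..1}" for t :: real
    by (rule bspec[OF M0(2) imageI[OF that]])
  have "h 0 = 0"
  proof (rule tendsto_zero_of_integrable_over_t[OF lim])
    show "set_integrable lborel {0<..} (\<lambda>t. c * M * (norm (F (of_real t)) / t) + norm (G (of_real t)) / t)"
      by (intro set_integral_add set_integrable_mult_right F G)
    fix t :: real assume t: "0 < t" "t \<le> 1"
    have DS: "of_real t \<in> DS"
      unfolding DS_def using sectorI[of t "- \<phi>" 0 \<phi>] \<phi> t by simp
    have "h t = e (?p (of_real t)) * F (of_real t) - G (of_real t)" using eq[OF DS] by (simp add: h_def)
    then have "norm (h t) \<le> norm (e (?p (of_real t)) * F (of_real t)) + norm (G (of_real t))"
      using norm_triangle_ineq4 by simp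
    also have "norm (e (?p (of_real t)) * F (of_real t)) \<le> c * (M * norm (F (of_real t)))"
      using c(1) M[of t] t by (intro order_trans[OF c(2)] mult_left_mono mult_right_mono) auto
    finally have "norm (h t) \<le> c * (M * norm (F (of_real t))) + norm (G (of_real t))" by simp
    from divide_right_mono[OF this, of t] t
    show "norm (h t) / t \<le> c * M * (norm (F (of_real t)) / t) + norm (G (of_real t)) / t"
      by (simp add: add_divide_distrib mult.assoc)
  qed
  moreover have "?p 0 = of_real (coeff p 0)" by (simp add: poly_0_coeff_0 coeff_map_poly)
  ultimately show ?thesis
    by (simp add: h_def E0_def scaleR_conv_of_real)
qed

lemma ext_calc_eq:
  assumes "bnd_components \<theta> f = (f0, finf)"
  shows "ext_calc \<theta> \<phi> J T f v = lmul finf v + A \<i> (lmul (f0 - finf) v) + omega_calc \<phi> J T (bnd_rest f f0 finf) v"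
  using assms Q_op_e[of \<i>] by (simp add: ext_calc_def A_def)

lemma bnd_components_SH_L0:
  assumes "f \<in> SH_Lbnd \<theta>" "bnd_components \<theta> f = (f0, finf)"
  shows "bnd_rest f f0 finf \<in> SH_L0 \<theta>"
proof -
  have "\<exists>x. case x of (f0, finf) \<Rightarrow> bnd_rest f f0 finf \<in> SH_L0 \<theta>"
    using assms(1) by (auto simp: SH_Lbnd_def)
  from someI_ex[OF this] show ?thesis using assms(2) by (simp add: bnd_components_def)
qed

text \<open>Both sides are multiplied by \<open>(1 + T\<^sup>2)\<^bsup>-m-1\<^esup>\<close>; then only products with bounded rational functions
  remain. The difference of the two decomposed functions is a rational function that vanishes at \<open>0\<close>
  because \<open>g\<^sub>0 = p\<^sub>0 f\<^sub>0\<close>, hence it is a combination of the functions \<open>cE j l\<close> with \<open>j > 0\<close>.\<close>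

theorem op_poly_ext_calc:
  assumes f: "f \<in> SH_Lbnd \<theta>" and g: "(\<lambda>s. cl_poly p s * f s) \<in> SH_Lbnd \<theta>"
    and \<theta>: "\<phi> < \<theta>" and p: "p \<noteq> 0"
  shows "op_poly p T (ext_calc \<theta> \<phi> J T f v) = Some (ext_calc \<theta> \<phi> J T (\<lambda>s. cl_poly p s * f s) v)"
proof -
  define g where "g s = cl_poly p s * f s" for s
  obtain f0 finf g0 ginf where comp: "bnd_components \<theta> f = (f0, finf)" "bnd_components \<theta> g = (g0, ginf)"
    by (metis prod.exhaust)
  have g': "g \<in> SH_Lbnd \<theta>" using g unfolding g_def .
  define a b where "a = f0 - finf" and "b = g0 - ginf"
  define Bf Bg where "Bf = omega_calc \<phi> J T (bnd_rest f f0 finf)" and "Bg = omega_calc \<phi> J T (bnd_rest g g0 ginf)"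
  obtain F where F: "admissible F" "\<And>z. z \<in> DS \<Longrightarrow> bnd_rest f f0 finf (e z) = F z"
      "set_integrable lborel {0<..} (\<lambda>t. norm (F (of_real t)) / t)"
    by (rule SH_L0_admissible[OF bnd_components_SH_L0[OF f comp(1)] \<theta>]) (rule that)
  obtain G where G: "admissible G" "\<And>z. z \<in> DS \<Longrightarrow> bnd_rest g g0 ginf (e z) = G z"
      "set_integrable lborel {0<..} (\<lambda>t. norm (G (of_real t)) / t)"
    by (rule SH_L0_admissible[OF bnd_components_SH_L0[OF g' comp(2)] \<theta>]) (rule that)
  have calcF: "has_calc F Bf" and calcG: "has_calc G Bg"
    unfolding Bf_def Bg_def using has_calc_omega F(1,2) G(1,2) by blast+
  define pz where "pz z = poly (map_poly of_real p) z" for z :: complex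
  have rel: "e (pz z) * F z - G z = ginf + e (E0 z) * b - e (pz z) * (finf + e (E0 z) * a)" if "z \<in> DS" for z
  proof -
    have 1: "F z = f (e z) - (finf + e (E0 z) * a)"
      using F(2)[OF that] by (simp only: bnd_rest_slice[OF that] a_def)
    have 2: "G z = e (pz z) * f (e z) - (ginf + e (E0 z) * b)"
      using G(2)[OF that] by (simp only: bnd_rest_slice[OF that] b_def g_def cl_poly_slice_emb[OF unit] pz_def)
    show ?thesis unfolding 1 2 by (simp add: algebra_simps)
  qed
  have p0: "g0 = coeff p 0 *\<^sub>R f0"
    by (rule component_at_0[OF F(3) G(3)]) (use rel in \<open>simp add: pz_def a_def b_def\<close>)
  define m where "m = degree p"
  let ?c = "coeff p"
  \<comment> \<open>By \<open>sum_cE\<close> this is E0^(m+1) p F at z; every exponent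
    \<open>Suc m - j\<close> of \<open>E0\<close> is positive and admits the splitting.\<close>
  define L where "L z = (\<Sum>j\<le>m. ?c j *\<^sub>R (cE j (Suc m - j) z * F z))" for z
  \<comment> \<open>What \<open>L\<close> contains besides \<open>cE 0 (Suc m) z * G z\<close>,
    after splitting one \<open>E0\<close> in the terms with ginf and finf. The multiples of
    \<open>cE 0 (Suc (Suc m)) z\<close> cancel by \<open>p0\<close>, so every remaining monomial
    contains \<open>E1\<close>.\<close>
  define H where "H z = cE 2 m z * ginf + ((\<Sum>j\<le>m. (- ?c j) *\<^sub>R (cE (Suc (Suc j)) (m - j) z * finf)) +
    (\<Sum>j=1..m. (- ?c j) *\<^sub>R (cE j (Suc (Suc m) - j) z * f0)))" for z
  define BH where "BH = (PR 2 m o\<^sub>L lmul_op ginf) + ((\<Sum>j\<le>m. (- ?c j) *\<^sub>R (PR (Suc (Suc j)) (m - j) o\<^sub>L lmul_op finf)) +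
    (\<Sum>j=1..m. (- ?c j) *\<^sub>R (PR j (Suc (Suc m) - j) o\<^sub>L lmul_op f0)))"
  have calcL: "has_calc L (\<Sum>j\<le>m. ?c j *\<^sub>R (PR j (Suc m - j) o\<^sub>L Bf))"
    unfolding L_def by (intro has_calc_sum has_calc_scaleR has_calc_PR calcF) simp
  have calcR: "has_calc (\<lambda>z. cE 0 (Suc m) z * G z + H z) ((PR 0 (Suc m) o\<^sub>L Bg) + BH)"
  proof -
    have cE': "has_calc (\<lambda>z. cE j l z * c) (PR j l o\<^sub>L lmul_op c)" if "1 \<le> j" for j l c
      using has_calc_cE[of "j - 1" l c] that by simp
    show ?thesis
      unfolding H_def BH_def
      by (intro has_calc_add has_calc_PR[OF calcG] has_calc_sum has_calc_scaleR cE') auto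
  qed
  have LR: "L z = cE 0 (Suc m) z * G z + H z" if z: "z \<in> DS" for z
  proof -
    have split: "cE j (Suc m - j) z = cE j (Suc (Suc m) - j) z + cE (Suc (Suc j)) (m - j) z" if "j \<le> m" for j
      using cE_split[OF z, of j "m - j"] that by (simp add: Suc_diff_le)
    have s1: "(\<Sum>j\<le>m. ?c j *\<^sub>R cE j (Suc m - j) z) = e (E0 z ^ Suc m) * e (pz z)"
      "(\<Sum>j\<le>m. ?c j *\<^sub>R cE j (Suc (Suc m) - j) z) = e (E0 z ^ Suc (Suc m)) * e (pz z)"
      unfolding m_def pz_def by (rule sum_cE; simp)+
    have e0: "cE 0 l z = e (E0 z ^ l)" for l by (simp add: cE_def)
    have comm: "e (E0 z ^ Suc m) * (e (pz z) * (e (E0 z) * a)) = (e (E0 z ^ Suc (Suc m)) * e (pz z)) * a"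
      "e (E0 z ^ Suc m) * (e (E0 z) * b) = e (E0 z ^ Suc (Suc m)) * b"
      by (simp_all only: mult.assoc[symmetric] slice_emb_mult[OF unit, symmetric]) (simp_all add: mult_ac)
    have "L z = (e (E0 z ^ Suc m) * e (pz z)) * F z"
      unfolding L_def s1(1)[symmetric] by (simp add: sum_distrib_right)
    then have "L z - cE 0 (Suc m) z * G z = e (E0 z ^ Suc m) * (e (pz z) * F z - G z)"
      by (simp add: e0 mult.assoc right_diff_distrib del: power_Suc)
    also have "\<dots> = e (E0 z ^ Suc m) * ginf + e (E0 z ^ Suc (Suc m)) * b -
        (e (E0 z ^ Suc m) * e (pz z)) * finf - (e (E0 z ^ Suc (Suc m)) * e (pz z)) * a"
      unfolding rel[OF z] by (simp only: distrib_left right_diff_distrib comm) (simp add: mult.assoc del: power_Suc)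
    also have "e (E0 z ^ Suc m) * e (pz z) = e (E0 z ^ Suc (Suc m)) * e (pz z) +
        (\<Sum>j\<le>m. ?c j *\<^sub>R cE (Suc (Suc j)) (m - j) z)"
      unfolding s1[symmetric] sum.distrib[symmetric] by (rule sum.cong) (simp_all only: atMost_iff split scaleR_add_right)
    also have "e (E0 z ^ Suc m) = cE 0 (Suc (Suc m)) z + cE 2 m z"
      using split[of 0] by (simp add: e0 numeral_2_eq_2 del: power_Suc)
    also have "(cE 0 (Suc (Suc m)) z + cE 2 m z) * ginf + e (E0 z ^ Suc (Suc m)) * b -
        (e (E0 z ^ Suc (Suc m)) * e (pz z) + (\<Sum>j\<le>m. ?c j *\<^sub>R cE (Suc (Suc j)) (m - j) z)) * finf -
        (e (E0 z ^ Suc (Suc m)) * e (pz z)) * a =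
        cE 0 (Suc (Suc m)) z * g0 + cE 2 m z * ginf - (e (E0 z ^ Suc (Suc m)) * e (pz z)) * f0 -
        (\<Sum>j\<le>m. ?c j *\<^sub>R (cE (Suc (Suc j)) (m - j) z * finf))"
    proof -
      have "(x + y) * ginf + x * (g0 - ginf) - (w + s) * finf - w * (f0 - finf) =
          x * g0 + y * ginf - w * f0 - s * finf" for x y w s :: "'n clifford"
        by (simp add: algebra_simps)
      then show ?thesis unfolding a_def b_def e0 by (simp only: sum_distrib_right mult_scaleR_left)
    qed
    also have "(e (E0 z ^ Suc (Suc m)) * e (pz z)) * f0 =
        cE 0 (Suc (Suc m)) z * g0 + (\<Sum>j=1..m. ?c j *\<^sub>R (cE j (Suc (Suc m) - j) z * f0))"
    proof -
      have "(\<Sum>j\<le>m. ?c j *\<^sub>R cE j (Suc (Suc m) - j) z) * f0 =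
          (\<Sum>j\<le>m. ?c j *\<^sub>R (cE j (Suc (Suc m) - j) z * f0))"
        by (simp only: sum_distrib_right mult_scaleR_left)
      also have "\<dots> = cE 0 (Suc (Suc m)) z * g0 + (\<Sum>j=1..m. ?c j *\<^sub>R (cE j (Suc (Suc m) - j) z * f0))"
        unfolding sum_atMost_split_0 p0 by (simp only: mult_scaleR_right diff_zero)
      finally show ?thesis unfolding s1(2) .
    qed
    finally have "L z - cE 0 (Suc m) z * G z = cE 2 m z * ginf -
        (\<Sum>j=1..m. ?c j *\<^sub>R (cE j (Suc (Suc m) - j) z * f0)) -
        (\<Sum>j\<le>m. ?c j *\<^sub>R (cE (Suc (Suc j)) (m - j) z * finf))" by simp
    also have "\<dots> = H z" by (simp add: H_def sum_negf)
    finally show ?thesis by (simp only: diff_eq_eq add.commute)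
  qed
  \<comment> \<open>One function with two computed values: limits are unique.\<close>
  have "(\<Sum>j\<le>m. ?c j *\<^sub>R (PR j (Suc m - j) o\<^sub>L Bf)) = (PR 0 (Suc m) o\<^sub>L Bg) + BH"
    by (rule has_calc_unique[OF calcL has_calc_cong[OF calcR LR]])
  from arg_cong[OF this, of "\<lambda>B. blinfun_apply B v"]
  have key: "(\<Sum>j\<le>m. ?c j *\<^sub>R PR j (Suc m - j) (Bf v)) = PR 0 (Suc m) (Bg v) + (PR 2 m (lmul ginf v) +
      ((\<Sum>j\<le>m. (- ?c j) *\<^sub>R PR (Suc (Suc j)) (m - j) (lmul finf v)) +
       (\<Sum>j=1..m. (- ?c j) *\<^sub>R PR j (Suc (Suc m) - j) (lmul f0 v))))"
    by (simp only: BH_def blinfun.add_left blinfun.sum_left blinfun.scaleR_left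
        blinfun_apply_blinfun_compose lmul_op_apply)
  define w u where "w = ext_calc \<theta> \<phi> J T f v" and "u = ext_calc \<theta> \<phi> J T g v"
  have w: "w = lmul finf v + A \<i> (lmul a v) + Bf v" and u: "u = lmul ginf v + A \<i> (lmul b v) + Bg v"
    unfolding w_def u_def a_def b_def Bf_def Bg_def by (rule ext_calc_eq[OF comp(1)] ext_calc_eq[OF comp(2)])+
  have split: "PR j (Suc m - j) x = PR j (Suc (Suc m) - j) x + PR (Suc (Suc j)) (m - j) x" if "j \<le> m" for j x
    using PR_split[of j "m - j" x] that by (simp add: Suc_diff_le)
  have PRA: "PR j (Suc m - j) (A \<i> x) = PR j (Suc (Suc m) - j) x" if "j \<le> m" for j x
    using that by (simp add: PR_A Suc_diff_le)
  have f0v: "lmul finf v + lmul a v = lmul f0 v" and g0v: "lmul ginf v + lmul b v = lmul g0 v"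
    by (simp_all add: a_def b_def flip: lmul.add_left)
  \<comment> \<open>The scalar computation is repeated for operators: \<open>A \<i>\<close> raises
    the power of R by one, and \<open>PR_split\<close> treats the multiples of finf and
    ginf.\<close>
  have "(\<Sum>j\<le>m. ?c j *\<^sub>R PR j (Suc m - j) w) =
      (\<Sum>j\<le>m. ?c j *\<^sub>R PR j (Suc (Suc m) - j) (lmul f0 v)) +
      (\<Sum>j\<le>m. ?c j *\<^sub>R PR (Suc (Suc j)) (m - j) (lmul finf v)) + (\<Sum>j\<le>m. ?c j *\<^sub>R PR j (Suc m - j) (Bf v))"
    unfolding sum.distrib[symmetric] f0v[symmetric]
  proof (rule sum.cong[OF refl])
    fix j assume "j \<in> {..m}"
    then have j: "j \<le> m" by simp
    show "?c j *\<^sub>R PR j (Suc m - j) w = ?c j *\<^sub>R PR j (Suc (Suc m) - j) (lmul finf v + lmul a v) +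
      ?c j *\<^sub>R PR (Suc (Suc j)) (m - j) (lmul finf v) + ?c j *\<^sub>R PR j (Suc m - j) (Bf v)"
      unfolding w blinfun.add_right PRA[OF j] split[OF j, of "lmul finf v"] by (simp add: scaleR_add_right)
  qed
  also have "\<dots> = PR 0 (Suc (Suc m)) (lmul g0 v) + PR 0 (Suc m) (Bg v) + PR 2 m (lmul ginf v)"
    unfolding key sum_atMost_split_0[of "\<lambda>j. ?c j *\<^sub>R PR j (Suc (Suc m) - j) (lmul f0 v)"]
    by (simp add: p0 sum_negf lmul.scaleR_left blinfun.scaleR_right)
  also have "\<dots> = PR 0 (Suc m) u"
    unfolding u blinfun.add_right g0v[symmetric] PR_A
    using split[of 0 "lmul ginf v"] by (simp add: numeral_2_eq_2)
  finally have eq: "(\<Sum>j\<le>m. ?c j *\<^sub>R PR j (Suc m - j) w) = PR 0 (Suc m) u" .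
  \<comment> \<open>On the range of (1 + T^2)^(-m-1) all powers of T up to m are defined, so p[T]
    can be evaluated term by term before the resolvents are cancelled.\<close>
  have "op_poly p T ((A \<i> ^^ Suc m) w) = Some (\<Sum>j\<le>m. ?c j *\<^sub>R PR j (Suc m - j) w)"
    unfolding PR_apply
    by (rule op_poly_SomeI[OF m_def[symmetric]], rule op_pow_A_funpow[OF X_resolvent[OF X_i]]) simp
  also have "\<dots> = Some ((A \<i> ^^ Suc m) u)" unfolding eq by (simp only: PR_apply funpow_0)
  finally have "op_poly p T w = Some u"
    by (rule op_poly_cancel_funpow[OF X_resolvent[OF X_i] p])
  then show ?thesis by (simp only: w_def u_def g_def[abs_def])
qed

end


section \<open>Bisectorial operators\<close>

lemma D_sect_real:
  assumes "s \<in> D_sect \<omega>" "0 < \<omega>" "\<omega> < pi / 2"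
  shows "cos \<omega> * norm s < \<bar>cl_real s\<bar>"
proof -
  obtain r J \<phi> where s: "s = cl_polar r J \<phi>" "0 < r" "J \<in> imag_units" "\<phi> \<in> I_sect \<omega>"
    using assms(1) by (auto simp: D_sect_def)
  have "cl_polar r J \<phi> = slice_point J (r * cos \<phi>) (r * sin \<phi>)"
    by (simp add: cl_polar_eq_slice_emb slice_emb_def)
  moreover have "norm (cl_polar r J \<phi>) = r"
    using s by (simp add: cl_polar_eq_slice_emb norm_slice_emb norm_mult)
  moreover have *: "cos \<omega> < cos x" if "\<bar>x\<bar> < \<omega>" for x
    using cos_monotone_0_pi[of "\<bar>x\<bar>" \<omega>] that assms by (simp add: cos_abs_real)
  have "cos \<omega> < \<bar>cos \<phi>\<bar>"
  proof (cases "\<bar>\<phi>\<bar> < \<omega>")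
    case True
    then show ?thesis using *[of \<phi>] by linarith
  next
    case False
    then have "\<bar>\<phi> - pi\<bar> < \<omega>" using s(4) by (auto simp: I_sect_def)
    from *[OF this] show ?thesis by (simp add: cos_diff)
  qed
  ultimately show ?thesis
    using s by (simp add: cl_real_slice_point abs_mult mult.commute)
qed

text \<open>The nonstrict form of the inequality describes a closed set containing the
  sector.\<close>

lemma closure_D_sect_real:
  assumes "s \<in> closure (D_sect \<omega>)" "0 < \<omega>" "\<omega> < pi / 2"
  shows "cos \<omega> * norm s \<le> \<bar>cl_real s\<bar>"
proof -
  have cl_real: "cl_real = (\<lambda>s :: 'a clifford. inner s (cl_basis {}))"
    by (simp add: fun_eq_iff cl_real_def inner_cl_basis_right)
  have "closed {s :: 'a clifford. cos \<omega> * norm s \<le> \<bar>cl_real s\<bar>}"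
    unfolding cl_real by (intro closed_Collect_le continuous_intros)
  moreover have "D_sect \<omega> \<subseteq> {s :: 'a clifford. cos \<omega> * norm s \<le> \<bar>cl_real s\<bar>}"
    using D_sect_real[OF _ assms(2,3)] less_imp_le by blast
  ultimately show ?thesis using closure_minimal assms(1) by blast
qed

lemma bisectorial_sector_calculus:
  fixes T :: "('v::banach, 'n::{finite,linorder}) cl_module \<rightharpoonup> ('v, 'n) cl_module"
  assumes T: "bisectorial \<omega> T" and \<phi>: "\<omega> < \<phi>" "\<phi> < pi / 2" and J: "J \<in> imag_units"
  obtains C where "sector_calculus T J {z. z \<noteq> 0 \<and> \<bar>Re z\<bar> \<le> cos \<phi> * norm z} C \<phi>"
proof -
  let ?X = "{z. z \<noteq> 0 \<and> \<bar>Re z\<bar> \<le> cos \<phi> * norm z}"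
  have T': "T \<in> closed_ops" "0 < \<omega>" "\<omega> < pi / 2" "S_spectrum T \<subseteq> closure (D_sect \<omega>)"
    using T by (auto simp: bisectorial_def)
  obtain C where C: "\<And>s. s \<in> paravectors - (D_sect \<phi> \<union> {0}) \<Longrightarrow>
      bounded_linear (S_L_inv s T) \<and> onorm (S_L_inv s T) \<le> C / norm s"
    using T \<phi> unfolding bisectorial_def by (metis greaterThanLessThan_iff)
  have cos: "0 < cos \<phi>" "cos \<phi> < cos \<omega>" "cos \<phi> < 1"
    using \<phi> T'(2) cos_gt_zero_pi[of \<phi>] cos_monotone_0_pi[of \<omega> \<phi>] cos_monotone_0_pi[of 0 \<phi>] by auto
  interpret slice_resolvent T J by unfold_locales (use T' J in auto)
  have re: "cl_real (e z) = Re z" and para: "e z \<in> paravectors" and nrm: "norm (e z) = norm z" for z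
    using J by (simp_all add: slice_emb_def cl_real_slice_point slice_point_paravector norm_slice_point cmod_def)
  \<comment> \<open>The strict gap between cos \<phi> and cos \<omega> keeps even the rays of angle
    \<phi> out of the closed sector of angle \<omega>.\<close>
  have X\<rho>: "z \<in> \<rho>" if "z \<in> ?X" for z
  proof -
    have "\<bar>Re z\<bar> < cos \<omega> * norm z"
      using that cos(2) by (auto intro: le_less_trans mult_strict_right_mono)
    then have "e z \<notin> closure (D_sect \<omega>)"
      using closure_D_sect_real[of "e z", OF _ T'(2,3)] by (auto simp: re nrm)
    then show ?thesis using T'(4) para[of z] by (auto simp: S_spectrum_def \<rho>_def)
  qed
  have XS: "bounded_linear (S z) \<and> onorm (S z) \<le> C / norm z" if "z \<in> ?X" for z
  proof -
    \<comment> \<open>\<open>D_sect\<close> excludes its boundary rays, so the resolvent estimate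
      for \<phi> itself holds along the path of integration.\<close>
    have "e z \<notin> D_sect \<phi>"
      using D_sect_real[of "e z" \<phi>] that T'(2) \<phi> by (auto simp: re nrm)
    moreover have "e z \<noteq> 0" using that nrm[of z] by auto
    ultimately show ?thesis using C[of "e z"] para[of z] by (simp add: S_def nrm)
  qed
  have Im: "Im z \<noteq> 0" if "z \<in> ?X" for z
  proof
    assume "Im z = 0"
    then have "\<bar>Re z\<bar> \<le> cos \<phi> * \<bar>Re z\<bar>" "Re z \<noteq> 0" using that by (auto simp: cmod_def complex_eq_iff)
    then show False using cos(3) by simp
  qed
  have "sector_calculus T J ?X C \<phi>"
    by (intro sector_calculus.intro slice_resolvent_bound.intro slice_resolvent_bound_axioms.intro
        sector_calculus_axioms.intro slice_resolvent_axioms) (use X\<rho> XS Im cos \<phi> T'(2) in auto)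
  then show thesis by (rule that)
qed

theorem proposition4p9:
  fixes T :: "('v::banach, 'n::{finite,linorder}) cl_module \<rightharpoonup> ('v, 'n) cl_module"
    and f :: "'n clifford \<Rightarrow> 'n clifford"
    and p :: "real poly"
    and m :: nat
    and \<omega> \<theta> \<phi> :: real
    and J :: "'n clifford"
  assumes "0 < \<omega>" and "\<omega> < pi / 2"
    and "bisectorial \<omega> T"
    and "\<omega> < \<theta>" and "\<theta> < pi / 2"
    and "p \<noteq> 0" and "degree p = m"
    and "f \<in> SH_Lbnd \<theta>"
    and "(\<lambda>s. cl_poly p s * f s) \<in> SH_Lbnd \<theta>"
    and "\<omega> < \<phi>" and "\<phi> < \<theta>" and "J \<in> imag_units"
  shows "range (ext_calc \<theta> \<phi> J T f) \<subseteq> dom (op_pow T m) \<and>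
    (\<lambda>v. Some (ext_calc \<theta> \<phi> J T (\<lambda>s. cl_poly p s * f s) v)) =
      op_poly p T \<circ>\<^sub>m (\<lambda>v. Some (ext_calc \<theta> \<phi> J T f v))"
proof -
  obtain C where "sector_calculus T J {z. z \<noteq> 0 \<and> \<bar>Re z\<bar> \<le> cos \<phi> * norm z} C \<phi>"
    using bisectorial_sector_calculus[of \<omega> T \<phi> J] assms by auto
  then interpret sector_calculus T J "{z. z \<noteq> 0 \<and> \<bar>Re z\<bar> \<le> cos \<phi> * norm z}" C \<phi> .
  have eq: "op_poly p T (ext_calc \<theta> \<phi> J T f v) = Some (ext_calc \<theta> \<phi> J T (\<lambda>s. cl_poly p s * f s) v)" for v
    by (rule op_poly_ext_calc) (use assms in auto)
  \<comment> \<open>p[T] has the domain of T^m, so definedness in the equation above is already the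
    inclusion of the range.\<close>
  have "ext_calc \<theta> \<phi> J T f v \<in> dom (op_pow T m)" for v
    using eq[of v] \<open>degree p = m\<close> by (simp add: op_poly_eq_Some_iff)
  then show ?thesis by (auto simp: map_comp_def fun_eq_iff eq)
qed

end
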